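(* Let $V$ be a simple vertex operator algebra with central charge $c$ such that $V_0=\mathbb C\mathbf 1$, $L(1)V_1=0$ and $c>1$. Then $V$ is a completely reducible module for the Virasoro algebra.
   Context: A vertex operator algebra $V=(V,Y,\mathbf 1,\omega)$ is graded by $L(0)$-eigenvalues, $V=\bigoplus_{n\in\mathbb Z}V_n$, where $Y(\omega,z)=\sum_{n\in\mathbb Z}L(n)z^{-n-2}$ and the $L(n)$ satisfy the Virasoro relations with central charge $c$. $V$ is regarded as a module for the Virasoro algebra via the operators $L(n)$. *)

theory Defs
  imports Complex_Main "HOL-Library.Groups_Big_Fun"
begin

text \<open>
  Complex vector spaces are given by a scalar multiplication on a whole type,
  as in the library locale \<^locale>\<open>vector_space\<close>.
\<close>

context vector_space
begin

definition internal_direct_sum :: "'i set \<Rightarrow> ('i \<Rightarrow> 'b set) \<Rightarrow> bool" where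
  "internal_direct_sum I W \<longleftrightarrow>
     (\<forall>i\<in>I. subspace (W i)) \<and>
     (\<forall>v. \<exists>!f. (\<forall>i\<in>I. f i \<in> W i) \<and> (\<forall>i. i \<notin> I \<longrightarrow> f i = 0) \<and>
               finite {i. f i \<noteq> 0} \<and> v = (\<Sum>i | f i \<noteq> 0. f i))"

end


text \<open>
  A module of central charge \<open>c\<close> for the Virasoro algebra: the central element acts as the
  scalar \<open>c\<close>, so submodules are the subspaces stable under all \<open>L n\<close>.
\<close>

locale virasoro_module = vector_space scale
  for scale :: "complex \<Rightarrow> 'v::ab_group_add \<Rightarrow> 'v" +
  fixes L :: "int \<Rightarrow> 'v \<Rightarrow> 'v" and c :: complex
  assumes linear_L: "Vector_Spaces.linear scale scale (L n)"
    and virasoro_relation: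
      "L m (L n v) - L n (L m v) =
         scale (of_int (m - n)) (L (m + n) v) +
         (if m + n = 0 then scale (of_int (m ^ 3 - m) / 12 * c) v else 0)"
begin

definition weight_space :: "int \<Rightarrow> 'v set" where
  "weight_space n = {v. L 0 v = scale (of_int n) v}"

definition submodule :: "'v set \<Rightarrow> bool" where
  "submodule W \<longleftrightarrow> subspace W \<and> (\<forall>n. \<forall>w\<in>W. L n w \<in> W)"

definition irreducible_submodule :: "'v set \<Rightarrow> bool" where
  "irreducible_submodule W \<longleftrightarrow>
     submodule W \<and> W \<noteq> {0} \<and> (\<forall>U. submodule U \<and> U \<subseteq> W \<longrightarrow> U = {0} \<or> U = W)"

text \<open>
  Distinct summands of a direct sum of nonzero submodules are different sets, so the family
  of summands can be indexed by itself.
\<close>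

definition completely_reducible :: bool where
  "completely_reducible \<longleftrightarrow>
     (\<exists>S. (\<forall>W\<in>S. irreducible_submodule W) \<and> internal_direct_sum S (\<lambda>W. W))"

end


text \<open>
  \<open>Y u n v\<close> is the mode \<open>u\<^sub>n v\<close>, where \<open>Y(u,z) = \<Sum>\<^sub>n u\<^sub>n z\<^sup>-\<^sup>n\<^sup>-\<^sup>1\<close>.  The axiom \<open>jacobi\<close> equates
  the coefficients of \<open>z\<^sub>0\<^sup>-\<^sup>l\<^sup>-\<^sup>1 z\<^sub>1\<^sup>-\<^sup>m\<^sup>-\<^sup>1 z\<^sub>2\<^sup>-\<^sup>n\<^sup>-\<^sup>1\<close> in the Jacobi identity
  applied to \<open>w\<close>.  All sums over \<open>i :: nat\<close> in it have finite support by \<open>truncation\<close>, so that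
  \<^const>\<open>Sum_any\<close> is the intended sum.
\<close>

locale vertex_algebra = vector_space scale
  for scale :: "complex \<Rightarrow> 'v::ab_group_add \<Rightarrow> 'v" +
  fixes Y :: "'v \<Rightarrow> int \<Rightarrow> 'v \<Rightarrow> 'v" and vac :: 'v
  assumes linear_left: "Vector_Spaces.linear scale scale (\<lambda>u. Y u n v)"
    and linear_right: "Vector_Spaces.linear scale scale (\<lambda>v. Y u n v)"
    and truncation: "\<exists>N. \<forall>n\<ge>N. Y u n v = 0"
    and vacuum: "Y vac n v = (if n = -1 then v else 0)"
    and creation: "Y u (-1) vac = u" "n \<ge> 0 \<Longrightarrow> Y u n vac = 0"
    and jacobi:
      "Sum_any (\<lambda>i::nat. scale ((-1) ^ i * (of_int l gchoose i)) (Y u (m + l - int i) (Y v (n + int i) w)))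
       - scale ((-1) powi l)
           (Sum_any (\<lambda>i::nat. scale ((-1) ^ i * (of_int l gchoose i)) (Y v (n + l - int i) (Y u (m + int i) w))))
       = Sum_any (\<lambda>i::nat. scale (of_int m gchoose i) (Y (Y u (l + int i) v) (m + n - int i) w))"
begin

text \<open>
  Submodules of the adjoint module.  They are automatically two-sided ideals by skew-symmetry,
  and automatically graded when a conformal vector is present.
\<close>

definition ideal :: "'v set \<Rightarrow> bool" where
  "ideal W \<longleftrightarrow> subspace W \<and> (\<forall>u n. \<forall>w\<in>W. Y u n w \<in> W)"

definition simple :: bool where
  "simple \<longleftrightarrow> (UNIV :: 'v set) \<noteq> {0} \<and> (\<forall>W. ideal W \<longrightarrow> W = {0} \<or> W = UNIV)"

end


text \<open>The index shift is due to \<open>Y(\<omega>,z) = \<Sum>\<^sub>n L(n) z\<^sup>-\<^sup>n\<^sup>-\<^sup>2\<close>, that is, \<open>L(n) = \<omega>\<^sub>n\<^sub>+\<^sub>1\<close>.\<close>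

definition virasoro_mode :: "('v \<Rightarrow> int \<Rightarrow> 'v \<Rightarrow> 'v) \<Rightarrow> 'v \<Rightarrow> int \<Rightarrow> 'v \<Rightarrow> 'v" where
  "virasoro_mode Y \<omega> n = Y \<omega> (n + 1)"

locale vertex_operator_algebra =
  vertex_algebra scale Y vac + virasoro_module scale "virasoro_mode Y \<omega>" c
  for scale :: "complex \<Rightarrow> 'v::ab_group_add \<Rightarrow> 'v"
    and Y :: "'v \<Rightarrow> int \<Rightarrow> 'v \<Rightarrow> 'v" and vac \<omega> :: 'v and c :: complex +
  assumes translation: "Y (virasoro_mode Y \<omega> (-1) u) n v = scale (- of_int n) (Y u (n - 1) v)"
    and grading: "internal_direct_sum UNIV weight_space"
    and finite_dimensional_weight_space: "\<exists>B. finite B \<and> weight_space n = span B"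
    and weights_bounded_below: "\<exists>N. \<forall>n<N. weight_space n = {0}"

end

theory Submission
  imports Defs "HOL-Library.Multiset" "HOL-Library.Function_Algebras" "HOL-Library.Product_Plus"
begin

text \<open>
  The theorem is reduced to one about graded Virasoro modules.  If a vector \<open>u\<close> satisfies \<open>u\<^sub>i = 0\<close> for
  all \<open>i \<ge> 0\<close>, then the modes of \<open>u\<close> commute with those of \<open>\<omega>\<close>,
  which implies \<open>L(0) u = 0\<close>.
  Hence neither \<open>L(-1) u = 0\<close> nor \<open>L(-1) u \<in> \<complex>\<one>\<close> is possible for a nonzero \<open>u\<close> of nonzero weight, and as
  \<open>V\<^sub>0 = \<complex>\<one>\<close> there are no negative weights.  What remains is a module with weights \<open>0, 1, 2, \<dots>\<close>
  such that \<open>L(-1) V\<^sub>0 = 0\<close> and \<open>L(1) V\<^sub>1 = 0\<close>.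

  A homogeneous vector \<open>v\<close> of weight \<open>h\<close> killed by all \<open>L(k)\<close>, \<open>k > 0\<close>, generates a submodule that is
  spanned by the words \<open>L(-k\<^sub>r) \<cdots> L(-k\<^sub>1) v\<close> with \<open>k\<^sub>1 \<le> \<cdots> \<le> k\<^sub>r\<close>; for \<open>h = 0\<close> the words with a
  part \<open>1\<close> vanish.  The Gram matrix of such a vector has the entries \<open>g \<kappa> \<iota>\<close> defined by
  \<open>L(k\<^sub>1) \<cdots> L(k\<^sub>r) L(-l\<^sub>s) \<cdots> L(-l\<^sub>1) v = g \<kappa> \<iota> v\<close>, where \<open>\<kappa>\<close> and \<open>\<iota>\<close> are partitions of the same
  number, without parts \<open>1\<close> if \<open>h = 0\<close>.  It depends on \<open>c\<close> and \<open>h\<close> only, and everything follows from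
  its invertibility for \<open>c > 1\<close> (\<open>gram_nondegenerate\<close>): a nonzero element of the submodule can be sent back to
  \<open>v\<close>, so the submodule is irreducible; its words are independent; and a vector of it can be
  prescribed by its images under the \<open>L(k\<^sub>1) \<cdots> L(k\<^sub>r)\<close>, so that every vector of \<open>V\<close> can be corrected
  by words of lower highest weight vectors until it is itself killed by all \<open>L(k)\<close>, \<open>k > 0\<close>.

  The invertibility is usually read off the Kac determinant.  Here it is derived from a positivity
  argument in the Fock space of one free boson \<open>a\<^sub>n\<close> with the background charge that produces \<open>c\<close>:
  \<open>L(m) = 1/2 \<Sum>\<^sub>j a\<^bsub>m-j\<^esub> a\<^sub>j + m \<beta> a\<^sub>m\<close> with \<open>\<beta> = i\<theta>\<close>, \<open>c = 1 + 12\<theta>\<^sup>2\<close>, and \<open>a\<^sub>0 = \<mu>\<close> with \<open>\<mu>\<^sup>2 = 2h - \<theta>\<^sup>2\<close>.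
  Suppose that \<open>L(k) x = 0\<close> for all \<open>k > 0\<close>, and take the Hermitian form for which the adjoint of
  \<open>a\<^bsub>-k\<^esub>\<close> is \<open>a\<^sub>k / 2\<close>.  In \<open>0 = \<Sum>\<^sub>k \<langle>a\<^sub>k x, L(k) x\<rangle>\<close> the cubic terms add up to half the sum of a
  number and its conjugate, so that the imaginary part is \<open>\<Sum>\<^sub>k (Im \<mu> + k\<theta>) \<parallel>a\<^sub>k x\<parallel>\<^sup>2 = 0\<close>
  (\<open>fock_singular_annihilated\<close>).  For \<open>h > 0\<close> one has \<open>\<bar>Im \<mu>\<bar> < \<theta>\<close>, and \<open>x\<close> is a multiple of the vacuum.
  Thus the functionals \<open>x \<mapsto> (L(k\<^sub>1) \<cdots> L(k\<^sub>r) x)\<close> read at the vacuum separate the Fock space.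
  Transposition replaces \<open>\<theta>\<close> by \<open>-\<theta>\<close>, so by the same identity the words \<open>L(-k\<^sub>r) \<cdots> L(-k\<^sub>1)\<close>
  generate the Fock space from its vacuum.  There are as many of them as
  monomials \<open>a\<^bsub>-k\<^sub>r\<^esub> \<cdots> a\<^bsub>-k\<^sub>1\<^esub>\<close>, so they form a basis.  For \<open>h = 0\<close> the borderline value
  \<open>\<mu> = i\<theta>\<close> is chosen, which makes \<open>L(-1)\<close> kill the vacuum; there the second generator
  \<open>a\<^bsub>-1\<^esub>\<close> on the vacuum replaces the missing words.
\<close>

section \<open>Square linear systems\<close>

lemma sum_apply_fun: "(\<Sum>i\<in>I. f i) x = (\<Sum>i\<in>I. (f i x :: 'a::comm_monoid_add))"
  by (induction I rule: infinite_finite_induct) auto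

definition nondegenerate_on :: "'i set \<Rightarrow> ('i \<Rightarrow> 'i \<Rightarrow> 'a::field) \<Rightarrow> bool" where
  "nondegenerate_on I G \<longleftrightarrow>
     (\<forall>b. (\<forall>i\<in>I. (\<Sum>j\<in>I. G i j * b j) = 0) \<longrightarrow> (\<forall>j\<in>I. b j = 0))"

text \<open>
  The columns of \<open>G\<close> are independent and as many as the unit vectors, so an inhomogeneity outside
  their span would give too many independent vectors.
\<close>
lemma nondegenerate_on_solvable:
  fixes G :: "'i \<Rightarrow> 'i \<Rightarrow> 'a::field"
  assumes fin: "finite I" and nd: "nondegenerate_on I G"
  shows "\<exists>b. \<forall>i\<in>I. (\<Sum>j\<in>I. G i j * b j) = \<phi> i"
proof -
  interpret F: vector_space "\<lambda>(c::'a) (f::'i \<Rightarrow> 'a) x. c * f x"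
    by unfold_locales (auto simp: algebra_simps fun_eq_iff)
  define C where "C j = (\<lambda>i. if i \<in> I then G i j else 0)" for j
  define e where "e j = (\<lambda>i. if i = j then 1 else 0 :: 'a)" for j :: 'i
  have comb: "f = (\<Sum>j\<in>I. (\<lambda>x. f j * e j x))" if "\<And>i. i \<notin> I \<Longrightarrow> f i = 0" for f
    using that fin by (auto simp: fun_eq_iff sum_apply_fun e_def if_distrib cong: if_cong)
  have inspan: "f \<in> F.span (e ` I)" if "\<And>i. i \<notin> I \<Longrightarrow> f i = 0" for f
    by (subst comb[OF that], assumption) (intro F.span_sum F.span_scale F.span_base, auto)
  have inj: "inj_on C I"
  proof (rule inj_onI, rule ccontr)
    fix j k assume jk: "j \<in> I" "k \<in> I" "C j = C k" "j \<noteq> k"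
    define b where "b i = (if i = j then 1 else if i = k then -1 else 0 :: 'a)" for i
    have "(\<Sum>l\<in>I. G i l * b l) = G i j - G i k" for i
    proof -
      have "(\<Sum>l\<in>I. G i l * b l) = (\<Sum>l\<in>I. (if l = j then G i j else 0) - (if l = k then G i k else 0))"
        by (rule sum.cong) (auto simp: b_def jk)
      then show ?thesis using fin jk by (simp add: sum_subtractf)
    qed
    moreover have "G i j = G i k" if "i \<in> I" for i
      using fun_cong[OF jk(3), of i] that by (simp add: C_def)
    ultimately have "\<forall>j\<in>I. b j = 0" using nd unfolding nondegenerate_on_def by simp
    with jk(1) show False by (auto simp: b_def)
  qed
  have ind: "F.independent (C ` I)"
  proof (rule F.independent_if_scalars_zero)
    show "finite (C ` I)" using fin by simp
    fix f x assume s: "(\<Sum>x\<in>C ` I. (\<lambda>i. f x * x i)) = 0" and x: "x \<in> C ` I"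
    have "(\<Sum>j\<in>I. G i j * f (C j)) = 0" if "i \<in> I" for i
    proof -
      have "(\<Sum>x\<in>C ` I. f x * x i) = 0"
        using fun_cong[OF s, of i] by (simp add: sum_apply_fun)
      then have "0 = (\<Sum>j\<in>I. f (C j) * C j i)" by (simp add: sum.reindex[OF inj])
      also have "(\<Sum>j\<in>I. f (C j) * C j i) = (\<Sum>j\<in>I. G i j * f (C j))"
        by (rule sum.cong) (use that in \<open>simp_all add: C_def[of _, THEN fun_cong]\<close>)
      finally show ?thesis by simp
    qed
    then show "f x = 0" using nd x unfolding nondegenerate_on_def by (auto dest!: spec[of _ "\<lambda>j. f (C j)"])
  qed
  define f where "f i = (if i \<in> I then \<phi> i else 0)" for i
  have "f \<in> F.span (C ` I)"
  proof (rule ccontr)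
    assume f: "f \<notin> F.span (C ` I)"
    have ind': "F.independent (insert f (C ` I))"
      using ind f by (simp add: F.independent_insertI)
    have sub: "insert f (C ` I) \<subseteq> F.span (e ` I)"
      by (auto intro!: inspan simp: C_def f_def)
    have "card (insert f (C ` I)) \<le> card (e ` I)"
      using F.independent_span_bound[OF finite_imageI[OF fin] ind' sub] by simp
    also have "\<dots> \<le> card I" by (rule card_image_le[OF fin])
    finally show False using f fin card_image[OF inj] F.span_base[of f "C ` I"]
      by (auto simp: card_insert_if split: if_splits)
  qed
  then obtain u where "f = (\<Sum>v\<in>C ` I. (\<lambda>x. u v * v x))"
    using F.span_finite[of "C ` I"] fin by auto
  then have f: "f = (\<Sum>j\<in>I. (\<lambda>x. u (C j) * C j x))" by (simp add: sum.reindex[OF inj])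
  have "(\<Sum>j\<in>I. G i j * u (C j)) = \<phi> i" if "i \<in> I" for i
  proof -
    have "\<phi> i = (\<Sum>j\<in>I. u (C j) * C j i)"
      using fun_cong[OF f, of i] that by (simp add: sum_apply_fun f_def)
    also have "\<dots> = (\<Sum>j\<in>I. G i j * u (C j))"
      by (rule sum.cong) (use that in \<open>simp_all add: C_def[of _, THEN fun_cong]\<close>)
    finally show ?thesis by simp
  qed
  then show ?thesis by (intro exI[of _ "\<lambda>j. u (C j)"] ballI)
qed

lemma nondegenerate_on_transpose:
  fixes G :: "'i \<Rightarrow> 'i \<Rightarrow> 'a::field"
  assumes fin: "finite I" and nd: "nondegenerate_on I G"
  shows "nondegenerate_on I (\<lambda>i j. G j i)"
  unfolding nondegenerate_on_def
proof (intro allI impI ballI)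
  fix b k assume b: "\<forall>i\<in>I. (\<Sum>j\<in>I. G j i * b j) = 0" and k: "k \<in> I"
  from nondegenerate_on_solvable[OF assms, of "\<lambda>i. if i = k then 1 else 0"] obtain x
    where x: "\<And>i. i \<in> I \<Longrightarrow> (\<Sum>j\<in>I. G i j * x j) = (if i = k then 1 else 0)" by auto
  have "b k = (\<Sum>i\<in>I. b i * (if i = k then 1 else 0))"
    using fin k by (simp add: if_distrib cong: if_cong)
  also have "\<dots> = (\<Sum>i\<in>I. b i * (\<Sum>j\<in>I. G i j * x j))" using x by simp
  also have "\<dots> = (\<Sum>i\<in>I. \<Sum>j\<in>I. x j * (G i j * b i))" by (simp add: sum_distrib_left algebra_simps)
  also have "\<dots> = (\<Sum>j\<in>I. x j * (\<Sum>i\<in>I. G i j * b i))" by (subst sum.swap) (simp add: sum_distrib_left)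
  also have "\<dots> = 0" using b by simp
  finally show "b k = 0" .
qed

section \<open>Ordered words in half of the Witt algebra\<close>

text \<open>
  Partitions are encoded as multisets of natural numbers in which an element \<open>i\<close> stands for the
  part \<open>i + 1\<close>; in this way every multiset is a partition, and \<open>level\<close> is the number that it
  partitions.
\<close>
definition level :: "nat multiset \<Rightarrow> nat" where
  "level \<kappa> = size \<kappa> + sum_mset \<kappa>"

lemma level_simps [simp]:
  "level {#} = 0" "level (add_mset i \<kappa>) = Suc i + level \<kappa>"
  by (auto simp: level_def)

lemma level_eq_0_iff [simp]: "level \<kappa> = 0 \<longleftrightarrow> \<kappa> = {#}"
  by (auto simp: level_def)

lemma level_member: "i \<in># \<kappa> \<Longrightarrow> Suc i \<le> level \<kappa>"
  by (metis le_add1 level_simps(2) multi_member_split)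

lemma finite_level: "finite {\<kappa>. level \<kappa> = m}"
proof (rule finite_subset)
  show "{\<kappa>. level \<kappa> = m} \<subseteq> mset ` {xs. set xs \<subseteq> {..m} \<and> length xs \<le> m}"
  proof
    fix \<kappa> assume "\<kappa> \<in> {\<kappa>. level \<kappa> = m}"
    then have m: "level \<kappa> = m" by simp
    obtain xs where xs: "mset xs = \<kappa>" using ex_mset by blast
    have "set xs \<subseteq> {..m}" using level_member[of _ \<kappa>] m xs by (force simp: Suc_le_eq)
    moreover have "length xs \<le> m" using m xs by (auto simp: level_def)
    ultimately show "\<kappa> \<in> mset ` {xs. set xs \<subseteq> {..m} \<and> length xs \<le> m}" using xs by auto
  qed
  show "finite (mset ` {xs. set xs \<subseteq> {..m} \<and> length xs \<le> m})"
    by (intro finite_imageI finite_lists_length_le) auto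
qed

lemma sorted_list_of_multiset_add_max:
  assumes "\<forall>i\<in>#\<kappa>. i \<le> (k::nat)"
  shows "sorted_list_of_multiset (add_mset k \<kappa>) = sorted_list_of_multiset \<kappa> @ [k]"
proof -
  have "mset (sorted_list_of_multiset \<kappa> @ [k]) = add_mset k \<kappa>" by simp
  moreover have "sorted (sorted_list_of_multiset \<kappa> @ [k])"
    using assms by (simp add: sorted_append)
  ultimately show ?thesis
    using sorted_list_of_multiset_mset[of "sorted_list_of_multiset \<kappa> @ [k]"] sorted_sort_id by metis
qed

lemma multiset_max_induct [case_names empty add]:
  fixes \<kappa> :: "nat multiset"
  assumes "P {#}" "\<And>\<kappa> k. \<forall>i\<in>#\<kappa>. i \<le> k \<Longrightarrow> P \<kappa> \<Longrightarrow> P (add_mset k \<kappa>)"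
  shows "P \<kappa>"
proof (induction "size \<kappa>" arbitrary: \<kappa>)
  case 0 then show ?case using assms by simp
next
  case (Suc n)
  then have "\<kappa> \<noteq> {#}" by auto
  then have mem: "Max_mset \<kappa> \<in># \<kappa>" by simp
  define m where "m = Max_mset \<kappa>"
  from multi_member_split[OF mem] obtain \<iota> where \<iota>': "\<kappa> = add_mset m \<iota>" unfolding m_def ..
  have m: "\<forall>i\<in>#\<kappa>. i \<le> m" by (simp add: m_def)
  from m have "\<forall>i\<in>#\<iota>. i \<le> m" by (subst (asm) \<iota>') simp
  moreover have "P \<iota>" using Suc \<iota>' by simp
  ultimately show ?case using \<iota>' assms(2) by simp
qed

lemma multiset_max_cases:
  assumes "\<kappa> \<noteq> {#}"
  obtains k \<iota> where "\<kappa> = add_mset (k::nat) \<iota>" "\<forall>i\<in>#\<iota>. i \<le> k"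
  using assms by (induction \<kappa> rule: multiset_max_induct) auto

text \<open>The smallest part acts first.\<close>
definition pbw_word :: "(nat \<Rightarrow> 'v \<Rightarrow> 'v) \<Rightarrow> nat multiset \<Rightarrow> 'v \<Rightarrow> 'v" where
  "pbw_word A \<kappa> v = fold A (sorted_list_of_multiset \<kappa>) v"

lemma pbw_word_empty [simp]: "pbw_word A {#} v = v"
  by (simp add: pbw_word_def)

lemma pbw_word_add_max: "\<forall>i\<in>#\<kappa>. i \<le> k \<Longrightarrow> pbw_word A (add_mset k \<kappa>) v = A k (pbw_word A \<kappa> v)"
  by (simp add: pbw_word_def sorted_list_of_multiset_add_max del: sorted_list_of_multiset_insert)

text \<open>
  The relations of the Lie algebra spanned by the \<open>L(-k)\<close> with \<open>k > 0\<close>, where \<open>A i\<close> is in the place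
  of \<open>L(-i-1)\<close>.  They are required only on \<open>X\<close> because the second instance of the locale, the action on functionals
  by composition, satisfies them on the linear functionals only.
\<close>
locale witt_half = vector_space scale
  for scale :: "complex \<Rightarrow> 'v::ab_group_add \<Rightarrow> 'v" +
  fixes A :: "nat \<Rightarrow> 'v \<Rightarrow> 'v" and X :: "'v set"
  assumes linear_A: "Vector_Spaces.linear scale scale (A i)"
    and A_closed: "v \<in> X \<Longrightarrow> A i v \<in> X"
    and A_commutator: "v \<in> X \<Longrightarrow> A i (A j v) - A j (A i v) = scale (of_int (int j - int i)) (A (Suc (i + j)) v)"
begin

sublocale pair: vector_space_pair scale scale ..

lemmas A_add = pair.linear_add[OF linear_A]
  and A_scale = pair.linear_scale[OF linear_A]
  and A_diff = pair.linear_diff[OF linear_A]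
  and A_zero = pair.linear_0[OF linear_A]

abbreviation word :: "nat multiset \<Rightarrow> 'v \<Rightarrow> 'v" where
  "word \<equiv> pbw_word A"

lemma word_closed: "v \<in> X \<Longrightarrow> word \<kappa> v \<in> X"
  by (induction \<kappa> rule: multiset_max_induct) (auto simp: pbw_word_add_max A_closed)

lemma A_span: "(\<And>x. x \<in> S \<Longrightarrow> A k x \<in> span T) \<Longrightarrow> y \<in> span S \<Longrightarrow> A k y \<in> span T"
  by (erule span_induct_alt) (auto simp: A_zero A_add A_scale span_zero span_add span_scale)

text \<open>
  The spanning half of the Poincare-Birkhoff-Witt theorem: an operator can be moved to its place in
  an ordered word at the cost of shorter words of the same level.
\<close>
lemma word_straighten:
  assumes v: "v \<in> X"
  shows "A k (word \<kappa> v) - word (add_mset k \<kappa>) v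
     \<in> span {word \<iota> v | \<iota>. size \<iota> \<le> size \<kappa> \<and> level \<iota> = Suc k + level \<kappa>}"
proof (induction "size \<kappa>" arbitrary: k \<kappa> rule: less_induct)
  case less
  let ?T = "\<lambda>n m. {word \<iota> v | \<iota>. size \<iota> \<le> n \<and> level \<iota> = m}"
  show ?case
  proof (cases "\<forall>i\<in>#\<kappa>. i \<le> k")
    case True
    then show ?thesis by (simp add: pbw_word_add_max span_zero)
  next
    case False
    define m where "m = Max_mset \<kappa>"
    have "\<kappa> \<noteq> {#}" using False by auto
    then have "m \<in># \<kappa>" by (simp add: m_def)
    from multi_member_split[OF this] obtain \<mu> where \<mu>: "\<kappa> = add_mset m \<mu>" ..
    have max: "\<forall>i\<in>#\<kappa>. i \<le> m" by (auto simp: m_def)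
    then have max': "\<forall>i\<in>#\<mu>. i \<le> m" using \<mu> by auto
    have km: "k < m" using False max by force
    \<comment> \<open>the induction hypothesis for all words that are shorter than \<open>\<kappa>\<close>\<close>
    have T: "A j x \<in> span (?T (Suc n) (Suc j + l))" if "n < size \<kappa>" "x \<in> span (?T n l)" for j n l x
    proof (rule A_span[OF _ that(2)])
      fix x assume "x \<in> ?T n l"
      then obtain \<iota> where \<iota>: "x = word \<iota> v" "size \<iota> \<le> n" "level \<iota> = l" by auto
      have "A j (word \<iota> v) - word (add_mset j \<iota>) v \<in> span (?T (size \<iota>) (Suc j + level \<iota>))"
        by (rule less) (use \<iota> that in auto)
      also have "\<dots> \<subseteq> span (?T (Suc n) (Suc j + l))"
        by (rule span_mono) (use \<iota> in auto)
      finally have "A j (word \<iota> v) - word (add_mset j \<iota>) v \<in> span (?T (Suc n) (Suc j + l))" .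
      moreover have "word (add_mset j \<iota>) v \<in> span (?T (Suc n) (Suc j + l))"
        by (rule span_base) (use \<iota> in auto)
      ultimately show "A j x \<in> span (?T (Suc n) (Suc j + l))"
        using span_add[of "A j (word \<iota> v) - word (add_mset j \<iota>) v" "?T (Suc n) (Suc j + l)" "word (add_mset j \<iota>) v"] \<iota> by simp
    qed
    let ?x = "word \<mu> v"
    define t where "t = A k ?x - word (add_mset k \<mu>) v"
    have t: "t \<in> span (?T (size \<mu>) (Suc k + level \<mu>))" unfolding t_def by (rule less) (simp add: \<mu>)
    have x: "?x \<in> span (?T (size \<mu>) (level \<mu>))" by (rule span_base) auto
    have "A m t \<in> span (?T (size \<kappa>) (Suc k + level \<kappa>))"
      using T[OF _ t, of m] by (simp add: \<mu> ac_simps)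
    moreover have "A (Suc (k + m)) ?x \<in> span (?T (size \<kappa>) (Suc k + level \<kappa>))"
      using T[OF _ x, of "Suc (k + m)"] by (simp add: \<mu> ac_simps)
    moreover have "A k (word \<kappa> v) - word (add_mset k \<kappa>) v = A m t + scale (of_int (int m - int k)) (A (Suc (k + m)) ?x)"
    proof -
      have "word (add_mset k \<kappa>) v = A m (word (add_mset k \<mu>) v)"
        using pbw_word_add_max[of "add_mset k \<mu>" m A v] max' km by (simp add: \<mu> add_mset_commute)
      moreover have "A k (word \<kappa> v) = A k (A m ?x)" using pbw_word_add_max[OF max', of A v] \<mu> by simp
      moreover have "A k (A m ?x) = A m (A k ?x) + scale (of_int (int m - int k)) (A (Suc (k + m)) ?x)"
        using A_commutator[OF word_closed[OF v], of k m] by (simp add: algebra_simps)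
      ultimately show ?thesis by (simp add: t_def A_diff)
    qed
    ultimately show ?thesis by (simp add: span_add span_scale)
  qed
qed

lemma A_word_span:
  assumes "v \<in> X" "y \<in> span {word \<iota> v | \<iota>. level \<iota> = m}"
  shows "A k y \<in> span {word \<iota> v | \<iota>. level \<iota> = Suc k + m}"
proof (rule A_span[OF _ assms(2)])
  fix x assume "x \<in> {word \<iota> v | \<iota>. level \<iota> = m}"
  then obtain \<iota> where \<iota>: "x = word \<iota> v" "level \<iota> = m" by auto
  have "A k x - word (add_mset k \<iota>) v \<in> span {word \<iota> v | \<iota>. level \<iota> = Suc k + m}"
    using word_straighten[OF assms(1), of k \<iota>] \<iota>
    by (auto elim!: subsetD[OF span_mono, rotated])
  moreover have "word (add_mset k \<iota>) v \<in> span {word \<iota> v | \<iota>. level \<iota> = Suc k + m}"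
    by (rule span_base) (use \<iota> in auto)
  ultimately show "A k x \<in> span {word \<iota> v | \<iota>. level \<iota> = Suc k + m}"
    using span_add[of "A k x - word (add_mset k \<iota>) v" _ "word (add_mset k \<iota>) v"] by simp
qed

end

section \<open>The Fock space and its Virasoro operators\<close>

text \<open>
  The Fock space consists of all complex functions on partitions, the coefficients of a possibly
  infinite sum of monomials \<open>a\<^bsub>-k\<^sub>r\<^esub> \<cdots> a\<^bsub>-k\<^sub>1\<^esub>\<close>.  Every coefficient of \<open>a\<^sub>n f\<close> and \<open>L(n) f\<close>
  depends on finitely many coefficients of \<open>f\<close>, so this completion does no harm, and it is a plain
  function type.
\<close>
definition fscale :: "complex \<Rightarrow> ('i \<Rightarrow> complex) \<Rightarrow> 'i \<Rightarrow> complex" where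
  fscale_apply [simp]: "fscale c f x = c * f x"

interpretation fun_space: vector_space fscale
  by unfold_locales (auto simp: algebra_simps fun_eq_iff)

interpretation fun_pair: vector_space_pair fscale fscale ..

lemma linear_fscaleI:
  assumes "\<And>f g. T (f + g) = T f + T g" "\<And>c f. T (fscale c f) = fscale c (T f)"
  shows "Vector_Spaces.linear fscale fscale T"
  using assms by unfold_locales auto

text \<open>The monomial of \<open>\<iota>\<close>; the empty partition gives the vacuum.\<close>
definition mono_vec :: "nat multiset \<Rightarrow> nat multiset \<Rightarrow> complex" where
  "mono_vec \<iota> \<kappa> = (if \<kappa> = \<iota> then 1 else 0)"

text \<open>
  The operators \<open>a\<^sub>n\<close> of the Heisenberg algebra: \<open>a\<^sub>-\<^sub>k\<close> multiplies by the variable of the part \<open>k\<close>,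
  \<open>a\<^sub>k\<close> is \<open>k\<close> times the derivative in this variable, and \<open>a\<^sub>0 = \<mu>\<close>.
\<close>
definition boson :: "complex \<Rightarrow> int \<Rightarrow> (nat multiset \<Rightarrow> complex) \<Rightarrow> nat multiset \<Rightarrow> complex" where
  "boson \<mu> n f \<kappa> =
     (if n = 0 then \<mu> * f \<kappa>
      else if n > 0 then of_int n * of_nat (Suc (count \<kappa> (nat n - 1))) * f (add_mset (nat n - 1) \<kappa>)
      else if nat (- n) - 1 \<in># \<kappa> then f (\<kappa> - {#nat (- n) - 1#}) else 0)"

text \<open>
  For \<open>m \<noteq> 0\<close> this is \<open>1/2 \<Sum>\<^sub>j a\<^bsub>m-j\<^esub> a\<^sub>j + m \<beta> a\<^sub>m\<close>.  The factors of each summand commute, which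
  makes normal ordering superfluous, and the range of \<open>j\<close> contains all summands that
  contribute to the coefficient at \<open>\<kappa>\<close> (\<open>boson_quadratic_eq_0\<close>).
\<close>
definition fock_L :: "complex \<Rightarrow> complex \<Rightarrow> int \<Rightarrow> (nat multiset \<Rightarrow> complex) \<Rightarrow> nat multiset \<Rightarrow> complex" where
  "fock_L \<mu> \<beta> m f \<kappa> =
     (if m = 0 then ((\<mu>\<^sup>2 - \<beta>\<^sup>2) / 2 + of_nat (level \<kappa>)) * f \<kappa>
      else (let N = \<bar>m\<bar> + int (level \<kappa>)
            in (\<Sum>j\<in>{-N..N}. boson \<mu> (m - j) (boson \<mu> j f) \<kappa>) / 2 + of_int m * \<beta> * boson \<mu> m f \<kappa>))"

text \<open>
  Each coefficient of \<open>a\<^sub>k g\<close> is a multiple of one coefficient of \<open>g\<close>.  So \<open>a\<^sub>k\<close> can be moved past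
  the sum in the definition of \<open>L(m)\<close>, whose range depends on the coefficient.
\<close>
lemma boson_pointwise:
  "\<exists>r \<kappa>'. (\<forall>g. boson \<mu> k g \<kappa> = r * g \<kappa>') \<and> (r \<noteq> 0 \<longrightarrow> int (level \<kappa>') = int (level \<kappa>) + k)
      \<and> int (level \<kappa>') \<le> int (level \<kappa>) + \<bar>k\<bar>"
proof (cases "k < 0")
  case True
  let ?i = "nat (- k) - 1"
  show ?thesis
  proof (cases "?i \<in># \<kappa>")
    case True
    from multi_member_split[OF this] obtain \<iota> where "\<kappa> = add_mset ?i \<iota>" ..
    then show ?thesis using \<open>k < 0\<close>
      by (intro exI[of _ 1] exI[of _ "\<kappa> - {#?i#}"]) (auto simp: boson_def)
  next
    case False
    then show ?thesis using \<open>k < 0\<close>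
      by (intro exI[of _ 0] exI[of _ \<kappa>]) (auto simp: boson_def)
  qed
next
  case False
  show ?thesis
  proof (cases "k = 0")
    case True then show ?thesis by (intro exI[of _ \<mu>] exI[of _ \<kappa>]) (auto simp: boson_def)
  next
    case False
    with \<open>\<not> k < 0\<close> show ?thesis
      by (intro exI[of _ "of_int k * of_nat (Suc (count \<kappa> (nat k - 1)))"] exI[of _ "add_mset (nat k - 1) \<kappa>"])
         (auto simp: boson_def)
  qed
qed

lemma boson_add: "boson \<mu> n (f + g) = boson \<mu> n f + boson \<mu> n g"
  by (auto simp: fun_eq_iff boson_def algebra_simps)

lemma boson_scale: "boson \<mu> n (fscale c f) = fscale c (boson \<mu> n f)"
  by (auto simp: fun_eq_iff boson_def)

lemma linear_boson: "Vector_Spaces.linear fscale fscale (boson \<mu> n)"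
  by (intro linear_fscaleI boson_add boson_scale)

lemmas boson_zero [simp] = fun_pair.linear_0[OF linear_boson]
  and boson_diff = fun_pair.linear_diff[OF linear_boson]

lemma boson_commutator:
  "boson \<mu> m (boson \<mu> n f) - boson \<mu> n (boson \<mu> m f) = (if m + n = 0 then fscale (of_int m) f else 0)"
proof -
  have pos: "boson \<mu> m (boson \<mu> n f) \<kappa> - boson \<mu> n (boson \<mu> m f) \<kappa> = (if m + n = 0 then of_int m * f \<kappa> else 0)"
    if "m > 0" for m n f \<kappa>
  proof (cases "n < 0")
    case True
    define i j where "i = nat m - 1" and "j = nat (- n) - 1"
    have m: "m = int i + 1" and n: "n = - int j - 1" using that True by (auto simp: i_def j_def)
    show ?thesis
    proof (cases "j \<in># \<kappa>")
      case mem: True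
      from multi_member_split[OF this] obtain \<iota> where \<iota>: "\<kappa> = add_mset j \<iota>" ..
      show ?thesis unfolding \<iota> m n
        by (auto simp: boson_def add_mset_commute algebra_simps nat_add_distrib)
    next
      case False
      then have "count \<kappa> j = 0" by (simp add: count_eq_zero_iff)
      then show ?thesis unfolding m n using False
        by (auto simp: boson_def algebra_simps nat_add_distrib)
    qed
  next
    case False
    show ?thesis
    proof (cases "m = n")
      case True then show ?thesis using that by simp
    next
      case False
      with that \<open>\<not> n < 0\<close> have "n > 0 \<Longrightarrow> nat n - 1 \<noteq> nat m - 1" by auto
      then show ?thesis using that \<open>\<not> n < 0\<close>
        by (auto simp: boson_def add_mset_commute algebra_simps)
    qed
  qed
  have "boson \<mu> m (boson \<mu> n f) \<kappa> - boson \<mu> n (boson \<mu> m f) \<kappa> = (if m + n = 0 then of_int m * f \<kappa> else 0)" for \<kappa>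
  proof (cases "m > 0 \<or> n > 0")
    case True
    then consider "m > 0" | "n > 0" by blast
    then show ?thesis
    proof cases
      case 1 then show ?thesis by (rule pos)
    next
      case 2
      show ?thesis
      proof (cases "m + n = 0")
        case True
        then have m: "m = - n" by simp
        show ?thesis using pos[OF 2, of m f \<kappa>] unfolding m by (simp add: algebra_simps)
      next
        case False
        then show ?thesis using pos[OF 2, of m f \<kappa>] by (simp add: add.commute)
      qed
    qed
  next
    case False
    show ?thesis
    proof (cases "m = 0 \<or> n = 0")
      case True then show ?thesis using False by (auto simp: boson_def)
    next
      case neg: False
      define i j where "i = nat (- m) - 1" and "j = nat (- n) - 1"
      have m: "m = - int i - 1" and n: "n = - int j - 1" using neg False by (auto simp: i_def j_def)
      show ?thesis unfolding m n
        by (cases "i = j") (auto simp: boson_def nat_add_distrib in_diff_count diff_right_commute[of \<kappa>] add_mset_commute diff_union_swap)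
    qed
  qed
  then show ?thesis by (auto simp: fun_eq_iff)
qed

lemma boson_local:
  assumes "\<And>\<kappa>'. int (level \<kappa>') = int (level \<kappa>) + n \<Longrightarrow> f \<kappa>' = g \<kappa>'"
  shows "boson \<mu> n f \<kappa> = boson \<mu> n g \<kappa>"
proof -
  obtain r \<kappa>' where "\<And>g. boson \<mu> n g \<kappa> = r * g \<kappa>'" "r \<noteq> 0 \<Longrightarrow> int (level \<kappa>') = int (level \<kappa>) + n"
    using boson_pointwise[of \<mu> n \<kappa>] by blast
  then show ?thesis using assms[of \<kappa>'] by (cases "r = 0") auto
qed

lemma boson_neg_low: "n < - int (level \<kappa>) \<Longrightarrow> boson \<mu> n f \<kappa> = 0"
  using boson_local[of \<kappa> n f 0 \<mu>] by fastforce

lemma boson_quadratic_eq_0: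
  assumes "m \<noteq> 0" "\<bar>j\<bar> > \<bar>m\<bar> + int (level \<kappa>)"
  shows "boson \<mu> (m - j) (boson \<mu> j f) \<kappa> = 0"
proof (cases "j > 0")
  case True
  then show ?thesis using assms by (intro boson_neg_low) auto
next
  case False
  have "boson \<mu> (m - j) (boson \<mu> j f) = boson \<mu> j (boson \<mu> (m - j) f)"
    using boson_commutator[of \<mu> "m - j" j f] assms(1) by simp
  moreover have "boson \<mu> j (boson \<mu> (m - j) f) \<kappa> = 0"
    using False assms by (intro boson_neg_low) auto
  ultimately show ?thesis by simp
qed

lemma fock_L_eq:
  assumes "m \<noteq> 0" "finite J" "{-(\<bar>m\<bar> + int (level \<kappa>))..\<bar>m\<bar> + int (level \<kappa>)} \<subseteq> J"
  shows "fock_L \<mu> \<beta> m f \<kappa> =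
    (\<Sum>j\<in>J. boson \<mu> (m - j) (boson \<mu> j f) \<kappa>) / 2 + of_int m * \<beta> * boson \<mu> m f \<kappa>"
proof -
  have "(\<Sum>j\<in>{-(\<bar>m\<bar> + int (level \<kappa>))..\<bar>m\<bar> + int (level \<kappa>)}. boson \<mu> (m - j) (boson \<mu> j f) \<kappa>)
      = (\<Sum>j\<in>J. boson \<mu> (m - j) (boson \<mu> j f) \<kappa>)"
    using assms by (intro sum.mono_neutral_left ballI boson_quadratic_eq_0) (auto simp: abs_if split: if_splits)
  then show ?thesis using assms(1) by (simp add: fock_L_def)
qed

lemma fock_L_add: "fock_L \<mu> \<beta> n (f + g) = fock_L \<mu> \<beta> n f + fock_L \<mu> \<beta> n g"
  by (auto simp: fun_eq_iff fock_L_def boson_add sum.distrib distrib_left add_divide_distrib Let_def)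

lemma fock_L_scale: "fock_L \<mu> \<beta> n (fscale c f) = fscale c (fock_L \<mu> \<beta> n f)"
  by (auto simp: fun_eq_iff fock_L_def boson_scale sum_distrib_left[symmetric] algebra_simps Let_def)

lemma linear_fock_L: "Vector_Spaces.linear fscale fscale (fock_L \<mu> \<beta> n)"
  by (intro linear_fscaleI fock_L_add fock_L_scale)

lemmas fock_L_zero [simp] = fun_pair.linear_0[OF linear_fock_L]
  and fock_L_diff = fun_pair.linear_diff[OF linear_fock_L]
  and fock_L_neg = fun_pair.linear_neg[OF linear_fock_L]

lemma fock_L_local:
  assumes "\<And>\<kappa>'. int (level \<kappa>') = int (level \<kappa>) + n \<Longrightarrow> f \<kappa>' = g \<kappa>'"
  shows "fock_L \<mu> \<beta> n f \<kappa> = fock_L \<mu> \<beta> n g \<kappa>"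
proof -
  have "boson \<mu> (n - j) (boson \<mu> j f) \<kappa> = boson \<mu> (n - j) (boson \<mu> j g) \<kappa>" for j
    by (rule boson_local, rule boson_local, rule assms) simp
  moreover have "boson \<mu> n f \<kappa> = boson \<mu> n g \<kappa>" by (rule boson_local, rule assms)
  moreover have "n = 0 \<Longrightarrow> f \<kappa> = g \<kappa>" by (rule assms) simp
  ultimately show ?thesis by (simp add: fock_L_def)
qed

text \<open>
  The field \<open>a\<close> is primary up to the anomaly of the background charge.  This commutator determines
  the \<open>L(m)\<close> up to scalars.
\<close>
lemma fock_L_boson:
  "fock_L \<mu> \<beta> m (boson \<mu> k f) - boson \<mu> k (fock_L \<mu> \<beta> m f) =
     fscale (- of_int k) (boson \<mu> (m + k) f) + (if m + k = 0 then fscale (\<beta> * of_int m ^ 2) f else 0)"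
proof
  fix \<kappa>
  obtain r \<kappa>' where r: "\<And>g. boson \<mu> k g \<kappa> = r * g \<kappa>'" "r \<noteq> 0 \<Longrightarrow> int (level \<kappa>') = int (level \<kappa>) + k"
    "int (level \<kappa>') \<le> int (level \<kappa>) + \<bar>k\<bar>"
    using boson_pointwise[of \<mu> k \<kappa>] by blast
  show "(fock_L \<mu> \<beta> m (boson \<mu> k f) - boson \<mu> k (fock_L \<mu> \<beta> m f)) \<kappa> =
     (fscale (- of_int k) (boson \<mu> (m + k) f) + (if m + k = 0 then fscale (\<beta> * of_int m ^ 2) f else 0)) \<kappa>"
  proof (cases "m = 0")
    case True
    have "r \<noteq> 0 \<Longrightarrow> (of_nat (level \<kappa>') :: complex) = of_nat (level \<kappa>) + of_int k"
      using r(2) by (metis of_int_add of_int_of_nat_eq)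
    then show ?thesis using True by (cases "r = 0") (auto simp: fock_L_def r algebra_simps)
  next
    case False
    \<comment> \<open>a summation range that serves both for \<open>\<kappa>\<close> and for the coefficient \<open>\<kappa>'\<close> read by \<open>a\<^sub>k\<close>\<close>
    define N where "N = \<bar>m\<bar> + int (level \<kappa>) + \<bar>k\<bar>"
    have J: "{-(\<bar>m\<bar> + int (level \<kappa>))..\<bar>m\<bar> + int (level \<kappa>)} \<subseteq> {-N..N}"
      "{-(\<bar>m\<bar> + int (level \<kappa>'))..\<bar>m\<bar> + int (level \<kappa>')} \<subseteq> {-N..N}"
      using r(3) by (auto simp: N_def)
    let ?q = "\<lambda>j g. boson \<mu> (m - j) (boson \<mu> j g)"
    have q: "?q j (boson \<mu> k f) \<kappa> - boson \<mu> k (?q j f) \<kappa> =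
       (if j = - k then - of_int k * boson \<mu> (m + k) f \<kappa> else 0) + (if j = m + k then - of_int k * boson \<mu> (m + k) f \<kappa> else 0)" for j
    proof -
      have "?q j (boson \<mu> k f) - boson \<mu> k (?q j f) =
        boson \<mu> (m - j) (boson \<mu> j (boson \<mu> k f) - boson \<mu> k (boson \<mu> j f)) +
        (boson \<mu> (m - j) (boson \<mu> k (boson \<mu> j f)) - boson \<mu> k (boson \<mu> (m - j) (boson \<mu> j f)))"
        by (simp add: boson_diff)
      also have "\<dots> = (if j + k = 0 then fscale (of_int j) (boson \<mu> (m - j) f) else 0) +
          (if m - j + k = 0 then fscale (of_int (m - j)) (boson \<mu> j f) else 0)"
        unfolding boson_commutator by (simp add: boson_scale)
      finally have *: "?q j (boson \<mu> k f) \<kappa> - boson \<mu> k (?q j f) \<kappa> =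
          (if j + k = 0 then of_int j * (boson \<mu> (m - j) f \<kappa>) else 0) +
          (if m - j + k = 0 then (of_int (m - j)) * (boson \<mu> j f \<kappa>) else 0)"
        by (auto simp: fun_eq_iff)
      have "j + k = 0 \<longleftrightarrow> j = - k" "m - j + k = 0 \<longleftrightarrow> j = m + k" by auto
      then show ?thesis unfolding * by auto
    qed
    have "fock_L \<mu> \<beta> m (boson \<mu> k f) \<kappa> - boson \<mu> k (fock_L \<mu> \<beta> m f) \<kappa> =
       (\<Sum>j\<in>{-N..N}. ?q j (boson \<mu> k f) \<kappa> - boson \<mu> k (?q j f) \<kappa>) / 2
       + of_int m * \<beta> * (boson \<mu> m (boson \<mu> k f) \<kappa> - boson \<mu> k (boson \<mu> m f) \<kappa>)"
      by (simp add: r(1) fock_L_eq[OF False _ J(1)] fock_L_eq[OF False _ J(2)] sum_subtractf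
            sum_distrib_left[symmetric] diff_divide_distrib algebra_simps)
    also have "(\<Sum>j\<in>{-N..N}. ?q j (boson \<mu> k f) \<kappa> - boson \<mu> k (?q j f) \<kappa>) = - 2 * of_int k * boson \<mu> (m + k) f \<kappa>"
    proof -
      have "-k \<in> {-N..N}" "m + k \<in> {-N..N}" by (auto simp: N_def)
      then show ?thesis unfolding q sum.distrib by simp
    qed
    also have "boson \<mu> m (boson \<mu> k f) \<kappa> - boson \<mu> k (boson \<mu> m f) \<kappa> = (if m + k = 0 then of_int m * f \<kappa> else 0)"
      using fun_cong[OF boson_commutator[of \<mu> m k f], of \<kappa>] by (simp split: if_splits)
    finally show ?thesis by (simp add: power2_eq_square algebra_simps)
  qed
qed

lemma boson_mono_vec: "boson \<mu> (- int i - 1) (mono_vec \<iota>) = mono_vec (add_mset i \<iota>)"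
proof
  fix \<kappa>
  show "boson \<mu> (- int i - 1) (mono_vec \<iota>) \<kappa> = mono_vec (add_mset i \<iota>) \<kappa>"
    by (auto simp: boson_def mono_vec_def nat_add_distrib dest: multi_member_split)
qed

lemma boson_vacuum: "n > 0 \<Longrightarrow> boson \<mu> n (mono_vec {#}) = 0"
  by (auto simp: boson_def mono_vec_def fun_eq_iff)

lemma sum_mono_vec:
  assumes "level \<kappa> = m" shows "(\<Sum>\<iota> | level \<iota> = m. f \<iota> * mono_vec \<iota> \<kappa>) = f \<kappa>"
proof -
  have "(\<Sum>\<iota> | level \<iota> = m. f \<iota> * mono_vec \<iota> \<kappa>) = (\<Sum>\<iota> | level \<iota> = m. if \<iota> = \<kappa> then f \<kappa> else 0)"
    by (rule sum.cong) (auto simp: mono_vec_def)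
  then show ?thesis using assms by (simp add: finite_level)
qed

lemma sum_mult_complement:
  "(\<Sum>j\<in>{1..<int n}. of_int (j * (int n - j)) :: complex) = (of_nat n ^ 3 - of_nat n) / 6"
proof -
  have *: "(\<Sum>j<k. of_nat j * (of_nat n - of_nat j) :: complex)
     = of_nat n * of_nat k * (of_nat k - 1) / 2 - (of_nat k - 1) * of_nat k * (2 * of_nat k - 1) / 6" for k
    by (induction k) (auto simp: field_simps)
  have "(\<Sum>j\<in>{1..<int n}. of_int (j * (int n - j)) :: complex) = (\<Sum>j\<in>{1..<n}. of_int (int j * (int n - int j)))"
    by (rule sum.reindex_bij_witness[of _ int nat]) auto
  also have "\<dots> = (\<Sum>j<n. of_nat j * (of_nat n - of_nat j))"
    by (rule sum.mono_neutral_cong_left) auto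
  also have "\<dots> = (of_nat n ^ 3 - of_nat n) / 6"
    unfolding * by (simp add: field_simps power3_eq_cube)
  finally show ?thesis .
qed

lemma fock_L_neg_low: "n < - int (level \<kappa>) \<Longrightarrow> fock_L \<mu> \<beta> n f \<kappa> = 0"
  using fock_L_local[of \<kappa> n f 0 \<mu> \<beta>] by fastforce

text \<open>
  The central charge is found here.  With \<open>g = L(-m) 1\<close> the vector \<open>a\<^sub>j g\<close> is \<open>j a\<^bsub>j-m\<^esub> 1\<close> up to the
  anomaly, so the quadratic part of \<open>L(m)\<close> contributes \<open>1/2 \<Sum>\<^sub>j j (m - j)\<close>, the sum being over \<open>0 < j < m\<close>.
\<close>
lemma fock_L_vacuum_norm:
  assumes "m > 0"
  shows "fock_L \<mu> \<beta> m (fock_L \<mu> \<beta> (- m) (mono_vec {#})) {#} =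
    of_int m * \<mu>\<^sup>2 - \<beta>\<^sup>2 * of_int m ^ 3 + (of_int m ^ 3 - of_int m) / 12"
proof -
  let ?e = "mono_vec {#}"
  define g where "g = fock_L \<mu> \<beta> (- m) ?e"
  have g: "boson \<mu> k g = fscale (of_int k) (boson \<mu> (k - m) ?e) - (if k = m then fscale (\<beta> * of_int m ^ 2) ?e else 0)"
    if "k > 0" for k
  proof -
    have "k - m = 0 \<longleftrightarrow> k = m" "- m + k = k - m" by auto
    then show ?thesis
    using fock_L_boson[of \<mu> \<beta> "-m" k ?e] by (auto simp: g_def boson_vacuum[OF that] fun_eq_iff algebra_simps split: if_splits)
  qed
  define am where "am = of_int m * \<mu> - \<beta> * of_int m ^ 2"
  have am: "boson \<mu> m g {#} = am"
    unfolding g[OF assms] by (simp add: boson_def mono_vec_def am_def)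
  have q: "boson \<mu> (m - j) (boson \<mu> j g) {#} =
     (if j = 0 then \<mu> * am else 0) + (if j = m then \<mu> * am else 0) + (if j \<in> {1..<m} then of_int (j * (m - j)) else 0)" for j
  proof -
    consider "j = 0" | "j = m" | "j \<in> {1..<m}" | "j > m" | "j < 0" by fastforce
    then show ?thesis
    proof cases
      case 1 
      have "boson \<mu> m (boson \<mu> 0 g) = boson \<mu> 0 (boson \<mu> m g)"
        using boson_commutator[of \<mu> m 0 g] assms by simp
      then show ?thesis using 1 assms am by (simp add: boson_def[of _ 0])
    next
      case 2 then show ?thesis using assms am by (simp add: boson_def[of _ 0])
    next
      case 3
      then have "boson \<mu> j g = fscale (of_int j) (boson \<mu> (j - m) ?e)" using g[of j] by simp
      moreover have "boson \<mu> (m - j) (boson \<mu> (j - m) ?e) = fscale (of_int (m - j)) ?e"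
        using boson_commutator[of \<mu> "m - j" "j - m" ?e] boson_vacuum[of "m - j"] 3 by simp
      ultimately show ?thesis using 3 by (simp add: boson_scale mono_vec_def)
    next
      case 4 then show ?thesis using assms by (simp add: boson_neg_low)
    next
      case 5
      have "boson \<mu> (m - j) (boson \<mu> j g) = boson \<mu> j (boson \<mu> (m - j) g)"
        using boson_commutator[of \<mu> "m - j" j g] assms by simp
      then show ?thesis using 5 assms by (simp add: boson_neg_low)
    qed
  qed
  have ints: "{-m..m} \<inter> {j. 1 \<le> j \<and> j < m} = {1..<m}" by auto
  have "(\<Sum>j\<in>{-m..m}. boson \<mu> (m - j) (boson \<mu> j g) {#}) = 2 * \<mu> * am + (\<Sum>j\<in>{1..<m}. of_int (j * (m - j)))"
    unfolding q sum.distrib using assms by (simp add: sum.If_cases ints)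
  also have "(\<Sum>j\<in>{1..<m}. of_int (j * (m - j)) :: complex) = (of_int m ^ 3 - of_int m) / 6"
    using sum_mult_complement[of "nat m"] assms by simp
  finally have s: "(\<Sum>j\<in>{-m..m}. boson \<mu> (m - j) (boson \<mu> j g) {#}) = 2 * \<mu> * am + (of_int m ^ 3 - of_int m) / 6" .
  have "fock_L \<mu> \<beta> m g {#} = (2 * \<mu> * am + (of_int m ^ 3 - of_int m) / 6) / 2 + of_int m * \<beta> * am"
    using assms fock_L_eq[of m "{-m..m}" "{#}" \<mu> \<beta> g] by (simp add: s am)
  also have "\<dots> = of_int m * \<mu>\<^sup>2 - \<beta>\<^sup>2 * of_int m ^ 3 + (of_int m ^ 3 - of_int m) / 12"
    unfolding am_def by (simp add: field_simps power2_eq_square power3_eq_cube)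
  finally show ?thesis by (simp add: g_def)
qed

text \<open>
  The difference \<open>D = [L(m), L(n)] - (m - n) L(m + n)\<close> commutes with all \<open>a\<^sub>k\<close>, by the commutator of
  the \<open>L(m)\<close> with the \<open>a\<^sub>k\<close>.  Hence it is a scalar, which can be read off at the vacuum.
\<close>
lemma fock_virasoro_relation:
  "fock_L \<mu> \<beta> m (fock_L \<mu> \<beta> n f) - fock_L \<mu> \<beta> n (fock_L \<mu> \<beta> m f) =
     fscale (of_int (m - n)) (fock_L \<mu> \<beta> (m + n) f) +
     (if m + n = 0 then fscale (of_int (m ^ 3 - m) / 12 * (1 - 12 * \<beta>\<^sup>2)) f else 0)"
proof -
  let ?L = "fock_L \<mu> \<beta>" and ?a = "boson \<mu>" and ?e = "mono_vec {#}"
  define D where "D m n f = ?L m (?L n f) - ?L n (?L m f) - fscale (of_int (m - n)) (?L (m + n) f)" for m n f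
  have lin: "Vector_Spaces.linear fscale fscale (D m n)" for m n
    by (rule linear_fscaleI) (auto simp: D_def fock_L_add fock_L_scale fun_eq_iff algebra_simps)
  have D_boson: "D m n (?a k f) = ?a k (D m n f)" for m n k f
  proof -
    have L: "?L m (?a k f) = ?a k (?L m f) + (fscale (- of_int k) (?a (m + k) f) + (if m + k = 0 then fscale (\<beta> * of_int m ^ 2) f else 0))"
      for m f k using fock_L_boson[of \<mu> \<beta> m k f] by (simp add: diff_eq_eq algebra_simps)
    have LL: "?L m (?L n (?a k f)) = ?a k (?L m (?L n f)) + fscale (- of_int k) (?a (m + k) (?L n f)) 
         + fscale (- of_int k) (?a (n + k) (?L m f))
         + (if m + k = 0 then fscale (\<beta> * of_int m ^ 2) (?L n f) else 0) 
         + (if n + k = 0 then fscale (\<beta> * of_int n ^ 2) (?L m f) else 0)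
         + fscale (of_int (k * (n + k))) (?a (m + n + k) f)
         + (if m + n + k = 0 then fscale (- of_int k * \<beta> * of_int m ^ 2) f else 0)" for m n
    proof -
      have "?L m (?L n (?a k f)) = ?L m (?a k (?L n f)) + (fscale (- of_int k) (?L m (?a (n + k) f)) + (if n + k = 0 then fscale (\<beta> * of_int n ^ 2) (?L m f) else 0))"
        unfolding L[of n k f] by (simp add: fock_L_add fock_L_scale fock_L_diff fock_L_neg)
      also note L[of m k "?L n f"]
      also note L[of m "n + k" f]
      finally show ?thesis by (auto simp: fun_eq_iff algebra_simps)
    qed
    have "D m n (?a k f) = ?a k (D m n f)"
      unfolding D_def LL boson_diff boson_scale L[of "m + n" k f]
    proof -
      have k: "m + n + k = 0 \<Longrightarrow> k = - (m + n)" and k': "n + m + k = 0 \<longleftrightarrow> m + n + k = 0" by auto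
      show "?a k (?L m (?L n f)) + fscale (- of_int k) (?a (m + k) (?L n f)) 
         + fscale (- of_int k) (?a (n + k) (?L m f))
         + (if m + k = 0 then fscale (\<beta> * of_int m ^ 2) (?L n f) else 0) 
         + (if n + k = 0 then fscale (\<beta> * of_int n ^ 2) (?L m f) else 0)
         + fscale (of_int (k * (n + k))) (?a (m + n + k) f)
         + (if m + n + k = 0 then fscale (- of_int k * \<beta> * of_int m ^ 2) f else 0) -
         (?a k (?L n (?L m f)) + fscale (- of_int k) (?a (n + k) (?L m f)) 
         + fscale (- of_int k) (?a (m + k) (?L n f))
         + (if n + k = 0 then fscale (\<beta> * of_int n ^ 2) (?L m f) else 0) 
         + (if m + k = 0 then fscale (\<beta> * of_int m ^ 2) (?L n f) else 0)
         + fscale (of_int (k * (m + k))) (?a (n + m + k) f)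
         + (if n + m + k = 0 then fscale (- of_int k * \<beta> * of_int n ^ 2) f else 0)) -
         fscale (of_int (m - n)) (?a k (?L (m + n) f) + (fscale (- of_int k) (?a (m + n + k) f) + (if m + n + k = 0 then fscale (\<beta> * of_int (m + n) ^ 2) f else 0)))
         = ?a k (?L m (?L n f)) - ?a k (?L n (?L m f)) - fscale (of_int (m - n)) (?a k (?L (m + n) f))"
      proof (cases "m + n + k = 0")
        case True
        show ?thesis unfolding k' add.commute[of n m] k[OF True]
          by (auto simp: fun_eq_iff algebra_simps power2_eq_square)
      next
        case False
        then show ?thesis unfolding k' add.commute[of n m]
          by (auto simp: fun_eq_iff algebra_simps power2_eq_square)
      qed
    qed
    then show ?thesis .
  qed
  \<comment> \<open>this reduces arbitrary functions to finite sums of monomials\<close>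
  have D_local: "D m n f \<kappa> = D m n g \<kappa>"
    if "\<And>\<kappa>'. int (level \<kappa>') = int (level \<kappa>) + (m + n) \<Longrightarrow> f \<kappa>' = g \<kappa>'" for m n f g \<kappa>
  proof -
    have "?L m (?L n f) \<kappa> = ?L m (?L n g) \<kappa>" "?L n (?L m f) \<kappa> = ?L n (?L m g) \<kappa>" "?L (m + n) f \<kappa> = ?L (m + n) g \<kappa>"
      by (rule fock_L_local, (rule fock_L_local)?, rule that, simp)+
    then show ?thesis by (simp add: D_def)
  qed
  define \<chi> where "\<chi> m n = (if m + n = 0 then of_int (m ^ 3 - m) / 12 * (1 - 12 * \<beta>\<^sup>2) else 0)" for m n :: int
  have D_vac0: "D m n ?e {#} = \<chi> m n" for m n
  proof -
    have pos: "D m (-m) ?e {#} = \<chi> m (-m)" if "m > 0" for m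
    proof -
      have "?L (- m) (?L m ?e) {#} = 0" using that by (simp add: fock_L_neg_low)
      then show ?thesis
        by (simp add: D_def fock_L_vacuum_norm[OF that] fock_L_def[of _ _ 0] mono_vec_def \<chi>_def field_simps power2_eq_square power3_eq_cube)
    qed
    consider "m + n \<noteq> 0" | "m > 0" "n = - m" | "m = 0" "n = 0" | "n > 0" "m = - n"
      by linarith
    then show ?thesis
    proof cases
      case 1
      have "D m n ?e {#} = D m n 0 {#}" using 1 by (intro D_local) (auto simp: mono_vec_def)
      then show ?thesis using 1 fun_pair.linear_0[OF lin] by (simp add: \<chi>_def)
    next
      case 2 then show ?thesis using pos by simp
    next
      case 3 then show ?thesis by (simp add: D_def \<chi>_def)
    next
      case 4
      have "D m n ?e {#} = - D n m ?e {#}" by (simp add: D_def algebra_simps)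
      also have "\<dots> = \<chi> m n" using pos[OF 4(1)] 4 by (simp add: \<chi>_def field_simps)
      finally show ?thesis .
    qed
  qed
  have D_vac: "D m n ?e = fscale (\<chi> m n) ?e"
  proof
    fix \<kappa>
    show "D m n ?e \<kappa> = fscale (\<chi> m n) ?e \<kappa>"
    proof (cases \<kappa>)
      case empty then show ?thesis by (simp add: D_vac0 mono_vec_def)
    next
      case (add i \<iota>)
      have "?a (int i + 1) (D m n ?e) = 0"
        unfolding D_boson[symmetric] by (simp add: boson_vacuum fun_pair.linear_0[OF lin])
      then have z: "?a (int i + 1) (D m n ?e) \<iota> = 0" by simp
      have "of_int (int i + 1) * of_nat (Suc (count \<iota> i)) * D m n ?e (add_mset i \<iota>) = 0"
        using z by (simp add: boson_def nat_add_distrib)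
      moreover have "of_int (int i + 1) \<noteq> (0::complex)" by (metis add_eq_0_iff negative_eq_positive of_int_0_eq_iff of_nat_1 of_nat_0_eq_iff one_neq_zero add.commute)
      moreover have "of_nat (Suc (count \<iota> i)) \<noteq> (0::complex)" by (rule of_nat_neq_0)
      ultimately have "D m n ?e (add_mset i \<iota>) = 0" by (metis no_zero_divisors)
      then show ?thesis using add by (simp add: mono_vec_def)
    qed
  qed
  have D_mono: "D m n (mono_vec \<iota>) = fscale (\<chi> m n) (mono_vec \<iota>)" for \<iota>
  proof (induction \<iota>)
    case empty then show ?case by (rule D_vac)
  next
    case (add i \<iota>)
    show ?case unfolding boson_mono_vec[of \<mu>, symmetric] D_boson add boson_scale ..
  qed
  have "D m n f \<kappa> = \<chi> m n * f \<kappa>" for \<kappa>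
  proof (cases "int (level \<kappa>) + (m + n) \<ge> 0")
    case True
    define M where "M = nat (int (level \<kappa>) + (m + n))"
    define f' where "f' = (\<Sum>\<iota> | level \<iota> = M. fscale (f \<iota>) (mono_vec \<iota>))"
    have f': "f' \<kappa>' = f \<kappa>'" if "level \<kappa>' = M" for \<kappa>'
      using sum_mono_vec[OF that, of f] by (simp add: f'_def sum_apply_fun)
    have "D m n f \<kappa> = D m n f' \<kappa>"
      by (rule D_local) (use f' True in \<open>simp add: M_def\<close>)
    also have "D m n f' = fscale (\<chi> m n) f'"
      unfolding f'_def fun_pair.linear_sum[OF lin] fun_pair.linear_scale[OF lin] D_mono
      by (simp add: fun_eq_iff sum_apply_fun sum_distrib_left mult_ac)
    also have "\<dots> \<kappa> = \<chi> m n * f \<kappa>"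
      by (cases "m + n = 0") (auto simp: \<chi>_def f' M_def)
    finally show ?thesis .
  next
    case False
    then have "D m n f \<kappa> = D m n 0 \<kappa>" by (intro D_local) auto
    then show ?thesis using False fun_pair.linear_0[OF lin] by (simp add: \<chi>_def)
  qed
  then have "D m n f = fscale (\<chi> m n) f" by (simp add: fun_eq_iff)
  then show ?thesis by (auto simp: D_def \<chi>_def fun_eq_iff algebra_simps)
qed

lemma virasoro_module_fock: "virasoro_module fscale (fock_L \<mu> \<beta>) (1 - 12 * \<beta>\<^sup>2)"
  by unfold_locales (auto simp: fock_L_add fock_L_scale fock_virasoro_relation)

section \<open>Singular vectors of the Fock space\<close>

text \<open>
  The weights of the diagonal form in which \<open>t a\<^sub>k\<close> is the transpose of \<open>a\<^sub>-\<^sub>k\<close>.  The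
  value \<open>t = 1\<close> is used for transposing \<open>L(n)\<close>, the value \<open>t = 1/2\<close> for the positivity argument.
\<close>
definition fock_weight :: "complex \<Rightarrow> nat multiset \<Rightarrow> complex" where
  "fock_weight t \<kappa> = (\<Prod>i\<in>#\<kappa>. t * of_nat (Suc i)) * (\<Prod>i\<in>set_mset \<kappa>. fact (count \<kappa> i))"

lemma fock_weight_add:
  "fock_weight t (add_mset i \<kappa>) = t * of_nat (Suc i) * of_nat (Suc (count \<kappa> i)) * fock_weight t \<kappa>"
proof -
  let ?S = "set_mset \<kappa> - {i}"
  have "(\<Prod>j\<in>set_mset (add_mset i \<kappa>). fact (count (add_mset i \<kappa>) j) :: complex)
     = fact (Suc (count \<kappa> i)) * (\<Prod>j\<in>?S. fact (count (add_mset i \<kappa>) j))"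
    by (subst prod.remove[of _ i]) auto
  also have "(\<Prod>j\<in>?S. fact (count (add_mset i \<kappa>) j) :: complex) = (\<Prod>j\<in>?S. fact (count \<kappa> j))"
    by (rule prod.cong) auto
  finally have 1: "(\<Prod>j\<in>set_mset (add_mset i \<kappa>). fact (count (add_mset i \<kappa>) j) :: complex)
     = fact (Suc (count \<kappa> i)) * (\<Prod>j\<in>?S. fact (count \<kappa> j))" .
  have 2: "(\<Prod>j\<in>set_mset \<kappa>. fact (count \<kappa> j) :: complex) = fact (count \<kappa> i) * (\<Prod>j\<in>?S. fact (count \<kappa> j))"
  proof (cases "i \<in># \<kappa>")
    case True then show ?thesis by (subst prod.remove[of _ i]) auto
  next
    case False then show ?thesis by (simp add: not_in_iff)
  qed
  show ?thesis unfolding fock_weight_def 1 2 by simp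
qed

lemma fock_weight_pos:
  assumes "t > 0" shows "\<exists>w>0. fock_weight (of_real t) \<kappa> = of_real w"
proof (induction \<kappa>)
  case empty then show ?case by (intro exI[of _ 1]) (simp add: fock_weight_def)
next
  case (add i \<kappa>)
  then obtain w where "w > 0" "fock_weight (of_real t) \<kappa> = of_real w" by blast
  then show ?case using assms
    by (intro exI[of _ "t * of_nat (Suc i) * of_nat (Suc (count \<kappa> i)) * w"] conjI)
      (simp_all only: fock_weight_add of_real_mult of_real_of_nat_eq mult_pos_pos of_nat_0_less_iff zero_less_Suc)
qed

text \<open>
  The form is bilinear and restricted to one level.  Levels are integers so that the identities
  below need no case distinction; a negative level is empty.
\<close>
definition fock_form :: "complex \<Rightarrow> int \<Rightarrow> (nat multiset \<Rightarrow> complex) \<Rightarrow> (nat multiset \<Rightarrow> complex) \<Rightarrow> complex" where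
  "fock_form t m f g = (\<Sum>\<kappa> | int (level \<kappa>) = m. fock_weight t \<kappa> * f \<kappa> * g \<kappa>)"

lemma finite_int_level: "finite {\<kappa>. int (level \<kappa>) = m}"
  by (rule finite_subset[OF _ finite_level[of "nat m"]]) auto

lemma fock_form_commute: "fock_form t m f g = fock_form t m g f"
  by (simp add: fock_form_def mult_ac)

lemma fock_form_neg: "m < 0 \<Longrightarrow> fock_form t m f g = 0"
  by (simp add: fock_form_def)

lemma fock_form_cong:
  "(\<And>\<kappa>. int (level \<kappa>) = m \<Longrightarrow> f \<kappa> = f' \<kappa>) \<Longrightarrow> (\<And>\<kappa>. int (level \<kappa>) = m \<Longrightarrow> g \<kappa> = g' \<kappa>) \<Longrightarrow>
     fock_form t m f g = fock_form t m f' g'"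
  unfolding fock_form_def by (rule sum.cong) auto

lemma fock_form_add: "fock_form t m f (g + g') = fock_form t m f g + fock_form t m f g'"
  by (simp add: fock_form_def sum.distrib distrib_left)

lemma fock_form_scale: "fock_form t m f (fscale c g) = c * fock_form t m f g"
  by (simp add: fock_form_def sum_distrib_left mult_ac)

lemma fock_form_zero [simp]: "fock_form t m f 0 = 0" "fock_form t m 0 g = 0"
  by (auto simp: fock_form_def)

lemma fock_form_sum: "fock_form t m f (\<Sum>i\<in>I. g i) = (\<Sum>i\<in>I. fock_form t m f (g i))"
  by (induction I rule: infinite_finite_induct)
    (simp_all only: sum.infinite sum.empty sum.insert fock_form_zero fock_form_add not_False_eq_True)

lemma fock_form_creation:
  "fock_form t m (boson \<mu> (- int i - 1) f) g = t * fock_form t (m - int i - 1) f (boson \<mu> (int i + 1) g)"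
proof -
  have "fock_form t m (boson \<mu> (- int i - 1) f) g =
     (\<Sum>\<kappa>\<in>add_mset i ` {\<iota>. int (level \<iota>) = m - int i - 1}. fock_weight t \<kappa> * f (\<kappa> - {#i#}) * g \<kappa>)"
    unfolding fock_form_def
  proof (rule sum.mono_neutral_cong_right[OF finite_int_level])
    show "add_mset i ` {\<iota>. int (level \<iota>) = m - int i - 1} \<subseteq> {\<kappa>. int (level \<kappa>) = m}" by auto
    show "\<forall>\<kappa>\<in>{\<kappa>. int (level \<kappa>) = m} - add_mset i ` {\<iota>. int (level \<iota>) = m - int i - 1}.
       fock_weight t \<kappa> * boson \<mu> (- int i - 1) f \<kappa> * g \<kappa> = 0"
    proof
      fix \<kappa> assume \<kappa>: "\<kappa> \<in> {\<kappa>. int (level \<kappa>) = m} - add_mset i ` {\<iota>. int (level \<iota>) = m - int i - 1}"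
      have "i \<notin># \<kappa>"
      proof
        assume "i \<in># \<kappa>"
        from multi_member_split[OF this] obtain \<iota> where "\<kappa> = add_mset i \<iota>" ..
        with \<kappa> show False by auto
      qed
      then show "fock_weight t \<kappa> * boson \<mu> (- int i - 1) f \<kappa> * g \<kappa> = 0"
        by (simp add: boson_def nat_add_distrib)
    qed
    show "fock_weight t \<kappa> * boson \<mu> (- int i - 1) f \<kappa> * g \<kappa> = fock_weight t \<kappa> * f (\<kappa> - {#i#}) * g \<kappa>"
      if "\<kappa> \<in> add_mset i ` {\<iota>. int (level \<iota>) = m - int i - 1}" for \<kappa>
      using that by (auto simp: boson_def nat_add_distrib)
  qed
  also have "\<dots> = (\<Sum>\<iota> | int (level \<iota>) = m - int i - 1. fock_weight t (add_mset i \<iota>) * f \<iota> * g (add_mset i \<iota>))"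
    by (subst sum.reindex) (auto simp: inj_on_def)
  also have "\<dots> = t * fock_form t (m - int i - 1) f (boson \<mu> (int i + 1) g)"
    unfolding fock_form_def sum_distrib_left
    by (rule sum.cong) (auto simp: fock_weight_add boson_def nat_add_distrib mult_ac)
  finally show ?thesis .
qed

lemma fock_form_boson:
  "fock_form 1 m (boson \<mu> n f) g = fock_form 1 (m + n) f (boson \<mu> (- n) g)"
proof -
  have neg: "fock_form 1 m (boson \<mu> n f) g = fock_form 1 (m + n) f (boson \<mu> (- n) g)" if "n < 0" for m n f g
  proof -
    have n: "n = - int (nat (- n) - 1) - 1" using that by simp
    show ?thesis using fock_form_creation[of 1 m \<mu> "nat (- n) - 1" f g] that
      by (simp add: n[symmetric] of_nat_diff)
  qed
  consider "n < 0" | "n = 0" | "n > 0" by linarith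
  then show ?thesis
  proof cases
    case 3
    have "fock_form 1 (m + n) (boson \<mu> (- n) g) f = fock_form 1 m g (boson \<mu> n f)"
      using neg[of "-n" "m + n" g f] 3 by simp
    then show ?thesis by (simp add: fock_form_commute)
  next
    case 2 then show ?thesis by (simp add: boson_def fock_form_def mult_ac)
  qed (rule neg)
qed

text \<open>
  Since \<open>a\<^sub>-\<^sub>n\<close> is the transpose of \<open>a\<^sub>n\<close> for \<open>t = 1\<close>, only the linear term \<open>n \<beta> a\<^sub>n\<close> of \<open>L(n)\<close> distinguishes its
  transpose from \<open>L(-n)\<close>.
\<close>
lemma fock_form_fock_L:
  assumes n: "n \<noteq> 0"
  shows "fock_form 1 m (fock_L \<mu> \<beta> n f) g = fock_form 1 (m + n) f (fock_L \<mu> (- \<beta>) (- n) g)"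
proof -
  \<comment> \<open>large enough for \<open>L(n)\<close> at level \<open>m\<close> and, after a shift by \<open>n\<close>, for \<open>L(-n)\<close> at level \<open>m + n\<close>\<close>
  define N where "N = \<bar>m\<bar> + 3 * \<bar>n\<bar>"
  let ?q = "\<lambda>n j f. boson \<mu> (n - j) (boson \<mu> j f)"
  have "fock_form 1 m (fock_L \<mu> \<beta> n f) g = fock_form 1 m g (fscale (1 / 2) (\<Sum>j\<in>{-N..N}. ?q n j f) + fscale (of_int n * \<beta>) (boson \<mu> n f))"
  proof (subst fock_form_commute, rule fock_form_cong)
    fix \<kappa> assume "int (level \<kappa>) = m"
    then show "fock_L \<mu> \<beta> n f \<kappa> = (fscale (1 / 2) (\<Sum>j\<in>{-N..N}. ?q n j f) + fscale (of_int n * \<beta>) (boson \<mu> n f)) \<kappa>"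
      by (subst fock_L_eq[OF n, of "{-N..N}"]) (auto simp: N_def sum_apply_fun)
  qed simp
  also have "\<dots> = (\<Sum>j\<in>{-N..N}. fock_form 1 (m + n) f (boson \<mu> (- j) (boson \<mu> (j - n) g))) / 2
      + of_int n * \<beta> * fock_form 1 (m + n) f (boson \<mu> (- n) g)"
    by (simp add: fock_form_add fock_form_scale fock_form_sum fock_form_commute[of _ m g] fock_form_boson)
  also have "(\<Sum>j\<in>{-N..N}. fock_form 1 (m + n) f (boson \<mu> (- j) (boson \<mu> (j - n) g)))
      = (\<Sum>i\<in>{-N-n..N-n}. fock_form 1 (m + n) f (?q (- n) i g))"
    by (rule sum.reindex_bij_witness[of _ "\<lambda>i. i + n" "\<lambda>j. j - n"]) auto
  finally have "fock_form 1 m (fock_L \<mu> \<beta> n f) g =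
     fock_form 1 (m + n) f (fscale (1 / 2) (\<Sum>i\<in>{-N-n..N-n}. ?q (- n) i g) + fscale (of_int n * \<beta>) (boson \<mu> (- n) g))"
    by (simp add: fock_form_add fock_form_scale fock_form_sum)
  also have "\<dots> = fock_form 1 (m + n) f (fock_L \<mu> (- \<beta>) (- n) g)"
  proof (rule fock_form_cong)
    fix \<kappa> assume "int (level \<kappa>) = m + n"
    then show "(fscale (1 / 2) (\<Sum>j\<in>{-N-n..N-n}. ?q (- n) j g) + fscale (of_int n * \<beta>) (boson \<mu> (- n) g)) \<kappa> = fock_L \<mu> (- \<beta>) (- n) g \<kappa>"
      using n by (subst fock_L_eq[of "- n" "{-N-n..N-n}"]) (auto simp: N_def sum_apply_fun)
  qed simp
  finally show ?thesis .
qed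

text \<open>
  The normally ordered form of \<open>L(k)\<close> for \<open>k > 0\<close>, which separates the summands with one creation
  operator from those with none.
\<close>
lemma fock_L_pos_eq:
  assumes k: "k > 0" and N: "int (level \<kappa>) \<le> N"
  shows "fock_L \<mu> \<beta> k f \<kappa> = (\<Sum>l\<in>{1..N}. boson \<mu> (- l) (boson \<mu> (k + l) f) \<kappa>)
     + (\<Sum>j\<in>{1..<k}. boson \<mu> (k - j) (boson \<mu> j f) \<kappa>) / 2 + (\<mu> + of_int k * \<beta>) * boson \<mu> k f \<kappa>"
proof -
  let ?q = "\<lambda>j. boson \<mu> (k - j) (boson \<mu> j f) \<kappa>" and ?p = "\<lambda>l. boson \<mu> (- l) (boson \<mu> (k + l) f) \<kappa>"
  define M where "M = k + N"
  have z: "?p l = 0" if "l > N" for l using that N by (simp add: boson_neg_low)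
  have swap: "?p (- j) = ?q j" for j
    using fun_cong[OF boson_commutator[of \<mu> "k - j" "j" f], of \<kappa>] k by simp
  have "{-M..M} = {-M..-1} \<union> ({0} \<union> ({1..<k} \<union> ({k} \<union> {k+1..M})))"
    using k N by (auto simp: M_def)
  then have "sum ?q {-M..M} = sum ?q ({-M..-1} \<union> ({0} \<union> ({1..<k} \<union> ({k} \<union> {k+1..M}))))" by simp
  also have "\<dots> = sum ?q {-M..-1} + (?q 0 + (sum ?q {1..<k} + (?q k + sum ?q {k+1..M})))"
    using k by (subst sum.union_disjoint; force?)+
  also have "sum ?q {-M..-1} = sum ?p {1..M}"
    by (rule sum.reindex_bij_witness[of _ uminus uminus]) (auto simp: swap[simplified])
  also have "sum ?p {1..M} = sum ?p {1..N}"
    using k by (intro sum.mono_neutral_right) (auto simp: M_def intro: z)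
  also have "sum ?q {k+1..M} = sum ?p {1..N}"
    by (rule sum.reindex_bij_witness[of _ "\<lambda>l. k + l" "\<lambda>j. j - k"]) (auto simp: M_def)
  also have "?q 0 = \<mu> * boson \<mu> k f \<kappa>"
    using fun_cong[OF boson_commutator[of \<mu> k 0 f], of \<kappa>] k by (simp add: boson_def[of _ 0])
  also have "?q k = \<mu> * boson \<mu> k f \<kappa>" by (simp add: boson_def[of _ 0])
  finally have s: "sum ?q {-M..M} = 2 * sum ?p {1..N} + sum ?q {1..<k} + 2 * \<mu> * boson \<mu> k f \<kappa>" by simp
  have "fock_L \<mu> \<beta> k f \<kappa> = sum ?q {-M..M} / 2 + of_int k * \<beta> * boson \<mu> k f \<kappa>"
    using k N by (intro fock_L_eq) (auto simp: M_def)
  then show ?thesis unfolding s by (simp add: field_simps)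
qed

lemma cnj_boson: "n \<noteq> 0 \<Longrightarrow> (\<lambda>\<kappa>. cnj (boson \<mu> n f \<kappa>)) = boson \<mu> n (\<lambda>\<kappa>. cnj (f \<kappa>))"
  by (auto simp: boson_def fun_eq_iff)

lemma cnj_fock_form:
  assumes "t > 0"
  shows "cnj (fock_form (of_real t) m f g) = fock_form (of_real t) m (\<lambda>\<kappa>. cnj (f \<kappa>)) (\<lambda>\<kappa>. cnj (g \<kappa>))"
proof -
  have "cnj (fock_weight (of_real t) \<kappa>) = fock_weight (of_real t) \<kappa>" for \<kappa>
    using fock_weight_pos[OF assms, of \<kappa>] by auto
  then show ?thesis by (simp add: fock_form_def)
qed

lemma fock_form_definite:
  assumes "t > 0"
  shows "Im (fock_form (of_real t) m (\<lambda>\<kappa>. cnj (f \<kappa>)) f) = 0" "Re (fock_form (of_real t) m (\<lambda>\<kappa>. cnj (f \<kappa>)) f) \<ge> 0"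
    and "Re (fock_form (of_real t) m (\<lambda>\<kappa>. cnj (f \<kappa>)) f) = 0 \<Longrightarrow> int (level \<kappa>) = m \<Longrightarrow> f \<kappa> = 0"
proof -
  obtain w where w: "\<And>\<kappa>. w \<kappa> > 0" "\<And>\<kappa>. fock_weight (of_real t) \<kappa> = of_real (w \<kappa>)"
    using fock_weight_pos[OF assms] by metis
  have "fock_weight (of_real t) \<kappa> * cnj (f \<kappa>) * f \<kappa> = of_real (w \<kappa> * (norm (f \<kappa>))\<^sup>2)" for \<kappa>
    using complex_norm_square[of "f \<kappa>"] by (simp add: w mult_ac)
  then have *: "fock_form (of_real t) m (\<lambda>\<kappa>. cnj (f \<kappa>)) f = of_real (\<Sum>\<kappa> | int (level \<kappa>) = m. w \<kappa> * (norm (f \<kappa>))\<^sup>2)"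
    by (simp add: fock_form_def)
  show "Im (fock_form (of_real t) m (\<lambda>\<kappa>. cnj (f \<kappa>)) f) = 0" unfolding * by simp
  have nn: "w \<kappa> * (norm (f \<kappa>))\<^sup>2 \<ge> 0" for \<kappa> using w(1)[of \<kappa>] by simp
  then show "Re (fock_form (of_real t) m (\<lambda>\<kappa>. cnj (f \<kappa>)) f) \<ge> 0" unfolding * by (simp add: sum_nonneg)
  assume "Re (fock_form (of_real t) m (\<lambda>\<kappa>. cnj (f \<kappa>)) f) = 0" "int (level \<kappa>) = m"
  then have "w \<kappa> * (norm (f \<kappa>))\<^sup>2 = 0"
    unfolding * using sum_nonneg_eq_0_iff[OF finite_int_level[of m], of "\<lambda>\<kappa>. w \<kappa> * (norm (f \<kappa>))\<^sup>2"] nn by auto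
  then show "f \<kappa> = 0" using w(1)[of \<kappa>] by auto
qed

text \<open>
  The decisive identity.  In \<open>0 = \<Sum>\<^sub>k \<langle>a\<^sub>k x, L(k) x\<rangle>\<close>, with \<open>P k l = \<langle>a\<^sub>l a\<^sub>k x, a\<^bsub>k+l\<^esub> x\<rangle>\<close>, the terms
  \<open>a\<^sub>-\<^sub>l a\<^bsub>k+l\<^esub>\<close> of \<open>L(k)\<close> contribute \<open>1/2 \<Sum> P k l\<close> and its terms \<open>1/2 a\<^bsub>k-j\<^esub> a\<^sub>j\<close> contribute the complex
  conjugate of this number.  Hence the imaginary part of the identity involves the linear
  terms \<open>(\<mu> + i k \<theta>) a\<^sub>k\<close> of \<open>L(k)\<close> only, and it reads \<open>\<Sum>\<^sub>k (Im \<mu> + k \<theta>) \<parallel>a\<^sub>k x\<parallel>\<^sup>2 = 0\<close>.  The balance of the two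
  cubic sums is what fixes the value \<open>t = 1/2\<close> in the form.
\<close>
lemma fock_singular_annihilated:
  assumes sing: "\<And>k \<kappa>. k > 0 \<Longrightarrow> int (level \<kappa>) = m - k \<Longrightarrow> fock_L \<mu> (\<i> * of_real \<theta>) k x \<kappa> = 0"
    and sgn: "(\<forall>k\<ge>1. Im \<mu> + k * \<theta> \<ge> 0) \<or> (\<forall>k\<ge>1. Im \<mu> + k * \<theta> \<le> 0)"
    and k: "k > 0" "Im \<mu> + of_int k * \<theta> \<noteq> 0" and \<kappa>: "int (level \<kappa>) = m - k"
  shows "boson \<mu> k x \<kappa> = 0"
proof -
  let ?a = "boson \<mu>" and ?F = "fock_form (of_real (1 / 2))"
  define X where "X = (\<lambda>\<kappa>. cnj (x \<kappa>))"
  define q where "q k = ?F (m - k) (?a k X) (?a k x)" for k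
  define P where "P k l = ?F (m - k - l) (?a l (?a k X)) (?a (k + l) x)" for k l
  have q: "q k = ?F (m - k) (\<lambda>\<kappa>. cnj (?a k x \<kappa>)) (?a k x)" if "k > 0" for k
    using that by (simp add: q_def X_def cnj_boson)
  have eq: "0 = (\<Sum>l\<in>{1..m}. P k l) / 2 + (\<Sum>j\<in>{1..<k}. cnj (P j (k - j))) / 2 + (\<mu> + of_int k * (\<i> * of_real \<theta>)) * q k"
    if k: "k > 0" for k
  proof -
    have 1: "?F (m - k) (?a k X) (?a (- l) (?a (k + l) x)) = P k l / 2" if "l > 0" for l
    proof -
      define i where "i = nat l - 1"
      have l: "- int i - 1 = - l" "int i + 1 = l" "m - k - int i - 1 = m - k - l" using that by (auto simp: i_def)
      show ?thesis
        using fock_form_creation[of "of_real (1 / 2)" "m - k" \<mu> i "?a (k + l) x" "?a k X", unfolded l]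
        unfolding P_def fock_form_commute[of _ _ "?a k X"] fock_form_commute[of _ _ "?a l (?a k X)"] by simp
    qed
    have 2: "?F (m - k) (?a k X) (?a (k - j) (?a j x)) = cnj (P j (k - j))" if "j \<in> {1..<k}" for j
      using that k by (simp add: P_def cnj_fock_form[of "1 / 2", simplified] cnj_boson X_def fock_form_commute)
    have "0 = ?F (m - k) (?a k X) (fock_L \<mu> (\<i> * of_real \<theta>) k x)"
      using fock_form_cong[of "m - k" "?a k X" "?a k X" "fock_L \<mu> (\<i> * of_real \<theta>) k x" 0] sing[OF k] by simp
    also have "\<dots> = ?F (m - k) (?a k X) ((\<Sum>l\<in>{1..m}. ?a (- l) (?a (k + l) x))
        + fscale (1 / 2) (\<Sum>j\<in>{1..<k}. ?a (k - j) (?a j x)) + fscale (\<mu> + of_int k * (\<i> * of_real \<theta>)) (?a k x))"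
      using k by (intro fock_form_cong) (auto simp: fock_L_pos_eq[OF k, of _ m] sum_apply_fun)
    also have "\<dots> = (\<Sum>l\<in>{1..m}. P k l / 2) + (\<Sum>j\<in>{1..<k}. cnj (P j (k - j))) / 2 + (\<mu> + of_int k * (\<i> * of_real \<theta>)) * q k"
    proof -
      have "(\<Sum>l\<in>{1..m}. ?F (m - k) (?a k X) (?a (- l) (?a (k + l) x))) = (\<Sum>l\<in>{1..m}. P k l / 2)"
        by (intro sum.cong refl 1) auto
      moreover have "(\<Sum>j\<in>{1..<k}. ?F (m - k) (?a k X) (?a (k - j) (?a j x))) = (\<Sum>j\<in>{1..<k}. cnj (P j (k - j)))"
        by (intro sum.cong refl 2) auto
      ultimately show ?thesis
        by (simp add: fock_form_add fock_form_scale fock_form_sum q_def del: of_real_divide)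
    qed
    finally show ?thesis by (simp add: sum_divide_distrib)
  qed
  define S where "S = (\<Sum>k\<in>{1..m}. \<Sum>l\<in>{1..m}. P k l)"
  have Pz: "P k l = 0" if "\<not> k + l \<le> m" for k l
    unfolding P_def using that by (intro fock_form_neg) simp
  \<comment> \<open>both double sums range over the pairs of positive integers with sum at most \<open>m\<close>\<close>
  have S: "(\<Sum>k\<in>{1..m}. \<Sum>j\<in>{1..<k}. P j (k - j)) = S"
  proof -
    have "S = (\<Sum>(k, l)\<in>{1..m} \<times> {1..m}. P k l)"
      by (simp add: S_def sum.cartesian_product)
    also have "\<dots> = (\<Sum>(k, l)\<in>{(k, l). k \<ge> 1 \<and> l \<ge> 1 \<and> k + l \<le> m}. P k l)"
      using Pz by (intro sum.mono_neutral_right) auto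
    also have "\<dots> = (\<Sum>(k, j)\<in>(SIGMA k:{1..m}. {1..<k}). P j (k - j))"
      by (rule sum.reindex_bij_witness[of _ "\<lambda>(k, j). (j, k - j)" "\<lambda>(k, l). (k + l, k)"]) auto
    also have "\<dots> = (\<Sum>k\<in>{1..m}. \<Sum>j\<in>{1..<k}. P j (k - j))"
      by (simp add: sum.Sigma)
    finally show ?thesis by simp
  qed
  have "0 = (\<Sum>k\<in>{1..m}. (\<Sum>l\<in>{1..m}. P k l) / 2 + (\<Sum>j\<in>{1..<k}. cnj (P j (k - j))) / 2 + (\<mu> + of_int k * (\<i> * of_real \<theta>)) * q k)"
    using eq by (intro sum.neutral[symmetric] ballI) auto
  also have "\<dots> = S / 2 + cnj S / 2 + (\<Sum>k\<in>{1..m}. (\<mu> + of_int k * (\<i> * of_real \<theta>)) * q k)"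
    unfolding S[symmetric] by (simp add: sum.distrib S_def sum_divide_distrib[symmetric]) (simp add: S S_def)
  finally have "0 = Im (S / 2 + cnj S / 2 + (\<Sum>k\<in>{1..m}. (\<mu> + of_int k * (\<i> * of_real \<theta>)) * q k))" by simp
  also have "\<dots> = (\<Sum>k\<in>{1..m}. (Im \<mu> + of_int k * \<theta>) * Re (q k))"
  proof -
    have "Im (q k) = 0" if "k > 0" for k unfolding q[OF that] by (rule fock_form_definite) simp
    then show ?thesis by simp
  qed
  finally have z: "(\<Sum>k\<in>{1..m}. (Im \<mu> + of_int k * \<theta>) * Re (q k)) = 0" by simp
  have q0: "Re (q k) \<ge> 0" if "k > 0" for k unfolding q[OF that] by (rule fock_form_definite) simp
  have "(Im \<mu> + of_int k * \<theta>) * Re (q k) = 0" if "k \<in> {1..m}" for k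
    using sgn
  proof
    assume *: "\<forall>k\<ge>1. Im \<mu> + k * \<theta> \<ge> 0"
    have "\<forall>k\<in>{1..m}. (Im \<mu> + of_int k * \<theta>) * Re (q k) \<ge> 0"
      using * q0 by (auto intro!: mult_nonneg_nonneg)
    then show ?thesis using z that sum_nonneg_eq_0_iff[of "{1..m}" "\<lambda>k. (Im \<mu> + of_int k * \<theta>) * Re (q k)"] by auto
  next
    assume *: "\<forall>k\<ge>1. Im \<mu> + k * \<theta> \<le> 0"
    have "\<forall>k\<in>{1..m}. - ((Im \<mu> + of_int k * \<theta>) * Re (q k)) \<ge> 0"
      using * q0 by (auto intro!: mult_nonpos_nonneg)
    then show ?thesis using z that sum_nonneg_eq_0_iff[of "{1..m}" "\<lambda>k. - ((Im \<mu> + of_int k * \<theta>) * Re (q k))"]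
      by (auto simp: sum_negf)
  qed
  moreover have "k \<in> {1..m}" using k(1) \<kappa> by auto
  ultimately have "Re (q k) = 0" using k(2) by auto
  then show ?thesis unfolding q[OF k(1)] using fock_form_definite(3)[of "1/2" "m - k" "?a k x" \<kappa>] \<kappa> by simp
qed

section \<open>Modules with a highest weight vector\<close>

context virasoro_module
begin

sublocale endo: vector_space_pair scale scale ..
sublocale functional: vector_space_pair scale "(*)"
  by unfold_locales (auto simp: algebra_simps)

lemmas L_add = endo.linear_add[OF linear_L]
  and L_scale = endo.linear_scale[OF linear_L]
  and L_zero [simp] = endo.linear_0[OF linear_L]
  and L_sum = endo.linear_sum[OF linear_L]

lemma L_swap:
  "L m (L n v) = L n (L m v) + scale (of_int (m - n)) (L (m + n) v) +
     (if m + n = 0 then scale (of_int (m ^ 3 - m) / 12 * c) v else 0)"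
  using virasoro_relation[of m n v] by (simp add: diff_eq_eq algebra_simps)

sublocale up: witt_half scale "\<lambda>i. L (- int i - 1)" UNIV
proof unfold_locales
  fix i j v
  have "- int i - 1 + (- int j - 1) = - int (Suc (i + j)) - 1" by simp
  then show "L (- int i - 1) (L (- int j - 1) v) - L (- int j - 1) (L (- int i - 1) v)
      = scale (of_int (int j - int i)) (L (- int (Suc (i + j)) - 1) v)"
    using virasoro_relation[of "- int i - 1" "- int j - 1" v] by simp
qed (auto simp: L_add L_scale)

text \<open>
  Composition with the \<open>L(k)\<close>, \<open>k > 0\<close>, is a right action, and this turns their relations into those of the
  \<open>L(-k)\<close>.
\<close>
sublocale dual: witt_half fscale "\<lambda>i \<phi> y. \<phi> (L (int i + 1) y)" "{\<phi>. Vector_Spaces.linear scale (*) \<phi>}"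
proof unfold_locales
  fix i j \<phi> assume "\<phi> \<in> {\<phi>. Vector_Spaces.linear scale (*) \<phi>}"
  then have \<phi>: "Vector_Spaces.linear scale (*) \<phi>" by simp
  have e: "int j + 1 + (int i + 1) = int (Suc (i + j)) + 1" by simp
  show "(\<lambda>y. \<phi> (L (int j + 1) (L (int i + 1) y))) - (\<lambda>y. \<phi> (L (int i + 1) (L (int j + 1) y)))
      = fscale (of_int (int j - int i)) (\<lambda>y. \<phi> (L (int (Suc (i + j)) + 1) y))"
    using virasoro_relation[of "int j + 1" "int i + 1"] e
    by (auto simp: fun_eq_iff functional.linear_diff[OF \<phi>, symmetric] functional.linear_scale[OF \<phi>, symmetric])
next
  fix i \<phi> assume "\<phi> \<in> {\<phi>. Vector_Spaces.linear scale (*) \<phi>}"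
  then have \<phi>: "Vector_Spaces.linear scale (*) \<phi>" by simp
  have "Vector_Spaces.linear scale (*) (\<phi> \<circ> L (int i + 1))"
    by (rule Vector_Spaces.linear_compose[OF linear_L \<phi>])
  then show "(\<lambda>y. \<phi> (L (int i + 1) y)) \<in> {\<phi>. Vector_Spaces.linear scale (*) \<phi>}"
    by (simp add: comp_def)
qed (auto simp: fun_eq_iff)

abbreviation up :: "nat multiset \<Rightarrow> 'v \<Rightarrow> 'v" where
  "up \<equiv> pbw_word (\<lambda>i. L (- int i - 1))"

text \<open>
  The mirror image of \<open>up\<close>: the smallest part acts last.  So a part \<open>1\<close> of \<open>\<kappa>\<close> yields an operator \<open>L(1)\<close>
  in the leftmost place.
\<close>
definition down :: "nat multiset \<Rightarrow> 'v \<Rightarrow> 'v" where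
  "down \<kappa> y = foldr (\<lambda>i. L (int i + 1)) (sorted_list_of_multiset \<kappa>) y"

lemma down_empty [simp]: "down {#} y = y"
  by (simp add: down_def)

lemma down_add_max: "\<forall>i\<in>#\<kappa>. i \<le> k \<Longrightarrow> down (add_mset k \<kappa>) y = down \<kappa> (L (int k + 1) y)"
  by (simp add: down_def sorted_list_of_multiset_add_max del: sorted_list_of_multiset_insert)

lemma down_add_0: "down (add_mset 0 \<kappa>) y = L 1 (down \<kappa> y)"
  by (simp add: down_def insort_is_Cons)

lemma up_add_0: "up (add_mset 0 \<kappa>) v = up \<kappa> (L (- 1) v)"
  by (simp add: pbw_word_def insort_is_Cons)

lemma up_zero [simp]: "up \<kappa> 0 = 0"
  by (induction \<kappa> rule: multiset_max_induct) (auto simp: pbw_word_add_max)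

lemma pbw_word_dual: "pbw_word (\<lambda>i \<phi> y. \<phi> (L (int i + 1) y)) \<kappa> \<phi> y = \<phi> (down \<kappa> y)"
  by (induction \<kappa> arbitrary: y rule: multiset_max_induct) (auto simp: pbw_word_add_max down_add_max)

lemma linear_down: "Vector_Spaces.linear scale scale (down \<kappa>)"
proof (induction \<kappa> rule: multiset_max_induct)
  case empty
  show ?case by unfold_locales auto
next
  case (add \<kappa> k)
  have "down (add_mset k \<kappa>) = down \<kappa> \<circ> L (int k + 1)" using add by (auto simp: down_add_max)
  then show ?case by (simp only: Vector_Spaces.linear_compose[OF linear_L add(2)])
qed

text \<open>
  Straightening for functionals.  By this lemma it suffices to know a functional on the
  ordered words \<open>L(k\<^sub>1) \<cdots> L(k\<^sub>r) y\<close> in order to control it on the ordered words of all \<open>L(k) y\<close>.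
\<close>
lemma functional_down_straighten:
  assumes \<phi>: "Vector_Spaces.linear scale (*) \<phi>"
    and 0: "\<And>\<kappa>. level \<kappa> = m \<Longrightarrow> \<phi> (down \<kappa> y) = 0"
    and k: "Suc k + level \<kappa> = m"
  shows "\<phi> (down \<kappa> (L (int k + 1) y)) = 0"
proof -
  let ?A = "\<lambda>i \<phi> y. \<phi> (L (int i + 1) y)"
  have "?A k (pbw_word ?A \<kappa> \<phi>) \<in> fun_space.span {pbw_word ?A \<iota> \<phi> | \<iota>. level \<iota> = Suc k + level \<kappa>}"
    by (rule dual.A_word_span) (use \<phi> in \<open>auto intro: fun_space.span_base\<close>)
  moreover have "f y = 0" if "f \<in> fun_space.span {pbw_word ?A \<iota> \<phi> | \<iota>. level \<iota> = Suc k + level \<kappa>}" for f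
    using that
  proof (induction rule: fun_space.span_induct_alt)
    case base then show ?case by simp
  next
    case (step c f g)
    then show ?case using 0 k by (auto simp: pbw_word_dual)
  qed
  ultimately have "?A k (pbw_word ?A \<kappa> \<phi>) y = 0" by blast
  then show ?thesis by (simp add: pbw_word_dual)
qed

definition highest_weight :: "complex \<Rightarrow> 'v \<Rightarrow> bool" where
  "highest_weight h v \<longleftrightarrow> (\<forall>k>0. L k v = 0) \<and> L 0 v = scale h v"

text \<open>A negative level gives the zero space.\<close>
definition level_space :: "'v \<Rightarrow> int \<Rightarrow> 'v set" where
  "level_space v n = span {up \<kappa> v | \<kappa>. int (level \<kappa>) = n}"

lemma subspace_level_space [simp]: "subspace (level_space v n)"
  by (simp add: level_space_def)

lemma up_in_level_space: "int (level \<kappa>) = n \<Longrightarrow> up \<kappa> v \<in> level_space v n"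
  unfolding level_space_def by (rule span_base) auto

lemma level_space_neg: "n < 0 \<Longrightarrow> level_space v n = {0}"
proof -
  assume "n < 0"
  then have "{up \<kappa> v | \<kappa>. int (level \<kappa>) = n} = {}" by auto
  then show ?thesis by (simp add: level_space_def)
qed

lemma level_space_0: "level_space v 0 = range (\<lambda>t. scale t v)"
proof -
  have "{up \<kappa> v | \<kappa>. int (level \<kappa>) = 0} = {v}" by auto
  then show ?thesis by (simp add: level_space_def span_singleton)
qed

lemma level_eq_1_iff: "level \<kappa> = Suc 0 \<longleftrightarrow> \<kappa> = {#0#}"
  by (cases \<kappa>) auto

lemma level_space_1:
  assumes "L (- 1) v = 0" shows "level_space v 1 = {0}"
proof -
  have "{up \<kappa> v | \<kappa>. int (level \<kappa>) = 1} = {0}"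
    using assms up_add_0[of "{#}" v] by (auto simp: level_eq_1_iff)
  then show ?thesis by (simp add: level_space_def)
qed

lemma level_space_induct [consumes 1, case_names zero add up]:
  assumes "y \<in> level_space v n" "P 0" "\<And>x y. P x \<Longrightarrow> P y \<Longrightarrow> P (x + y)"
    "\<And>t \<kappa>. int (level \<kappa>) = n \<Longrightarrow> P (scale t (up \<kappa> v))"
  shows "P y"
  using assms(1) unfolding level_space_def
  by (induction rule: span_induct_alt) (use assms(2-) in auto)

lemma L_neg_level_space:
  assumes "k < 0" "y \<in> level_space v n" shows "L k y \<in> level_space v (n - k)"
proof (cases "n < 0")
  case True
  then show ?thesis using assms by (simp add: level_space_neg subspace_0)
next
  case False
  define i where "i = nat (- k) - 1"
  have k: "k = - int i - 1" using assms by (simp add: i_def)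
  have "y \<in> span {up \<kappa> v | \<kappa>. level \<kappa> = nat n}" using assms(2) False
    by (simp add: level_space_def int_eq_iff cong: conj_cong)
  from up.A_word_span[OF _ this, of i] have "L k y \<in> span {up \<kappa> v | \<kappa>. level \<kappa> = Suc i + nat n}"
    unfolding k by simp
  also have "\<dots> = level_space v (n - k)" unfolding level_space_def k using False
    by (intro arg_cong[of _ _ span]) auto
  finally show ?thesis .
qed

lemma L0_up:
  assumes v: "highest_weight h v"
  shows "L 0 (up \<kappa> v) = scale (h + of_nat (level \<kappa>)) (up \<kappa> v)"
proof (induction \<kappa> rule: multiset_max_induct)
  case empty then show ?case using v by (simp add: highest_weight_def)
next
  case (add \<kappa> k)
  let ?x = "up \<kappa> v"
  have "L 0 (L (- int k - 1) ?x) = L (- int k - 1) (L 0 ?x) + scale (of_int (0 - (- int k - 1))) (L (- int k - 1) ?x)"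
    using L_swap[of 0 "- int k - 1" ?x] by simp
  also have "\<dots> = scale (h + of_nat (Suc k + level \<kappa>)) (L (- int k - 1) ?x)"
    unfolding add(2) L_scale scale_left_distrib[symmetric] by (simp add: add_ac)
  finally show ?case using add(1) by (simp add: pbw_word_add_max)
qed

lemma L0_level_space:
  assumes v: "highest_weight h v" and y: "y \<in> level_space v n"
  shows "L 0 y = scale (h + of_int n) y"
  using y
proof (induction rule: level_space_induct)
  case (up t \<kappa>)
  then have "(of_nat (level \<kappa>) :: complex) = of_int n" by (metis of_int_of_nat_eq)
  then show ?case by (simp add: L_scale L0_up[OF v] mult.commute)
qed (auto simp: L_add scale_right_distrib)

text \<open>
  A raising word can be traversed from the left by \<open>L(k)\<close>; the commutators with its letters are
  again operators on shorter words.
\<close>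
lemma L_level_space:
  assumes v: "highest_weight h v" and y: "y \<in> level_space v n"
  shows "L k y \<in> level_space v (n - k)"
proof -
  have up: "L k (up \<kappa> v) \<in> level_space v (int (level \<kappa>) - k)" for \<kappa> k
  proof (induction \<kappa> arbitrary: k rule: multiset_max_induct)
    case empty
    consider "k < 0" | "k = 0" | "k > 0" by linarith
    then show ?case
    proof cases
      case 1 then show ?thesis using L_neg_level_space[of k "up {#} v" v 0] up_in_level_space[of "{#}" 0 v] by simp
    next
      case 2 then show ?thesis using v by (auto simp: highest_weight_def level_space_0)
    next
      case 3 then show ?thesis using v by (auto simp: highest_weight_def subspace_0)
    qed
  next
    case (add \<kappa> i)
    let ?x = "up \<kappa> v"
    have x: "up (add_mset i \<kappa>) v = L (- int i - 1) ?x" using add(1) by (rule pbw_word_add_max)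
    have "L (- int i - 1) (L k ?x) \<in> level_space v (int (level \<kappa>) - k - (- int i - 1))"
      by (rule L_neg_level_space[OF _ add(2)]) simp
    moreover have "L (k + (- int i - 1)) ?x \<in> level_space v (int (level \<kappa>) - (k + (- int i - 1)))" by (rule add(2))
    moreover have "k + (- int i - 1) = 0 \<Longrightarrow> ?x \<in> level_space v (int (level \<kappa>) - (k + (- int i - 1)))"
      by (rule up_in_level_space) simp
    ultimately show ?case unfolding x L_swap[of k "- int i - 1" ?x]
      by (auto intro!: subspace_add subspace_scale subspace_0 simp: algebra_simps)
  qed
  show ?thesis using y
    by (induction rule: level_space_induct)
      (auto simp: L_add L_scale subspace_0 intro: subspace_add subspace_scale up)
qed

lemma down_level_space:
  assumes v: "highest_weight h v" and y: "y \<in> level_space v n"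
  shows "down \<kappa> y \<in> level_space v (n - int (level \<kappa>))"
  using y
proof (induction \<kappa> arbitrary: y n rule: multiset_max_induct)
  case (add \<kappa> k)
  have "down \<kappa> (L (int k + 1) y) \<in> level_space v (n - (int k + 1) - int (level \<kappa>))"
    by (intro add L_level_space[OF v])
  then show ?case using add(1) by (simp add: down_add_max algebra_simps)
qed simp

lemma down_up_scalar:
  assumes "highest_weight h v" "level \<kappa> = level \<iota>"
  shows "\<exists>t. down \<kappa> (up \<iota> v) = scale t v"
  using down_level_space[OF assms(1) up_in_level_space[OF refl, of \<iota>], of \<kappa>] assms(2)
  by (auto simp: level_space_0)

end

lemma virasoro_module_prod:
  assumes "virasoro_module s1 L1 c" "virasoro_module s2 L2 c"
  shows "virasoro_module (\<lambda>t p. (s1 t (fst p), s2 t (snd p))) (\<lambda>n p. (L1 n (fst p), L2 n (snd p))) c"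
proof -
  interpret m1: virasoro_module s1 L1 c by fact
  interpret m2: virasoro_module s2 L2 c by fact
  show ?thesis
    by unfold_locales
      (auto simp: prod_eq_iff m1.scale_left_distrib m2.scale_left_distrib m1.scale_right_distrib m2.scale_right_distrib
        m1.L_add m2.L_add m1.L_scale m2.L_scale m1.virasoro_relation m2.virasoro_relation)
qed

text \<open>
  The matrix entries of two highest weight vectors with equal central charge and weight agree,
  because both are the entries of the pair \<open>(v1, v2)\<close> in the direct sum of the modules.
\<close>
lemma down_up_universal:
  assumes "virasoro_module s1 L1 c" "virasoro_module s2 L2 c"
    and v1: "virasoro_module.highest_weight s1 L1 h v1" and v2: "virasoro_module.highest_weight s2 L2 h v2"
    and lev: "level \<kappa> = level \<iota>"
  shows "\<exists>t. virasoro_module.down L1 \<kappa> (pbw_word (\<lambda>i. L1 (- int i - 1)) \<iota> v1) = s1 t v1 \<and>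
             virasoro_module.down L2 \<kappa> (pbw_word (\<lambda>i. L2 (- int i - 1)) \<iota> v2) = s2 t v2"
proof -
  interpret m1: virasoro_module s1 L1 c by fact
  interpret m2: virasoro_module s2 L2 c by fact
  interpret m: virasoro_module "\<lambda>t p. (s1 t (fst p), s2 t (snd p))" "\<lambda>n p. (L1 n (fst p), L2 n (snd p))" c
    by (rule virasoro_module_prod) fact+
  have up: "m.up \<iota> (x, y) = (m1.up \<iota> x, m2.up \<iota> y)" for x y
    by (induction \<iota> rule: multiset_max_induct) (auto simp: pbw_word_add_max)
  have down: "m.down \<kappa> (x, y) = (m1.down \<kappa> x, m2.down \<kappa> y)" for x y
    by (induction \<kappa> arbitrary: x y rule: multiset_max_induct) (auto simp: m.down_add_max m1.down_add_max m2.down_add_max)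
  have "m.highest_weight h (v1, v2)"
    using v1 v2 by (auto simp: m.highest_weight_def m1.highest_weight_def m2.highest_weight_def zero_prod_def)
  from m.down_up_scalar[OF this lev] show ?thesis by (simp add: up down)
qed

section \<open>The Gram matrix of a highest weight vector\<close>

text \<open>
  The parameters with which the vacuum of the Fock space has weight \<open>h\<close> and the central charge is
  \<open>1 + 12\<theta>\<^sup>2\<close>.  By the bounds on \<open>Im \<mu>\<close>, the number \<open>Im \<mu> + k \<theta>\<close> is positive and
  \<open>Im \<mu> - k \<theta>\<close> is negative for all \<open>k \<ge> 1\<close>, except that the latter vanishes if \<open>h = 0\<close> and \<open>k = 1\<close>.
\<close>
locale fock_parameters =
  fixes \<mu> \<beta> :: complex and \<theta> :: real and h :: nat
  assumes \<theta>: "\<theta> > 0" and \<beta>: "\<beta> = \<i> * of_real \<theta>"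
    and \<mu>: "\<mu>\<^sup>2 = 2 * of_nat h + \<beta>\<^sup>2" and Im_\<mu>: "0 \<le> Im \<mu>" "Im \<mu> \<le> \<theta>"
    and Im_less: "h > 0 \<Longrightarrow> Im \<mu> < \<theta>" and weight_0: "h = 0 \<Longrightarrow> \<mu> = \<beta>"
begin

sublocale fock: virasoro_module fscale "fock_L \<mu> \<beta>" "1 - 12 * \<beta>\<^sup>2"
  by (rule virasoro_module_fock)

abbreviation vac where "vac \<equiv> mono_vec {#}"

lemma highest_weight_vac: "fock.highest_weight (of_nat h) vac"
proof -
  have "fock_L \<mu> \<beta> k vac = 0" if "k > 0" for k
  proof
    fix \<kappa>
    have "fock_L \<mu> \<beta> k vac \<kappa> = fock_L \<mu> \<beta> k 0 \<kappa>"
      by (rule fock_L_local) (use that in \<open>auto simp: mono_vec_def\<close>)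
    then show "fock_L \<mu> \<beta> k vac \<kappa> = 0 \<kappa>" by simp
  qed
  moreover have "fock_L \<mu> \<beta> 0 vac = fscale (of_nat h) vac"
    by (auto simp: fun_eq_iff fock_L_def mono_vec_def \<mu>)
  ultimately show ?thesis by (simp add: fock.highest_weight_def)
qed

text \<open>
  In the sum for \<open>L(-1) 1\<close> only \<open>j = 0\<close> and \<open>j = -1\<close> contribute, which gives \<open>(\<mu> - \<beta>) a\<^sub>-\<^sub>1 1\<close>.
\<close>
lemma L_vac_weight_0:
  assumes "h = 0" shows "fock_L \<mu> \<beta> (- 1) vac = 0"
proof
  fix \<kappa>
  have **: "boson \<mu> (- 1 - j) (boson \<mu> j vac) =
      (if j = 0 \<or> j = - 1 then fscale \<mu> (boson \<mu> (- 1) vac) else 0)" for j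
  proof (cases "j \<ge> 0 \<or> j = - 1")
    case True
    then show ?thesis
      by (auto simp: boson_vacuum) (auto simp: boson_def[of _ 0] fun_eq_iff boson_def)
  next
    case False
    then have "boson \<mu> (- 1 - j) (boson \<mu> j vac) = boson \<mu> j (boson \<mu> (- 1 - j) vac)"
      using boson_commutator[of \<mu> "- 1 - j" j vac] by simp
    then show ?thesis using False by (simp add: boson_vacuum)
  qed
  have "(\<Sum>j\<in>{-(1 + int (level \<kappa>))..1 + int (level \<kappa>)}. boson \<mu> (- 1 - j) (boson \<mu> j vac) \<kappa>)
     = (\<Sum>j\<in>{-(1 + int (level \<kappa>))..1 + int (level \<kappa>)}. (if j = - 1 then \<mu> * boson \<mu> (- 1) vac \<kappa> else 0) + (if j = 0 then \<mu> * boson \<mu> (- 1) vac \<kappa> else 0))"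
    unfolding ** by (rule sum.cong) auto
  also have "\<dots> = 2 * \<mu> * boson \<mu> (- 1) vac \<kappa>"
    by (simp add: sum.distrib)
  finally show "fock_L \<mu> \<beta> (- 1) vac \<kappa> = 0 \<kappa>"
    using weight_0[OF assms] by (simp add: fock_L_def)
qed

lemma boson_eq_0D: "boson \<mu> (int i + 1) x \<iota> = 0 \<Longrightarrow> x (add_mset i \<iota>) = 0"
proof -
  assume "boson \<mu> (int i + 1) x \<iota> = 0"
  then have "of_nat (Suc i) * of_nat (Suc (count \<iota> i)) * x (add_mset i \<iota>) = 0"
    by (simp add: boson_def nat_add_distrib add.commute)
  moreover have "of_nat (Suc i) * of_nat (Suc (count \<iota> i)) \<noteq> (0::complex)"
    by (metis no_zero_divisors of_nat_neq_0)
  ultimately show ?thesis by (metis no_zero_divisors)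
qed

text \<open>
  By induction the \<open>L(k) y\<close> vanish at the lower levels, so \<open>y\<close> is singular and all \<open>a\<^sub>k y\<close> vanish.
\<close>
lemma vacuum_coefficients_separate:
  assumes "\<And>\<kappa>. level \<kappa> = m \<Longrightarrow> fock.down \<kappa> y {#} = 0" "level \<kappa> = m"
  shows "y \<kappa> = 0"
  using assms
proof (induction m arbitrary: y \<kappa> rule: less_induct)
  case (less m)
  show ?case
  proof (cases \<kappa>)
    case empty
    then show ?thesis using less(2)[of "{#}"] less(3) by simp
  next
    case (add i \<iota>)
    have lin: "Vector_Spaces.linear fscale (*) (\<lambda>f::nat multiset \<Rightarrow> complex. f {#})"
      by unfold_locales (auto simp: algebra_simps)
    have "boson \<mu> (int i + 1) y \<iota> = 0"
    proof (rule fock_singular_annihilated[where m = "int m" and \<theta> = \<theta>])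
      fix k \<kappa>' assume k: "k > 0" "int (level \<kappa>') = int m - k"
      define j where "j = nat k - 1"
      have j: "k = int j + 1" "Suc j + level \<kappa>' = m" using k by (auto simp: j_def)
      have "fock.down \<nu> (fock_L \<mu> \<beta> (int j + 1) y) {#} = 0" if "level \<nu> = level \<kappa>'" for \<nu>
        by (rule fock.functional_down_straighten[OF lin]) (use less(2) that j in auto)
      then show "fock_L \<mu> (\<i> * of_real \<theta>) k y \<kappa>' = 0"
        using less(1)[of "level \<kappa>'" "fock_L \<mu> \<beta> k y" \<kappa>'] j by (simp add: \<beta>)
    next
      show "(\<forall>k\<ge>1. Im \<mu> + k * \<theta> \<ge> 0) \<or> (\<forall>k\<ge>1. Im \<mu> + k * \<theta> \<le> 0)" using \<theta> Im_\<mu> by auto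
      have "real_of_int (int i + 1) * \<theta> > 0" using \<theta> by simp
      then show "Im \<mu> + real_of_int (int i + 1) * \<theta> \<noteq> 0" using Im_\<mu> by linarith
      show "int (level \<iota>) = int m - (int i + 1)" using less(3) add by simp
    qed simp
    then show ?thesis using add boson_eq_0D by simp
  qed
qed

text \<open>
  A family indexed by partitions that will turn out to be a basis.  For \<open>h > 0\<close> it consists of the
  ordered words on the vacuum.  For \<open>h = 0\<close> the words with a part \<open>1\<close> vanish on the vacuum; they
  are replaced by the words on \<open>a\<^sub>-\<^sub>1 1\<close> in which this part has been removed.
\<close>
definition spanning_vec :: "nat multiset \<Rightarrow> nat multiset \<Rightarrow> complex" where
  "spanning_vec \<kappa> = (if h = 0 \<and> 0 \<in># \<kappa> then fock.up (\<kappa> - {#0#}) (mono_vec {#0#}) else fock.up \<kappa> vac)"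

lemma L_spanning_vec: "fock_L \<mu> \<beta> (- int k - 1) (spanning_vec \<iota>) \<in> fun_space.span {spanning_vec \<kappa> | \<kappa>. level \<kappa> = Suc k + level \<iota>}"
proof (cases "h = 0 \<and> 0 \<in># \<iota>")
  case True
  from multi_member_split[of 0 \<iota>] True obtain \<iota>' where \<iota>: "\<iota> = add_mset 0 \<iota>'" by blast
  let ?f = "mono_vec {#0#}"
  have "spanning_vec \<iota> = fock.up \<iota>' ?f" unfolding spanning_vec_def using True \<iota> by simp
  then have "fock_L \<mu> \<beta> (- int k - 1) (spanning_vec \<iota>) \<in> fun_space.span {fock.up \<kappa> ?f | \<kappa>. level \<kappa> = Suc k + level \<iota>'}"
    using fock.up.A_word_span[of ?f "spanning_vec \<iota>" "level \<iota>'" k] by (auto intro: fun_space.span_base)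
  also have "\<dots> \<subseteq> fun_space.span {spanning_vec \<kappa> | \<kappa>. level \<kappa> = Suc k + level \<iota>}"
  proof (rule fun_space.span_mono, safe)
    fix \<kappa> assume "level \<kappa> = Suc k + level \<iota>'"
    then show "\<exists>\<kappa>'. fock.up \<kappa> ?f = spanning_vec \<kappa>' \<and> level \<kappa>' = Suc k + level \<iota>"
      unfolding spanning_vec_def using True \<iota> by (intro exI[of _ "add_mset 0 \<kappa>"]) simp
  qed
  finally show ?thesis .
next
  case False
  then have "spanning_vec \<iota> = fock.up \<iota> vac" unfolding spanning_vec_def by auto
  moreover have "fock.up \<iota> vac \<in> fun_space.span {fock.up \<kappa> vac | \<kappa>. level \<kappa> = level \<iota>}"
    by (rule fun_space.span_base) auto
  ultimately have "fock_L \<mu> \<beta> (- int k - 1) (spanning_vec \<iota>) \<in> fun_space.span {fock.up \<kappa> vac | \<kappa>. level \<kappa> = Suc k + level \<iota>}"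
    using fock.up.A_word_span[OF UNIV_I] by simp
  also have "\<dots> \<subseteq> fun_space.span {spanning_vec \<kappa> | \<kappa>. level \<kappa> = Suc k + level \<iota>}"
  proof (rule fun_space.span_minimal[OF _ fun_space.subspace_span], safe)
    fix \<kappa> assume \<kappa>: "level \<kappa> = Suc k + level \<iota>"
    show "fock.up \<kappa> vac \<in> fun_space.span {spanning_vec \<kappa> | \<kappa>. level \<kappa> = Suc k + level \<iota>}"
    proof (cases "h = 0 \<and> 0 \<in># \<kappa>")
      case True
      from multi_member_split[of 0 \<kappa>] True obtain \<kappa>' where \<kappa>': "\<kappa> = add_mset 0 \<kappa>'" by blast
      have "fock.up \<kappa> vac = 0" unfolding \<kappa>' fock.up_add_0 using True L_vac_weight_0 by simp
      then show ?thesis by (simp add: fun_space.span_zero)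
    next
      case False
      then have "fock.up \<kappa> vac = spanning_vec \<kappa>" by (auto simp: spanning_vec_def)
      then show ?thesis using \<kappa> by (auto intro: fun_space.span_base)
    qed
  qed
  finally show ?thesis .
qed

text \<open>
  The transposed operators have \<open>-\<theta>\<close> in the place of \<open>\<theta>\<close>.  The coefficients \<open>Im \<mu> - k \<theta>\<close> force \<open>a\<^sub>k g = 0\<close>
  unless \<open>h = 0\<close> and \<open>k = 1\<close>.  In this exceptional case \<open>g\<close> is a multiple of the power \<open>a\<^sub>-\<^sub>1\<^sup>m 1\<close>, and
  from \<open>m \<ge> 2\<close> on such a vector is not killed by the term \<open>1/2 a\<^sub>1 a\<^sub>1\<close> of \<open>L(2)\<close>.
\<close>
lemma cosingular_eq_0:
  assumes sing: "\<And>k \<kappa>. k > 0 \<Longrightarrow> int (level \<kappa>) = int m - k \<Longrightarrow> fock_L \<mu> (- \<beta>) k g \<kappa> = 0"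
    and m: "m > 0" and one: "h = 0 \<Longrightarrow> m = 1 \<Longrightarrow> g {#0#} = 0" and \<kappa>: "level \<kappa> = m"
  shows "g \<kappa> = 0"
proof -
  have b: "boson \<mu> k g \<iota> = 0" if k: "k > 0" "h > 0 \<or> k > 1" and \<iota>: "int (level \<iota>) = int m - k" for k \<iota>
  proof (rule fock_singular_annihilated[where m = "int m" and \<theta> = "- \<theta>"])
    show "fock_L \<mu> (\<i> * of_real (- \<theta>)) k g \<kappa> = 0" if "0 < k" "int (level \<kappa>) = int m - k" for k \<kappa>
      using sing[OF that] by (simp add: \<beta>)
    have "Im \<mu> \<le> k * \<theta>" if "k \<ge> 1" for k
    proof -
      have "1 * \<theta> \<le> k * \<theta>" using that \<theta> by (intro mult_right_mono) auto
      then show ?thesis using Im_\<mu> by simp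
    qed
    then show "(\<forall>k\<ge>1. Im \<mu> + k * - \<theta> \<ge> 0) \<or> (\<forall>k\<ge>1. Im \<mu> + k * - \<theta> \<le> 0)" by simp
    have "Im \<mu> < real_of_int k * \<theta>"
    proof (cases "k > 1")
      case True
      have "1 * \<theta> < real_of_int k * \<theta>" using True \<theta> by (intro mult_strict_right_mono) auto
      then show ?thesis using Im_\<mu> by simp
    next
      case False
      then have "k = 1" using k by simp
      then show ?thesis using k Im_less by simp
    qed
    then show "Im \<mu> + real_of_int k * - \<theta> \<noteq> 0" by simp
  qed (use k \<iota> in auto)
  show ?thesis
  proof (cases "\<exists>i\<in>#\<kappa>. h > 0 \<or> i > 0")
    case True
    then obtain i where i: "i \<in># \<kappa>" "h > 0 \<or> i > 0" by blast
    from multi_member_split[OF i(1)] obtain \<iota> where \<iota>: "\<kappa> = add_mset i \<iota>" ..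
    have "boson \<mu> (int i + 1) g \<iota> = 0" by (rule b) (use i \<kappa> \<iota> in auto)
    then show ?thesis using \<iota> boson_eq_0D by simp
  next
    case False
    then have all0: "\<forall>i\<in>#\<kappa>. i = 0" and h: "h = 0 \<or> \<kappa> = {#}" by (auto simp: multiset_nonemptyE)
    have "\<kappa> \<noteq> {#}" using \<kappa> m by auto
    then have h: "h = 0" using h by simp
    from \<open>\<kappa> \<noteq> {#}\<close> obtain i \<kappa>' where "\<kappa> = add_mset i \<kappa>'" by (meson multiset_cases)
    then have \<kappa>': "\<kappa> = add_mset 0 \<kappa>'" using all0 by simp
    show ?thesis
    proof (cases \<kappa>')
      case empty
      then show ?thesis using one[OF h] \<kappa> \<kappa>' by simp
    next
      case (add j \<iota>)
      then have \<iota>: "\<kappa>' = add_mset 0 \<iota>" using all0 \<kappa>' by simp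
      then have lev: "int (level \<iota>) = int m - 2" using \<kappa> \<kappa>' by simp
      have "boson \<mu> (- l) (boson \<mu> (2 + l) g) \<iota> = 0" if "l \<ge> 1" for l
      proof -
        have "boson \<mu> (- l) (boson \<mu> (2 + l) g) \<iota> = boson \<mu> (- l) 0 \<iota>"
          by (rule boson_local) (use lev that in \<open>auto intro!: b\<close>)
        then show ?thesis by simp
      qed
      moreover have "boson \<mu> 2 g \<iota> = 0" by (rule b) (use lev in auto)
      moreover have "fock_L \<mu> (- \<beta>) 2 g \<iota> = 0" by (rule sing) (use lev in auto)
      moreover have "{1..<2::int} = {1}" by auto
      ultimately have "boson \<mu> 1 (boson \<mu> 1 g) \<iota> = 0"
        using fock_L_pos_eq[of 2 \<iota> "int (level \<iota>)" \<mu> "- \<beta>" g] by simp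
      then have "boson \<mu> 1 g (add_mset 0 \<iota>) = 0" using boson_eq_0D[of 0 "boson \<mu> 1 g"] by simp
      then show ?thesis using boson_eq_0D[of 0 g] \<kappa>' \<iota> by simp
    qed
  qed
qed

text \<open>
  A vector orthogonal to the family at level \<open>m\<close> is killed by all transposes of the \<open>L(-k)\<close>, by induction,
  since the \<open>L(-k)\<close> map the family to its span.  So the family generates the Fock space.
\<close>
lemma spanning_vec_separate:
  assumes "\<And>\<kappa>. level \<kappa> = m \<Longrightarrow> fock_form 1 (int m) (spanning_vec \<kappa>) g = 0" "level \<kappa> = m"
  shows "g \<kappa> = 0"
  using assms
proof (induction m arbitrary: g \<kappa> rule: less_induct)
  case (less m)
  show ?case
  proof (cases "m = 0")
    case True
    have "{\<kappa>. level \<kappa> = 0} = {{#}}" by auto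
    then have "g {#} = 0" using less(2)[of "{#}"] True by (simp add: spanning_vec_def fock_form_def mono_vec_def fock_weight_def)
    then show ?thesis using less True by simp
  next
    case False
    show ?thesis
    proof (rule cosingular_eq_0[of m])
      fix k \<kappa>' assume k: "k > 0" "int (level \<kappa>') = int m - k"
      define j where "j = nat k - 1"
      have j: "k = int j + 1" "Suc j + level \<kappa>' = m" using k by (auto simp: j_def)
      have z: "fock_form 1 (int m) f g = 0" if "f \<in> fun_space.span {spanning_vec \<kappa> | \<kappa>. level \<kappa> = m}" for f
        using that
      proof (induction rule: fun_space.span_induct_alt)
        case base show ?case by (rule fock_form_zero)
      next
        case (step c f f')
        then have "fock_form 1 (int m) g f = 0" using less(2) by (auto simp: fock_form_commute)
        then show ?case using step
          by (simp only: fock_form_commute[of _ _ _ g] fock_form_add fock_form_scale mult_zero_right add_0)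
      qed
      have "fock_form 1 (int (level \<kappa>')) (spanning_vec \<nu>) (fock_L \<mu> (- \<beta>) k g) = 0" if "level \<nu> = level \<kappa>'" for \<nu>
      proof -
        have "fock_form 1 (int m) (fock_L \<mu> \<beta> (- k) (spanning_vec \<nu>)) g = 0"
          using z[of "fock_L \<mu> \<beta> (- k) (spanning_vec \<nu>)"] L_spanning_vec[of j \<nu>] j that by simp
        then show ?thesis using fock_form_fock_L[of "- k" "int m" \<mu> \<beta> "spanning_vec \<nu>" g] k by simp
      qed
      then show "fock_L \<mu> (- \<beta>) k g \<kappa>' = 0"
        using less(1)[of "level \<kappa>'" "fock_L \<mu> (- \<beta>) k g" \<kappa>'] j by simp
    next
      assume h: "h = 0" and m: "m = 1"
      have s: "{\<kappa>. level \<kappa> = Suc 0} = {{#0#}}" by (auto simp: fock.level_eq_1_iff)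
      have "spanning_vec {#0#} {#0#} = 1" unfolding spanning_vec_def using h by (simp add: mono_vec_def)
      then show "g {#0#} = 0"
        using less(2)[of "{#0#}"] m fock_weight_add[of 1 0 "{#}"] by (simp add: fock_form_def s fock_weight_def)
    qed (use False less in auto)
  qed
qed

text \<open>
  At each level the family has as many members as there are coefficients, so
  its coefficient matrix is square.
\<close>
lemma spanning_vec_independent:
  assumes b: "\<And>\<iota>. level \<iota> = m \<Longrightarrow> (\<Sum>\<kappa> | level \<kappa> = m. b \<kappa> * spanning_vec \<kappa> \<iota>) = 0" and \<kappa>: "level \<kappa> = m"
  shows "b \<kappa> = 0"
proof -
  let ?I = "{\<kappa>. level \<kappa> = m}"
  have "nondegenerate_on ?I (\<lambda>\<kappa> \<iota>. fock_weight 1 \<iota> * spanning_vec \<kappa> \<iota>)"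
    unfolding nondegenerate_on_def
    using spanning_vec_separate[of m] by (auto simp: fock_form_def)
  from nondegenerate_on_transpose[OF finite_level this]
  have "nondegenerate_on ?I (\<lambda>\<iota> \<kappa>. fock_weight 1 \<iota> * spanning_vec \<kappa> \<iota>)" .
  moreover have "(\<Sum>\<kappa> | level \<kappa> = m. fock_weight 1 \<iota> * spanning_vec \<kappa> \<iota> * b \<kappa>) = 0" if "level \<iota> = m" for \<iota>
  proof -
    have "(\<Sum>\<kappa> | level \<kappa> = m. fock_weight 1 \<iota> * spanning_vec \<kappa> \<iota> * b \<kappa>) = fock_weight 1 \<iota> * (\<Sum>\<kappa> | level \<kappa> = m. b \<kappa> * spanning_vec \<kappa> \<iota>)"
      unfolding sum_distrib_left by (rule sum.cong) (simp_all only: mult.assoc mult.commute[of "b _"])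
    then show ?thesis using b[OF that] by simp
  qed
  ultimately show ?thesis using \<kappa> unfolding nondegenerate_on_def by auto
qed

end

text \<open>The partitions of \<open>m\<close>, in case \<open>h = 0\<close> those without a part \<open>1\<close> (encoded as \<open>0\<close>).\<close>
definition basis_parts :: "nat \<Rightarrow> nat \<Rightarrow> nat multiset set" where
  "basis_parts h m = {\<kappa>. level \<kappa> = m \<and> (h = 0 \<longrightarrow> 0 \<notin># \<kappa>)}"

lemma finite_basis_parts: "finite (basis_parts h m)"
  unfolding basis_parts_def by (rule finite_subset[OF _ finite_level[of m]]) auto

lemma (in fock_parameters) fock_gram_nondegenerate:
  assumes g: "\<And>\<kappa> \<iota>. \<kappa> \<in> basis_parts h m \<Longrightarrow> \<iota> \<in> basis_parts h m \<Longrightarrow> fock.down \<kappa> (fock.up \<iota> vac) = fscale (g \<kappa> \<iota>) vac"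
  shows "nondegenerate_on (basis_parts h m) g"
  unfolding nondegenerate_on_def
proof (intro allI impI)
  let ?P = "basis_parts h m"
  fix b assume b: "\<forall>\<kappa>\<in>?P. (\<Sum>\<iota>\<in>?P. g \<kappa> \<iota> * b \<iota>) = 0"
  define y where "y = (\<Sum>\<iota>\<in>?P. fscale (b \<iota>) (fock.up \<iota> vac))"
  have y_lev: "y \<in> fock.level_space vac (int m)"
    unfolding y_def by (intro fun_space.subspace_sum fun_space.subspace_scale fock.subspace_level_space fock.up_in_level_space)
       (auto simp: basis_parts_def)
  have y0: "y \<kappa> = 0" if "level \<kappa> = m" for \<kappa>
  proof (rule vacuum_coefficients_separate[OF _ that])
    fix \<kappa> assume lev: "level \<kappa> = m"
    show "fock.down \<kappa> y {#} = 0"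
    proof (cases "\<kappa> \<in> ?P")
      case True
      have "fock.down \<kappa> y = (\<Sum>\<iota>\<in>?P. fscale (b \<iota>) (fscale (g \<kappa> \<iota>) vac))"
        unfolding y_def using g[OF True]
        by (simp only: fun_pair.linear_sum[OF fock.linear_down] fun_pair.linear_scale[OF fock.linear_down] cong: sum.cong)
      then have "fock.down \<kappa> y {#} = (\<Sum>\<iota>\<in>?P. g \<kappa> \<iota> * b \<iota>)"
        by (simp add: sum_apply_fun mono_vec_def mult.commute)
      then show ?thesis using b True by simp
    next
      case False
      then have h: "h = 0" and "0 \<in># \<kappa>" using lev by (auto simp: basis_parts_def)
      from multi_member_split[OF this(2)] obtain \<kappa>' where \<kappa>': "\<kappa> = add_mset 0 \<kappa>'" ..
      have "fock.down \<kappa>' y \<in> fock.level_space vac (int m - int (level \<kappa>'))"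
        by (rule fock.down_level_space[OF highest_weight_vac y_lev])
      moreover have "int m - int (level \<kappa>') = 1" using lev \<kappa>' by simp
      ultimately have "fock.down \<kappa>' y = 0" using fock.level_space_1[OF L_vac_weight_0[OF h]] by simp
      then show ?thesis by (simp add: \<kappa>' fock.down_add_0)
    qed
  qed
  show "\<forall>\<iota>\<in>?P. b \<iota> = 0"
  proof
    fix \<iota> assume \<iota>: "\<iota> \<in> ?P"
    have "(if \<iota> \<in> ?P then b \<iota> else 0) = 0"
    proof (rule spanning_vec_independent[of m "\<lambda>\<iota>. if \<iota> \<in> ?P then b \<iota> else 0"])
      fix \<kappa> assume "level \<kappa> = m"
      have "(\<Sum>\<iota> | level \<iota> = m. (if \<iota> \<in> ?P then b \<iota> else 0) * spanning_vec \<iota> \<kappa>) = (\<Sum>\<iota>\<in>?P. b \<iota> * fock.up \<iota> vac \<kappa>)"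
        by (rule sum.mono_neutral_cong_right[OF finite_level]) (auto simp: basis_parts_def spanning_vec_def)
      also have "\<dots> = y \<kappa>" by (simp add: y_def sum_apply_fun)
      also have "\<dots> = 0" using y0 \<open>level \<kappa> = m\<close> by simp
      finally show "(\<Sum>\<iota> | level \<iota> = m. (if \<iota> \<in> ?P then b \<iota> else 0) * spanning_vec \<iota> \<kappa>) = 0" .
    qed (use \<iota> in \<open>simp add: basis_parts_def\<close>)
    then show "b \<iota> = 0" using \<iota> by simp
  qed
qed

text \<open>
  The square roots \<open>\<mu>\<close> of \<open>2h - \<theta>\<^sup>2\<close> are real if \<open>\<theta>\<^sup>2 \<le> 2h\<close>; otherwise they are imaginary of absolute
  value \<open>sqrt (\<theta>\<^sup>2 - 2h)\<close>, which is less than \<open>\<theta>\<close> for \<open>h > 0\<close>.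
\<close>
lemma fock_parameters_exist:
  assumes "c \<in> \<real>" "Re c > 1"
  obtains \<mu> \<beta> \<theta> where "fock_parameters \<mu> \<beta> \<theta> h" "1 - 12 * \<beta>\<^sup>2 = c"
proof -
  define \<theta> where "\<theta> = sqrt ((Re c - 1) / 12)"
  define \<beta> where "\<beta> = \<i> * of_real \<theta>"
  have \<theta>: "\<theta> > 0" using assms by (simp add: \<theta>_def)
  have \<beta>2: "\<beta>\<^sup>2 = of_real (- \<theta>\<^sup>2)" by (simp add: \<beta>_def power_mult_distrib)
  have \<theta>2: "\<theta>\<^sup>2 = (Re c - 1) / 12" using assms by (simp add: \<theta>_def)
  have c: "1 - 12 * \<beta>\<^sup>2 = c"
    using assms(1) unfolding \<beta>2 \<theta>2 by (simp add: complex_eq_iff complex_is_Real_iff field_simps)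
  have "\<exists>\<mu>. \<mu>\<^sup>2 = 2 * of_nat h + \<beta>\<^sup>2 \<and> 0 \<le> Im \<mu> \<and> Im \<mu> \<le> \<theta> \<and> (h > 0 \<longrightarrow> Im \<mu> < \<theta>) \<and> (h = 0 \<longrightarrow> \<mu> = \<beta>)"
  proof (cases "h = 0")
    case True
    then show ?thesis using \<theta> by (intro exI[of _ \<beta>]) (simp add: \<beta>_def)
  next
    case False
    define s where "s = 2 * real h - \<theta>\<^sup>2"
    have s: "2 * of_nat h + \<beta>\<^sup>2 = of_real s" by (simp add: s_def \<beta>2)
    show ?thesis
    proof (cases "s \<ge> 0")
      case True
      then show ?thesis using \<theta> False unfolding s
        by (intro exI[of _ "of_real (sqrt s)"]) (simp add: of_real_power[symmetric] del: of_real_power)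
    next
      case neg: False
      have "sqrt (- s) < \<theta>" using False \<theta> by (intro real_less_lsqrt) (auto simp: s_def)
      then show ?thesis using neg \<theta> False unfolding s
        by (intro exI[of _ "\<i> * of_real (sqrt (- s))"]) (simp add: power_mult_distrib of_real_power[symmetric] del: of_real_power)
    qed
  qed
  then obtain \<mu> where "\<mu>\<^sup>2 = 2 * of_nat h + \<beta>\<^sup>2" "0 \<le> Im \<mu>" "Im \<mu> \<le> \<theta>" "h > 0 \<longrightarrow> Im \<mu> < \<theta>" "h = 0 \<longrightarrow> \<mu> = \<beta>" by blast
  then have "fock_parameters \<mu> \<beta> \<theta> h" using \<theta> \<beta>_def by unfold_locales auto
  then show ?thesis using that c by blast
qed

text \<open>
  The substitute for the Kac determinant formula, transferred from the Fock space to an arbitrary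
  module of the same central charge.
\<close>
theorem (in virasoro_module) gram_nondegenerate:
  assumes c: "c \<in> \<real>" "Re c > 1" and v: "highest_weight (of_nat h) v"
  obtains g where "\<And>\<kappa> \<iota>. level \<kappa> = level \<iota> \<Longrightarrow> down \<kappa> (up \<iota> v) = scale (g \<kappa> \<iota>) v"
    and "\<And>m. nondegenerate_on (basis_parts h m) g"
proof -
  obtain \<mu> \<beta> \<theta> where "fock_parameters \<mu> \<beta> \<theta> h" and cb: "1 - 12 * \<beta>\<^sup>2 = c"
    using fock_parameters_exist[OF c] by blast
  then interpret F: fock_parameters \<mu> \<beta> \<theta> h by simp
  have "\<forall>\<kappa> \<iota>. \<exists>t. level \<kappa> = level \<iota> \<longrightarrow> down \<kappa> (up \<iota> v) = scale t v \<and> F.fock.down \<kappa> (F.fock.up \<iota> F.vac) = fscale t F.vac"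
    using down_up_universal[OF virasoro_module_axioms F.fock.virasoro_module_axioms[unfolded cb] v F.highest_weight_vac] by blast
  then obtain g where g: "\<And>\<kappa> \<iota>. level \<kappa> = level \<iota> \<Longrightarrow> down \<kappa> (up \<iota> v) = scale (g \<kappa> \<iota>) v \<and> F.fock.down \<kappa> (F.fock.up \<iota> F.vac) = fscale (g \<kappa> \<iota>) F.vac"
    by metis
  show ?thesis
  proof (rule that[of g])
    show "nondegenerate_on (basis_parts h m) g" for m
      by (rule F.fock_gram_nondegenerate) (use g in \<open>auto simp: basis_parts_def\<close>)
  qed (use g in auto)
qed

section \<open>Semisimplicity of graded Virasoro modules\<close>

context vector_space
begin

lemma span_Union_decompose:
  assumes "x \<in> span (\<Union>i\<in>I. W i)" "\<And>i. i \<in> I \<Longrightarrow> subspace (W i)"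
  obtains t y where "finite t" "t \<subseteq> I" "\<And>i. i \<in> I \<Longrightarrow> y i \<in> W i" "x = (\<Sum>i\<in>t. y i)"
proof -
  have "\<exists>t y. finite t \<and> t \<subseteq> I \<and> (\<forall>i\<in>I. y i \<in> W i) \<and> (\<forall>i. i \<notin> t \<longrightarrow> y i = 0) \<and> x = (\<Sum>i\<in>t. y i)"
    using assms(1)
  proof (induction rule: span_induct_alt)
    case base
    show ?case using assms(2) by (intro exI[of _ "{}"] exI[of _ "\<lambda>_. 0"]) (auto intro: subspace_0)
  next
    case (step c w x)
    then obtain t y where ty: "finite t" "t \<subseteq> I" "\<forall>i\<in>I. y i \<in> W i" "\<forall>i. i \<notin> t \<longrightarrow> y i = 0" "x = (\<Sum>i\<in>t. y i)" by blast
    obtain j where j: "j \<in> I" "w \<in> W j" using step by blast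
    define z where "z i = (if i = j then scale c w else 0) + y i" for i
    have "(\<Sum>i\<in>insert j t. z i) = scale c w + (\<Sum>i\<in>insert j t. y i)"
      using ty(1) by (simp add: z_def sum.distrib)
    also have "(\<Sum>i\<in>insert j t. y i) = x"
      using ty by (auto intro: sum.mono_neutral_right)
    finally have "scale c w + x = (\<Sum>i\<in>insert j t. z i)" ..
    moreover have "\<forall>i\<in>I. z i \<in> W i"
      using ty(3) j assms(2) by (auto simp: z_def intro: subspace_add subspace_scale)
    moreover have "\<forall>i. i \<notin> insert j t \<longrightarrow> z i = 0" using ty(4) by (simp add: z_def)
    ultimately show ?case using ty(1,2) j(1)
      by (intro exI[of _ "insert j t"] exI[of _ z]) simp
  qed
  then show ?thesis using that by blast
qed

lemma internal_direct_sum_imageI: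
  assumes sub: "\<And>i. i \<in> I \<Longrightarrow> subspace (W i)" and inj: "inj_on W I"
    and span: "\<And>x. x \<in> span (\<Union>i\<in>I. W i)"
    and ind: "\<And>t y. finite t \<Longrightarrow> t \<subseteq> I \<Longrightarrow> (\<And>i. i \<in> t \<Longrightarrow> y i \<in> W i) \<Longrightarrow> (\<Sum>i\<in>t. y i) = 0 \<Longrightarrow> \<forall>i\<in>t. y i = 0"
  shows "internal_direct_sum (W ` I) (\<lambda>X. X)"
  unfolding internal_direct_sum_def
proof (intro conjI allI ballI ex_ex1I)
  fix X assume "X \<in> W ` I" then show "subspace X" using sub by auto
next
  fix x
  obtain t y where ty: "finite t" "t \<subseteq> I" "\<And>i. i \<in> I \<Longrightarrow> y i \<in> W i" "x = (\<Sum>i\<in>t. y i)"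
    using span_Union_decompose[OF span sub] by metis
  define f where "f X = (if X \<in> W ` t then y (inv_into I W X) else 0)" for X
  have f: "f (W i) = y i" if "i \<in> t" for i
    using that ty(2) inj by (auto simp: f_def)
  have supp: "{X. f X \<noteq> 0} \<subseteq> W ` t" by (auto simp: f_def)
  have "(\<Sum>X | f X \<noteq> 0. f X) = (\<Sum>X\<in>W ` t. f X)"
    using ty(1) supp by (intro sum.mono_neutral_left) auto
  also have "\<dots> = x"
    using inj_on_subset[OF inj ty(2)] by (simp add: sum.reindex f ty(4))
  finally have "x = (\<Sum>X | f X \<noteq> 0. f X)" ..
  moreover have "\<forall>X\<in>W ` I. f X \<in> X"
    using ty sub inj by (auto simp: f_def subspace_0)
  moreover have "\<forall>X. X \<notin> W ` I \<longrightarrow> f X = 0" using ty(2) by (auto simp: f_def)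
  moreover have "finite {X. f X \<noteq> 0}" using supp ty(1) by (meson finite_imageI finite_subset)
  ultimately show "\<exists>f. (\<forall>i\<in>W ` I. f i \<in> i) \<and> (\<forall>i. i \<notin> W ` I \<longrightarrow> f i = 0) \<and> finite {i. f i \<noteq> 0} \<and> x = (\<Sum>i | f i \<noteq> 0. f i)"
    by blast
next
  fix x f g
  assume f: "(\<forall>i\<in>W ` I. f i \<in> i) \<and> (\<forall>i. i \<notin> W ` I \<longrightarrow> f i = 0) \<and> finite {i. f i \<noteq> 0} \<and> x = (\<Sum>i | f i \<noteq> 0. f i)"
    and g: "(\<forall>i\<in>W ` I. g i \<in> i) \<and> (\<forall>i. i \<notin> W ` I \<longrightarrow> g i = 0) \<and> finite {i. g i \<noteq> 0} \<and> x = (\<Sum>i | g i \<noteq> 0. g i)"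
  define A where "A = {i. f i \<noteq> 0} \<union> {i. g i \<noteq> 0}"
  have A: "finite A" using f g by (auto simp: A_def)
  have sub': "A \<subseteq> W ` I" using f g unfolding A_def by blast
  obtain t where t: "t \<subseteq> I" "inj_on W t" "A = W ` t"
    using subset_image_inj[of A W I] sub' by auto
  then have fin: "finite t" using A by (metis finite_imageD)
  have "(\<Sum>i | f i \<noteq> 0. f i) = sum f A" "(\<Sum>i | g i \<noteq> 0. g i) = sum g A"
    by (intro sum.mono_neutral_left A; auto simp: A_def)+
  then have sum0: "(\<Sum>i\<in>t. f (W i) - g (W i)) = 0"
    using f g sum.reindex[OF t(2), of f] sum.reindex[OF t(2), of g] by (simp add: sum_subtractf t(3) comp_def)
  have mem: "f (W i) - g (W i) \<in> W i" if "i \<in> t" for i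
  proof -
    have "i \<in> I" using that t(1) by blast
    then show ?thesis using f g sub by (simp add: subspace_diff)
  qed
  have "\<forall>i\<in>t. f (W i) - g (W i) = 0" by (rule ind[OF fin t(1) mem sum0])
  then have "\<forall>X\<in>A. f X = g X" by (auto simp: t(3))
  moreover have "\<forall>X. X \<notin> A \<longrightarrow> f X = g X" by (auto simp: A_def)
  ultimately show "f = g" by blast
qed

end

lemma (in virasoro_module) L_weight_space: "x \<in> weight_space n \<Longrightarrow> L k x \<in> weight_space (n - k)"
  using L_swap[of 0 k x] 
  by (auto simp: weight_space_def L_scale scale_left_distrib[symmetric] scale_left_diff_distrib[symmetric])

locale graded_virasoro_module = virasoro_module scale L c
  for scale :: "complex \<Rightarrow> 'v::ab_group_add \<Rightarrow> 'v" and L :: "int \<Rightarrow> 'v \<Rightarrow> 'v" and c :: complex +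
  assumes c: "c \<in> \<real>" "Re c > 1"
    and grading: "internal_direct_sum UNIV weight_space"
    and finite_dimensional: "\<exists>B. finite B \<and> weight_space n = span B"
    and weights_nonneg: "n < 0 \<Longrightarrow> weight_space n = {0}"
    and L_weight_0: "v \<in> weight_space 0 \<Longrightarrow> L (- 1) v = 0"
    and L_weight_1: "v \<in> weight_space 1 \<Longrightarrow> L 1 v = 0"
begin

lemma subspace_weight_space [simp]: "subspace (weight_space n)"
  using grading by (simp add: internal_direct_sum_def)

lemma weight_components_unique:
  assumes N: "finite N" and x: "\<And>n. n \<in> N \<Longrightarrow> x n \<in> weight_space n" and s: "(\<Sum>n\<in>N. x n) = 0"
  shows "\<forall>n\<in>N. x n = 0"
proof -
  define f where "f n = (if n \<in> N then x n else 0)" for n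
  have supp: "{n. f n \<noteq> 0} \<subseteq> N" by (auto simp: f_def)
  have "(\<Sum>n | f n \<noteq> 0. f n) = (\<Sum>n\<in>N. f n)"
    using N supp by (intro sum.mono_neutral_left) auto
  also have "\<dots> = 0" using s by (simp add: f_def)
  finally have s0: "0 = (\<Sum>n | f n \<noteq> 0. f n)" ..
  let ?P = "\<lambda>f. (\<forall>n\<in>UNIV. f n \<in> weight_space n) \<and> (\<forall>n. n \<notin> UNIV \<longrightarrow> f n = 0) \<and> finite {n. f n \<noteq> 0} \<and> 0 = (\<Sum>n | f n \<noteq> 0. f n)"
  have "\<exists>!f. ?P f" using grading unfolding internal_direct_sum_def by (elim conjE allE)
  then obtain k where k: "\<And>g. ?P g \<Longrightarrow> g = k" by (elim ex1E) blast
  have "f = k" by (rule k) (use x s0 finite_subset[OF supp N] in \<open>auto simp: f_def subspace_0\<close>)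
  moreover have "(\<lambda>_. 0) = k" by (rule k) (auto simp: subspace_0)
  ultimately have "f = (\<lambda>_. 0)" by simp
  then show ?thesis by (auto simp: f_def fun_eq_iff split: if_splits)
qed

lemma weight_decomposition: "x \<in> span (\<Union>n. weight_space n)"
proof -
  obtain f where f: "\<forall>n. f n \<in> weight_space n" "x = (\<Sum>n | f n \<noteq> 0. f n)"
    using grading unfolding internal_direct_sum_def by blast
  show ?thesis unfolding f(2) by (intro span_sum span_base) (use f(1) in blast)
qed

lemma down_weight_space: "x \<in> weight_space n \<Longrightarrow> down \<kappa> x \<in> weight_space (n - int (level \<kappa>))"
proof (induction \<kappa> arbitrary: x n rule: multiset_max_induct)
  case (add \<kappa> k)
  have "down \<kappa> (L (int k + 1) x) \<in> weight_space (n - (int k + 1) - int (level \<kappa>))"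
    by (intro add L_weight_space)
  then show ?case using add(1) by (simp add: down_add_max algebra_simps)
qed simp

lemma highest_weight_iff: "highest_weight (of_nat n) v \<longleftrightarrow> (\<forall>k>0. L k v = 0) \<and> v \<in> weight_space (int n)"
  by (auto simp: highest_weight_def weight_space_def)

lemma level_space_weight_space:
  assumes "highest_weight (of_nat h) v" shows "level_space v n \<subseteq> weight_space (int h + n)"
  using L0_level_space[OF assms] by (auto simp: weight_space_def)

text \<open>For \<open>h = 0\<close> a word with a part \<open>1\<close> begins with \<open>L(-1) v = 0\<close>.\<close>
lemma level_space_representation:
  assumes v: "highest_weight (of_nat h) v" and y: "y \<in> level_space v (int m)"
  obtains b where "y = (\<Sum>\<iota>\<in>basis_parts h m. scale (b \<iota>) (up \<iota> v))"
proof -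
  have "\<exists>b. y = (\<Sum>\<iota>\<in>basis_parts h m. scale (b \<iota>) (up \<iota> v))"
    using y
  proof (induction rule: level_space_induct)
    case zero show ?case by (intro exI[of _ "\<lambda>_. 0"]) simp
  next
    case (add x y)
    then obtain b b' where "x = (\<Sum>\<iota>\<in>basis_parts h m. scale (b \<iota>) (up \<iota> v))" "y = (\<Sum>\<iota>\<in>basis_parts h m. scale (b' \<iota>) (up \<iota> v))"
      by blast
    then show ?case by (intro exI[of _ "\<lambda>\<iota>. b \<iota> + b' \<iota>"]) (simp add: scale_left_distrib sum.distrib)
  next
    case (up t \<kappa>)
    show ?case
    proof (cases "\<kappa> \<in> basis_parts h m")
      case True
      have "(\<Sum>\<iota>\<in>basis_parts h m. scale (if \<iota> = \<kappa> then t else 0) (up \<iota> v)) = (\<Sum>\<iota>\<in>basis_parts h m. if \<iota> = \<kappa> then scale t (up \<kappa> v) else 0)"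
        by (rule sum.cong) auto
      then show ?thesis using True by (intro exI[of _ "\<lambda>\<iota>. if \<iota> = \<kappa> then t else 0"]) (simp add: finite_basis_parts)
    next
      case False
      then have "h = 0" "0 \<in># \<kappa>" using up by (auto simp: basis_parts_def)
      from multi_member_split[OF this(2)] obtain \<kappa>' where \<kappa>': "\<kappa> = add_mset 0 \<kappa>'" ..
      have "L (- 1) v = 0" using v highest_weight_iff[of 0 v] \<open>h = 0\<close> by (intro L_weight_0) simp
      then have "up \<kappa> v = 0" by (simp add: \<kappa>' up_add_0)
      then show ?thesis by (intro exI[of _ "\<lambda>_. 0"]) simp
    qed
  qed
  then show ?thesis using that by blast
qed

lemma down_sum_up:
  assumes g: "\<And>\<kappa> \<iota>. level \<kappa> = level \<iota> \<Longrightarrow> down \<kappa> (up \<iota> v) = scale (g \<kappa> \<iota>) v" and \<kappa>: "level \<kappa> = m"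
  shows "down \<kappa> (\<Sum>\<iota>\<in>basis_parts h m. scale (b \<iota>) (up \<iota> v)) = scale (\<Sum>\<iota>\<in>basis_parts h m. g \<kappa> \<iota> * b \<iota>) v"
proof -
  have "down \<kappa> (\<Sum>\<iota>\<in>basis_parts h m. scale (b \<iota>) (up \<iota> v)) = (\<Sum>\<iota>\<in>basis_parts h m. scale (b \<iota>) (down \<kappa> (up \<iota> v)))"
    by (simp add: endo.linear_sum[OF linear_down] endo.linear_scale[OF linear_down])
  also have "\<dots> = (\<Sum>\<iota>\<in>basis_parts h m. scale (g \<kappa> \<iota> * b \<iota>) v)"
    by (rule sum.cong) (use \<kappa> in \<open>auto simp: g basis_parts_def mult.commute\<close>)
  finally show ?thesis by (simp add: scale_sum_left)
qed

lemma level_space_separated: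
  assumes v: "highest_weight (of_nat h) v" "v \<noteq> 0" and y: "y \<in> level_space v (int m)"
    and 0: "\<And>\<kappa>. level \<kappa> = m \<Longrightarrow> down \<kappa> y = 0"
  shows "y = 0"
proof -
  obtain g where g: "\<And>\<kappa> \<iota>. level \<kappa> = level \<iota> \<Longrightarrow> down \<kappa> (up \<iota> v) = scale (g \<kappa> \<iota>) v"
    and nd: "\<And>m. nondegenerate_on (basis_parts h m) g"
    using gram_nondegenerate[OF c v(1)] by blast
  obtain b where b: "y = (\<Sum>\<iota>\<in>basis_parts h m. scale (b \<iota>) (up \<iota> v))"
    using level_space_representation[OF v(1) y] by blast
  have "(\<Sum>\<iota>\<in>basis_parts h m. g \<kappa> \<iota> * b \<iota>) = 0" if "\<kappa> \<in> basis_parts h m" for \<kappa>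
  proof -
    have "level \<kappa> = m" using that by (simp add: basis_parts_def)
    then show ?thesis using 0 v(2) down_sum_up[OF g, where \<kappa> = \<kappa> and m = m and h = h and b = b] by (simp add: b)
  qed
  then have "\<forall>\<iota>\<in>basis_parts h m. b \<iota> = 0" using nd[of m] by (simp add: nondegenerate_on_def)
  then show ?thesis by (simp add: b)
qed

lemma level_space_prescribed:
  assumes v: "highest_weight (of_nat h) v" "v \<noteq> 0"
  obtains y where "y \<in> level_space v (int m)" "\<And>\<kappa>. \<kappa> \<in> basis_parts h m \<Longrightarrow> down \<kappa> y = scale (\<phi> \<kappa>) v"
proof -
  obtain g where g: "\<And>\<kappa> \<iota>. level \<kappa> = level \<iota> \<Longrightarrow> down \<kappa> (up \<iota> v) = scale (g \<kappa> \<iota>) v"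
    and nd: "\<And>m. nondegenerate_on (basis_parts h m) g"
    using gram_nondegenerate[OF c v(1)] by blast
  obtain b where b: "\<forall>\<kappa>\<in>basis_parts h m. (\<Sum>\<iota>\<in>basis_parts h m. g \<kappa> \<iota> * b \<iota>) = \<phi> \<kappa>"
    using nondegenerate_on_solvable[OF finite_basis_parts nd] by blast
  show ?thesis
  proof (rule that)
    show "(\<Sum>\<iota>\<in>basis_parts h m. scale (b \<iota>) (up \<iota> v)) \<in> level_space v (int m)"
      by (intro subspace_sum subspace_scale subspace_level_space up_in_level_space) (auto simp: basis_parts_def)
    show "down \<kappa> (\<Sum>\<iota>\<in>basis_parts h m. scale (b \<iota>) (up \<iota> v)) = scale (\<phi> \<kappa>) v" if "\<kappa> \<in> basis_parts h m" for \<kappa>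
      using down_sum_up[OF g, where \<kappa> = \<kappa> and m = m and h = h and b = b] b that by (simp add: basis_parts_def)
  qed
qed

lemma level_space_singular_eq_0:
  assumes v: "highest_weight (of_nat h) v" "v \<noteq> 0" and y: "y \<in> level_space v m" "m > 0"
    and 0: "\<And>k. k > 0 \<Longrightarrow> L k y = 0"
  shows "y = 0"
proof (rule level_space_separated[OF v, of y "nat m"])
  fix \<kappa> assume \<kappa>: "level \<kappa> = nat m"
  show "down \<kappa> y = 0"
  proof -
    have "\<kappa> \<noteq> {#}" using \<kappa> y(2) by auto
    then obtain k \<kappa>' where "\<kappa> = add_mset k \<kappa>'" "\<forall>i\<in>#\<kappa>'. i \<le> k" using multiset_max_cases by blast
    then show ?thesis by (simp add: down_add_max 0 endo.linear_0[OF linear_down])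
  qed
qed (use y in simp)

end

context virasoro_module
begin

lemma submodule_up: "submodule U \<Longrightarrow> v \<in> U \<Longrightarrow> up \<kappa> v \<in> U"
  by (induction \<kappa> rule: multiset_max_induct) (auto simp: pbw_word_add_max submodule_def)

lemma submodule_down: "submodule U \<Longrightarrow> v \<in> U \<Longrightarrow> down \<kappa> v \<in> U"
  by (induction \<kappa> arbitrary: v rule: multiset_max_induct) (auto simp: down_add_max submodule_def)

definition cyclic :: "'v \<Rightarrow> 'v set" where
  "cyclic v = span (range (\<lambda>\<kappa>. up \<kappa> v))"

lemma subspace_cyclic [simp]: "subspace (cyclic v)"
  by (simp add: cyclic_def)

lemma level_space_cyclic: "level_space v n \<subseteq> cyclic v"
  unfolding level_space_def cyclic_def by (rule span_mono) auto

lemma cyclic_level_spaces: "cyclic v \<subseteq> span (\<Union>n. level_space v n)"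
  unfolding cyclic_def by (rule span_mono) (use up_in_level_space in blast)

lemma generator_in_cyclic: "v \<in> cyclic v"
  unfolding cyclic_def by (rule span_base) (metis pbw_word_empty rangeI)

lemma submodule_cyclic:
  assumes "highest_weight h v" shows "submodule (cyclic v)"
  unfolding submodule_def
proof (intro conjI allI ballI)
  fix n y assume "y \<in> cyclic v"
  then show "L n y \<in> cyclic v"
    unfolding cyclic_def[of v]
  proof (induction rule: span_induct_alt)
    case base show ?case by (simp add: span_zero)
  next
    case (step t x y)
    then obtain \<kappa> where "x = up \<kappa> v" by blast
    then have "L n x \<in> cyclic v"
      using L_level_space[OF assms up_in_level_space[OF refl], of n \<kappa>] level_space_cyclic by blast
    then show ?case using step by (simp add: L_add L_scale span_add span_scale cyclic_def)
  qed
qed simp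

end

context graded_virasoro_module
begin

text \<open>
  The component of highest level of a nonzero vector \<open>u\<close> is sent to a nonzero multiple of \<open>v\<close> by some
  lowering word, which kills the components of lower level.
\<close>
lemma irreducible_cyclic:
  assumes v: "highest_weight (of_nat h) v" "v \<noteq> 0"
  shows "irreducible_submodule (cyclic v)"
  unfolding irreducible_submodule_def
proof (intro conjI allI impI)
  show "submodule (cyclic v)" using v(1) by (rule submodule_cyclic)
  show "cyclic v \<noteq> {0}" using generator_in_cyclic[of v] v(2) by auto
  fix U assume U: "submodule U \<and> U \<subseteq> cyclic v"
  show "U = {0} \<or> U = cyclic v"
  proof (cases "U \<subseteq> {0}")
    case True
    moreover have "0 \<in> U" using U by (simp add: submodule_def subspace_0)
    ultimately show ?thesis by blast
  next
    case False
    then obtain u where u: "u \<in> U" "u \<noteq> 0" by blast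
    then have "u \<in> span (\<Union>n\<in>UNIV. level_space v n)" using U cyclic_level_spaces by blast
    then obtain t y where ty: "finite t" "\<And>n. y n \<in> level_space v n" "u = (\<Sum>n\<in>t. y n)"
      by (rule span_Union_decompose) auto
    define A where "A = {n\<in>t. y n \<noteq> 0}"
    have A: "finite A" "A \<noteq> {}" using ty u(2) by (auto simp: A_def intro: sum.neutral)
    define M where "M = Max A"
    have M: "M \<in> A" unfolding M_def using A by (rule Max_in)
    have "M \<ge> 0"
    proof (rule ccontr)
      assume "\<not> M \<ge> 0"
      then have "y M = 0" using ty(2)[of M] level_space_neg[of M v] by simp
      then show False using M by (simp add: A_def)
    qed
    then have yM: "y M \<in> level_space v (int (nat M))" using ty(2)[of M] by simp
    have "y M \<noteq> 0" using M by (simp add: A_def)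
    then obtain \<kappa> where \<kappa>: "level \<kappa> = nat M" "down \<kappa> (y M) \<noteq> 0"
      using level_space_separated[OF v yM] by blast
    have "down \<kappa> (y M) \<in> level_space v 0"
      using down_level_space[OF v(1) yM, of \<kappa>] \<kappa>(1) by simp
    then obtain s where s: "down \<kappa> (y M) = scale s v" by (auto simp: level_space_0)
    have z: "down \<kappa> (y n) = 0" if "n \<in> t" "n \<noteq> M" for n
    proof (cases "n < M")
      case True
      then show ?thesis
        using down_level_space[OF v(1) ty(2), of \<kappa> n] \<kappa>(1) \<open>M \<ge> 0\<close> level_space_neg[of "n - int (level \<kappa>)" v] by simp
    next
      case False
      then have "n \<notin> A" using that(2) Max_ge[OF A(1), of n] by (auto simp: M_def)
      then show ?thesis using that by (simp add: A_def endo.linear_0[OF linear_down])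
    qed
    have "down \<kappa> u = (\<Sum>n\<in>t. down \<kappa> (y n))" by (simp add: ty(3) endo.linear_sum[OF linear_down])
    also have "\<dots> = (\<Sum>n\<in>{M}. down \<kappa> (y n))"
      using ty(1) M z by (intro sum.mono_neutral_right) (auto simp: A_def)
    finally have du: "down \<kappa> u = scale s v" using s by simp
    have "s \<noteq> 0" using \<kappa>(2) s by auto
    then have "v = scale (1 / s) (down \<kappa> u)" by (simp add: du)
    moreover have "down \<kappa> u \<in> U" using U u(1) by (intro submodule_down) auto
    ultimately have "v \<in> U" using U by (metis submodule_def subspace_scale)
    then have "range (\<lambda>\<kappa>. up \<kappa> v) \<subseteq> U" using U submodule_up by blast
    then have "cyclic v \<subseteq> U" unfolding cyclic_def by (rule span_minimal) (use U in \<open>simp add: submodule_def\<close>)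
    then show ?thesis using U by blast
  qed
qed

lemma singular_basis_exists:
  obtains B wt where "independent B" "\<And>v. v \<in> B \<Longrightarrow> highest_weight (of_nat (wt v)) v"
    "\<And>n. finite {v\<in>B. wt v = n}" "\<And>n x. highest_weight (of_nat n) x \<Longrightarrow> x \<in> span {v\<in>B. wt v = n}"
proof -
  have "\<forall>n. \<exists>b. b \<subseteq> {x. highest_weight (of_nat n) x} \<and> independent b \<and> {x. highest_weight (of_nat n) x} \<subseteq> span b"
    by (metis maximal_independent_subset)
  then obtain b where b: "\<And>n v. v \<in> b n \<Longrightarrow> highest_weight (of_nat n) v" "\<And>n. independent (b n)"
    "\<And>n x. highest_weight (of_nat n) x \<Longrightarrow> x \<in> span (b n)"
    by (metis mem_Collect_eq subsetD)
  define B where "B = (\<Union>n. b n)"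
  define wt where "wt v = (SOME n. v \<in> b n)" for v
  have w: "v \<in> b n \<Longrightarrow> v \<in> weight_space (int n)" for v n using b(1) highest_weight_iff by blast
  have n0: "v \<in> b n \<Longrightarrow> v \<noteq> 0" for v n using b(2) dependent_zero by metis
  have wt: "wt v = n" if v: "v \<in> b n" for v n
  proof -
    have "v \<in> b (wt v)" unfolding wt_def using v by (rule someI)
    then have "scale (of_nat n) v = scale (of_nat (wt v)) v"
      using b(1)[of v n] b(1)[of v "wt v"] v by (simp add: highest_weight_def)
    then show ?thesis using n0[OF v] by simp
  qed
  have B: "{v\<in>B. wt v = n} = b n" for n using wt by (auto simp: B_def)
  show ?thesis
  proof (rule that[of B wt])
    show "independent B"
      unfolding dependent_explicit
    proof safe
      fix t u v assume t: "finite t" "t \<subseteq> B" "(\<Sum>v\<in>t. scale (u v) v) = 0" and v: "v \<in> t" "u v \<noteq> 0"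
      let ?x = "\<lambda>n. \<Sum>v | v \<in> t \<and> int (wt v) = n. scale (u v) v"
      have "(\<Sum>n\<in>(\<lambda>v. int (wt v)) ` t. ?x n) = 0"
        using sum.image_gen[OF t(1), of "\<lambda>v. scale (u v) v" "\<lambda>v. int (wt v)"] t(3) by simp
      moreover have "?x n \<in> weight_space n" for n
      proof (intro subspace_sum subspace_scale subspace_weight_space)
        fix v assume "v \<in> {v. v \<in> t \<and> int (wt v) = n}"
        then have "v \<in> b (wt v)" "int (wt v) = n" using t(2) wt by (auto simp: B_def)
        then show "v \<in> weight_space n" using w by blast
      qed
      ultimately have "?x (int (wt v)) = 0"
        using weight_components_unique[of "(\<lambda>v. int (wt v)) ` t" ?x] t(1) v(1) by blast
      moreover have "finite {w. w \<in> t \<and> int (wt w) = int (wt v)}" "{w. w \<in> t \<and> int (wt w) = int (wt v)} \<subseteq> b (wt v)"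
        using t(1,2) B[of "wt v"] by auto
      ultimately have "u v = 0" using independentD[OF b(2)] v(1) by blast
      then show False using v(2) by simp
    qed
    show "finite {v\<in>B. wt v = n}" for n
    proof -
      obtain F where "finite F" "weight_space (int n) = span F" using finite_dimensional by blast
      then show ?thesis unfolding B using independent_span_bound[OF _ b(2), of F n] w by blast
    qed
    show "highest_weight (of_nat (wt v)) v" if "v \<in> B" for v
      using that b(1) wt by (auto simp: B_def)
    show "x \<in> span {v\<in>B. wt v = n}" if "highest_weight (of_nat n) x" for n x
      unfolding B using that by (rule b(3))
  qed
qed

end

text \<open>
  A homogeneous basis of the space of singular vectors.  Its elements will generate the summands of
  the decomposition.
\<close>
locale singular_basis = graded_virasoro_module scale L c
  for scale :: "complex \<Rightarrow> 'v::ab_group_add \<Rightarrow> 'v" and L :: "int \<Rightarrow> 'v \<Rightarrow> 'v" and c :: complex +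
  fixes B :: "'v set" and wt :: "'v \<Rightarrow> nat"
  assumes independent_B: "independent B"
    and highest_weight_B: "v \<in> B \<Longrightarrow> highest_weight (of_nat (wt v)) v"
    and finite_B: "finite {v\<in>B. wt v = n}"
    and span_B: "highest_weight (of_nat n) x \<Longrightarrow> x \<in> span {v\<in>B. wt v = n}"
begin

lemma B_nonzero: "v \<in> B \<Longrightarrow> v \<noteq> 0"
  using independent_B dependent_zero by metis

text \<open>
  If the \<open>y v\<close> of total weight \<open>n\<close> add up to zero, then so do the \<open>L k (y v)\<close>.  By induction every \<open>y v\<close> is
  singular, hence zero or a multiple of \<open>v\<close>, and the basis vectors are independent.
\<close>
lemma level_spaces_independent:
  assumes "finite t" "t \<subseteq> B" "\<And>v. v \<in> t \<Longrightarrow> y v \<in> level_space v (int n - int (wt v))" "(\<Sum>v\<in>t. y v) = 0" "v \<in> t"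
  shows "y v = 0"
  using assms(3-)
proof (induction n arbitrary: y v rule: less_induct)
  case (less n)
  have hw: "v \<in> t \<Longrightarrow> highest_weight (of_nat (wt v)) v" for v using assms(2) highest_weight_B by blast
  have L0: "L k (y v) = 0" if k: "k > 0" and v: "v \<in> t" for k v
  proof -
    have lev: "L k (y v) \<in> level_space v (int n - k - int (wt v))" if "v \<in> t" for v
      using L_level_space[OF hw[OF that] less(2)[OF that], of k] by (simp add: algebra_simps)
    show ?thesis
    proof (cases "k \<le> int n")
      case True
      have "(\<Sum>v\<in>t. L k (y v)) = 0" using less(3) by (simp add: L_sum[symmetric])
      then show ?thesis using less(1)[of "nat (int n - k)" "\<lambda>v. L k (y v)" v] lev v k True by simp
    next
      case False
      then show ?thesis using lev[OF v] level_space_neg[of "int n - k - int (wt v)" v] by simp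
    qed
  qed
  have ne: "y v = 0" if v: "v \<in> t" "wt v \<noteq> n" for v
  proof (cases "wt v < n")
    case True
    show ?thesis
      by (rule level_space_singular_eq_0[OF hw[OF v(1)] B_nonzero less(2)[OF v(1)]])
        (use True v assms(2) L0 in auto)
  next
    case False
    then show ?thesis using less(2)[OF v(1)] level_space_neg[of "int n - int (wt v)" v] v(2) by simp
  qed
  have "\<forall>v. \<exists>s. v \<in> t \<longrightarrow> wt v = n \<longrightarrow> y v = scale s v"
    using less(2) by (force simp: level_space_0)
  then obtain s where s: "\<And>v. v \<in> t \<Longrightarrow> wt v = n \<Longrightarrow> y v = scale (s v) v" by metis
  show ?case
  proof (cases "wt v = n")
    case True
    have "(\<Sum>v | v \<in> t \<and> wt v = n. scale (s v) v) = (\<Sum>v\<in>t. y v)"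
      by (rule sum.mono_neutral_cong_left) (use assms(1) ne s in auto)
    also have "\<dots> = 0" by (rule less(3))
    finally have "s v = 0"
      using independentD[OF independent_B, of "{v. v \<in> t \<and> wt v = n}" s v] assms(1,2) less(4) True by auto
    then show ?thesis using s[OF less(4) True] by simp
  next
    case False then show ?thesis using ne less(4) by blast
  qed
qed

lemma cyclic_independent:
  assumes t: "finite t" "t \<subseteq> B" and y: "\<And>v. v \<in> t \<Longrightarrow> y v \<in> cyclic v" and s: "(\<Sum>v\<in>t. y v) = 0" and v: "v \<in> t"
  shows "y v = 0"
proof -
  have hw: "v \<in> t \<Longrightarrow> highest_weight (of_nat (wt v)) v" for v using t(2) highest_weight_B by blast
  have "\<exists>N z. finite N \<and> (\<forall>n. z n \<in> level_space v (n - int (wt v))) \<and> (\<forall>n. n \<notin> N \<longrightarrow> z n = 0) \<and> y v = (\<Sum>n\<in>N. z n)"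
    if v: "v \<in> t" for v
  proof -
    have "y v \<in> span (\<Union>n\<in>UNIV. level_space v n)" using y[OF v] cyclic_level_spaces by blast
    then obtain N z where z: "finite N" "\<And>n. z n \<in> level_space v n" "y v = (\<Sum>n\<in>N. z n)"
      by (rule span_Union_decompose) auto
    let ?s = "\<lambda>n. n - int (wt v)" and ?N = "(\<lambda>n. n + int (wt v)) ` N"
    have "(\<Sum>n\<in>?N. if n \<in> ?N then z (?s n) else 0) = (\<Sum>n\<in>N. z n)"
      by (subst sum.reindex) (auto simp: inj_on_def)
    then show ?thesis using z
      by (intro exI[of _ ?N] exI[of _ "\<lambda>n. if n \<in> ?N then z (?s n) else 0"]) (auto simp: subspace_0)
  qed
  then obtain N z where z: "\<And>v. v \<in> t \<Longrightarrow> finite (N v)" "\<And>v n. v \<in> t \<Longrightarrow> z v n \<in> level_space v (n - int (wt v))"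
    "\<And>v n. v \<in> t \<Longrightarrow> n \<notin> N v \<Longrightarrow> z v n = 0" "\<And>v. v \<in> t \<Longrightarrow> y v = (\<Sum>n\<in>N v. z v n)"
    by metis
  define M where "M = (\<Union>v\<in>t. N v)"
  have M: "finite M" using t(1) z(1) by (auto simp: M_def)
  have yM: "y v = (\<Sum>n\<in>M. z v n)" if "v \<in> t" for v
    unfolding z(4)[OF that] using M z(3) that by (intro sum.mono_neutral_left) (auto simp: M_def)
  have ws: "z v n \<in> weight_space n" if "v \<in> t" for v n
    using z(2)[OF that, of n] level_space_weight_space[OF hw[OF that], of "n - int (wt v)"] by auto
  have "(\<Sum>n\<in>M. \<Sum>v\<in>t. z v n) = 0"
    using s by (subst sum.swap) (simp add: yM)
  then have z0: "\<forall>n\<in>M. (\<Sum>v\<in>t. z v n) = 0"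
    by (intro weight_components_unique[OF M] subspace_sum subspace_weight_space ws)
  have "z v n = 0" if "n \<in> M" for n
  proof (cases "n \<ge> 0")
    case True
    show ?thesis
      by (rule level_spaces_independent[OF t, of "\<lambda>v. z v n" "nat n"]) (use z(2) z0 that v True in auto)
  next
    case False
    then show ?thesis using z(2)[OF v, of n] level_space_neg[of "n - int (wt v)" v] by simp
  qed
  then show ?thesis using yM[OF v] by simp
qed

text \<open>
  A functional that reads off the coefficient of \<open>v\<close> and ignores the submodules generated by the
  other basis vectors.  It is defined on all of \<open>V\<close>, before \<open>V\<close> is known to be the sum of these submodules.
\<close>
lemma coordinate_functional:
  assumes v: "v \<in> B"
  obtains \<epsilon> where "Vector_Spaces.linear scale (*) \<epsilon>" "\<epsilon> v = 1"
    "\<And>w y. w \<in> B \<Longrightarrow> w \<noteq> v \<Longrightarrow> y \<in> level_space w (int (wt v) - int (wt w)) \<Longrightarrow> \<epsilon> y = 0"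
proof -
  let ?W = "\<lambda>w. level_space w (int (wt v) - int (wt w))"
  define K where "K = span (\<Union>w\<in>B - {v}. ?W w)"
  have vK: "v \<notin> K"
  proof
    assume "v \<in> K"
    then obtain t y where ty: "finite t" "t \<subseteq> B - {v}" "\<And>w. w \<in> B - {v} \<Longrightarrow> y w \<in> ?W w" "v = (\<Sum>w\<in>t. y w)"
      unfolding K_def by (rule span_Union_decompose) auto
    define z where "z w = (if w = v then - v else y w)" for w
    have "z v = 0"
    proof (rule level_spaces_independent[of "insert v t" z "wt v"])
      have "(\<Sum>w\<in>t. z w) = (\<Sum>w\<in>t. y w)" by (rule sum.cong) (use ty(2) in \<open>auto simp: z_def\<close>)
      then show "(\<Sum>w\<in>insert v t. z w) = 0" using ty by (subst sum.insert) (auto simp: z_def)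
      have "v \<in> level_space v 0" using up_in_level_space[of "{#}" 0 v] by simp
      then show "z w \<in> ?W w" if "w \<in> insert v t" for w
        using that ty(2,3) by (auto simp: z_def intro: subspace_neg)
    qed (use ty v in auto)
    then show False using B_nonzero[OF v] by (simp add: z_def)
  qed
  obtain b where b: "b \<subseteq> K" "independent b" "K \<subseteq> span b" using maximal_independent_subset by blast
  have "span b \<subseteq> K" using b(1) unfolding K_def by (simp add: span_minimal)
  then have "v \<notin> span b" using vK by blast
  then have "independent (insert v b)" using b(2) by (simp add: independent_insertI)
  then obtain \<epsilon> where \<epsilon>: "Vector_Spaces.linear scale (*) \<epsilon>" "\<forall>x\<in>insert v b. \<epsilon> x = (if x = v then 1 else 0)"
    using functional.linear_independent_extend[of "insert v b" "\<lambda>x. if x = v then 1 else 0"] by blast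
  have b0: "\<epsilon> x = 0" if "x \<in> span b" for x
    using that
  proof (induction rule: span_induct_alt)
    case base show ?case using functional.linear_0[OF \<epsilon>(1)] .
  next
    case (step c x y)
    have "\<epsilon> x = 0" using \<epsilon>(2) step(1) \<open>v \<notin> span b\<close> span_base[of x b] by auto
    then show ?case using step(2) by (simp add: functional.linear_add[OF \<epsilon>(1)] functional.linear_scale[OF \<epsilon>(1)])
  qed
  show ?thesis
  proof (rule that[OF \<epsilon>(1)])
    show "\<epsilon> v = 1" using \<epsilon>(2) by simp
    fix w y assume "w \<in> B" "w \<noteq> v" "y \<in> ?W w"
    then have "y \<in> K" unfolding K_def by (intro span_base) auto
    then show "\<epsilon> y = 0" using b(3) b0 by blast
  qed
qed

text \<open>
  For each \<open>v\<close> of weight less than \<open>n\<close>, nondegeneracy provides a vector \<open>y v\<close> in the submodule of \<open>v\<close> on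
  which the lowering words have the same \<open>v\<close>-coordinates as on \<open>x\<close>.  The difference \<open>z\<close> of \<open>x\<close> and
  all \<open>y v\<close> has vanishing coordinates.  So have the \<open>L k z\<close>; as these
  lie in the sum of the submodules by induction, they vanish.  Hence \<open>z\<close> is singular, that is, a
  combination of basis vectors.
\<close>
lemma weight_space_spanned: "x \<in> weight_space (int n) \<Longrightarrow> x \<in> span (\<Union>v\<in>B. level_space v (int n - int (wt v)))"
proof (induction n arbitrary: x rule: less_induct)
  case (less n)
  let ?S = "\<lambda>n. span (\<Union>v\<in>B. level_space v (int n - int (wt v)))"
  define T where "T = {v\<in>B. wt v < n}"
  have "T = (\<Union>m<n. {v\<in>B. wt v = m})" by (auto simp: T_def)
  then have T: "finite T" using finite_B by simp
  have "\<forall>v\<in>T. \<exists>\<epsilon>. Vector_Spaces.linear scale (*) \<epsilon> \<and> \<epsilon> v = 1 \<and>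
    (\<forall>w y. w \<in> B \<longrightarrow> w \<noteq> v \<longrightarrow> y \<in> level_space w (int (wt v) - int (wt w)) \<longrightarrow> \<epsilon> y = 0)"
    by (metis (mono_tags, lifting) T_def coordinate_functional mem_Collect_eq)
  then obtain \<epsilon> where lin: "\<And>v. v \<in> T \<Longrightarrow> Vector_Spaces.linear scale (*) (\<epsilon> v)" and \<epsilon>1: "\<And>v. v \<in> T \<Longrightarrow> \<epsilon> v v = 1"
    and \<epsilon>0: "\<And>v w y. v \<in> T \<Longrightarrow> w \<in> B \<Longrightarrow> w \<noteq> v \<Longrightarrow> y \<in> level_space w (int (wt v) - int (wt w)) \<Longrightarrow> \<epsilon> v y = 0"
    by metis
  have hw: "v \<in> T \<Longrightarrow> highest_weight (of_nat (wt v)) v" "v \<in> T \<Longrightarrow> v \<noteq> 0" for v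
    using highest_weight_B B_nonzero by (auto simp: T_def)
  have "\<forall>v\<in>T. \<exists>y. y \<in> level_space v (int (n - wt v)) \<and> (\<forall>\<kappa>\<in>basis_parts (wt v) (n - wt v). down \<kappa> y = scale (\<epsilon> v (down \<kappa> x)) v)"
  proof
    fix v assume v: "v \<in> T"
    show "\<exists>y. y \<in> level_space v (int (n - wt v)) \<and> (\<forall>\<kappa>\<in>basis_parts (wt v) (n - wt v). down \<kappa> y = scale (\<epsilon> v (down \<kappa> x)) v)"
    proof (rule level_space_prescribed[OF hw[OF v]])
      fix y assume "y \<in> level_space v (int (n - wt v))"
        "\<And>\<kappa>. \<kappa> \<in> basis_parts (wt v) (n - wt v) \<Longrightarrow> down \<kappa> y = scale (\<epsilon> v (down \<kappa> x)) v"
      then show ?thesis by (intro exI[of _ y] conjI ballI)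
    qed
  qed
  then obtain y where y: "\<And>v. v \<in> T \<Longrightarrow> y v \<in> level_space v (int (n - wt v))"
    "\<And>v \<kappa>. v \<in> T \<Longrightarrow> \<kappa> \<in> basis_parts (wt v) (n - wt v) \<Longrightarrow> down \<kappa> (y v) = scale (\<epsilon> v (down \<kappa> x)) v"
    by metis
  have y': "y v \<in> level_space v (int n - int (wt v))" if "v \<in> T" for v
    using y(1)[OF that] that by (simp add: T_def of_nat_diff)
  define z where "z = x - (\<Sum>v\<in>T. y v)"
  have z_wt: "z \<in> weight_space (int n)"
    unfolding z_def
  proof (intro subspace_diff subspace_sum subspace_weight_space less(2))
    fix v assume "v \<in> T"
    then show "y v \<in> weight_space (int n)" using level_space_weight_space[OF hw(1)] y' by fastforce
  qed
  have \<epsilon>z: "\<epsilon> v (down \<kappa> z) = 0" if v: "v \<in> T" and \<kappa>: "level \<kappa> = n - wt v" for v \<kappa>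
  proof (cases "\<kappa> \<in> basis_parts (wt v) (n - wt v)")
    case True
    have "\<epsilon> v (down \<kappa> z) = \<epsilon> v (down \<kappa> x) - (\<Sum>w\<in>T. \<epsilon> v (down \<kappa> (y w)))"
      by (simp add: z_def endo.linear_diff[OF linear_down] endo.linear_sum[OF linear_down]
          functional.linear_diff[OF lin[OF v]] functional.linear_sum[OF lin[OF v]])
    also have "(\<Sum>w\<in>T. \<epsilon> v (down \<kappa> (y w))) = (\<Sum>w\<in>{v}. \<epsilon> v (down \<kappa> (y w)))"
    proof (intro sum.mono_neutral_right ballI)
      fix w assume w: "w \<in> T - {v}"
      have "down \<kappa> (y w) \<in> level_space w (int n - int (wt w) - int (level \<kappa>))"
        using w by (intro down_level_space[OF hw(1)] y') auto
      moreover have "int n - int (wt w) - int (level \<kappa>) = int (wt v) - int (wt w)"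
        using \<kappa> v by (simp add: T_def)
      ultimately show "\<epsilon> v (down \<kappa> (y w)) = 0" using \<epsilon>0[OF v, of w] w by (auto simp: T_def)
    qed (use T v in auto)
    also have "\<dots> = \<epsilon> v (down \<kappa> x)"
      using y(2)[OF v True] by (simp add: functional.linear_scale[OF lin[OF v]] \<epsilon>1[OF v])
    finally show ?thesis by simp
  next
    case False
    \<comment> \<open>a part \<open>1\<close> for \<open>h = 0\<close>: the operator that acts last is \<open>L(1)\<close> on the weight space of \<open>1\<close>\<close>
    then have h: "wt v = 0" "0 \<in># \<kappa>" using \<kappa> by (auto simp: basis_parts_def)
    from multi_member_split[OF this(2)] obtain \<kappa>' where \<kappa>': "\<kappa> = add_mset 0 \<kappa>'" ..
    have "down \<kappa>' z \<in> weight_space (int n - int (level \<kappa>'))" by (rule down_weight_space[OF z_wt])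
    moreover have "int n - int (level \<kappa>') = 1" using \<kappa> \<kappa>' h by simp
    ultimately have "down \<kappa> z = 0" using L_weight_1 by (simp add: \<kappa>' down_add_0)
    then show ?thesis by (simp add: functional.linear_0[OF lin[OF v]])
  qed
  have "L k z = 0" if k: "k > 0" for k
  proof (cases "k \<le> int n")
    case False
    then show ?thesis using L_weight_space[OF z_wt, of k] weights_nonneg[of "int n - k"] by simp
  next
    case True
    define j where "j = nat k - 1"
    define m where "m = nat (int n - k)"
    have jk: "k = int j + 1" "Suc j + m = n" using k True by (auto simp: j_def m_def)
    have "L k z \<in> weight_space (int m)" using L_weight_space[OF z_wt, of k] True by (simp add: m_def)
    then have "L k z \<in> ?S m" by (rule less(1)[rotated]) (use jk in simp)
    then obtain t u where tu: "finite t" "t \<subseteq> B" "\<And>v. v \<in> B \<Longrightarrow> u v \<in> level_space v (int m - int (wt v))" "L k z = (\<Sum>v\<in>t. u v)"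
      by (rule span_Union_decompose) auto
    have "u v = 0" if v: "v \<in> t" for v
    proof (cases "wt v \<le> m")
      case False
      then show ?thesis using tu(3)[of v] tu(2) v level_space_neg[of "int m - int (wt v)" v] by auto
    next
      case wt: True
      have vT: "v \<in> T" using wt tu(2) v jk by (auto simp: T_def)
      show ?thesis
      proof (rule level_space_separated[OF hw[OF vT]])
        show uv: "u v \<in> level_space v (int (m - wt v))" using tu(3)[of v] tu(2) v wt by (auto simp: of_nat_diff)
        fix \<kappa> assume \<kappa>: "level \<kappa> = m - wt v"
        have "down \<kappa> (u v) \<in> level_space v 0" using down_level_space[OF hw(1)[OF vT] uv, of \<kappa>] \<kappa> by simp
        then obtain s where s: "down \<kappa> (u v) = scale s v" by (auto simp: level_space_0)
        have "0 = \<epsilon> v (down \<kappa> (L (int j + 1) z))"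
          by (rule functional_down_straighten[OF lin[OF vT], symmetric, of "n - wt v"]) (use \<epsilon>z[OF vT] \<kappa> jk wt in auto)
        also have "\<dots> = (\<Sum>w\<in>t. \<epsilon> v (down \<kappa> (u w)))"
          by (simp add: jk(1)[symmetric] tu(4) endo.linear_sum[OF linear_down] functional.linear_sum[OF lin[OF vT]])
        also have "\<dots> = (\<Sum>w\<in>{v}. \<epsilon> v (down \<kappa> (u w)))"
        proof (intro sum.mono_neutral_right ballI)
          fix w assume w: "w \<in> t - {v}"
          then have wB: "w \<in> B" using tu(2) by blast
          have "down \<kappa> (u w) \<in> level_space w (int m - int (wt w) - int (level \<kappa>))"
            by (intro down_level_space[OF highest_weight_B[OF wB]] tu(3) wB)
          moreover have "int m - int (wt w) - int (level \<kappa>) = int (wt v) - int (wt w)"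
            using \<kappa> wt by simp
          ultimately show "\<epsilon> v (down \<kappa> (u w)) = 0" using \<epsilon>0[OF vT wB] w by auto
        qed (use tu v in auto)
        also have "\<dots> = s" by (simp add: s functional.linear_scale[OF lin[OF vT]] \<epsilon>1[OF vT])
        finally show "down \<kappa> (u v) = 0" using s by simp
      qed
    qed
    then show ?thesis by (simp add: tu(4))
  qed
  then have "highest_weight (of_nat n) z" using z_wt by (simp add: highest_weight_iff)
  then have "z \<in> span {v\<in>B. wt v = n}" by (rule span_B)
  also have "\<dots> \<subseteq> ?S n"
  proof (rule span_mono, safe)
    fix v assume "v \<in> B" "n = wt v"
    then show "v \<in> (\<Union>u\<in>B. level_space u (int (wt v) - int (wt u)))"
      using up_in_level_space[of "{#}" 0 v] by (intro UN_I[of v]) auto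
  qed
  finally have "z \<in> ?S n" .
  moreover have "(\<Sum>v\<in>T. y v) \<in> ?S n"
    by (intro span_sum span_base UN_I) (auto intro: y' simp: T_def)
  ultimately have "z + (\<Sum>v\<in>T. y v) \<in> ?S n" by (rule span_add)
  then show ?case by (simp add: z_def)
qed

lemma completely_reducible_singular_basis: "completely_reducible"
  unfolding completely_reducible_def
proof (intro exI[of _ "cyclic ` B"] conjI)
  show "\<forall>W\<in>cyclic ` B. irreducible_submodule W"
    using irreducible_cyclic highest_weight_B B_nonzero by blast
  show "internal_direct_sum (cyclic ` B) (\<lambda>W. W)"
  proof (rule internal_direct_sum_imageI)
    show "inj_on cyclic B"
    proof (rule inj_onI, rule ccontr)
      fix v w assume vw: "v \<in> B" "w \<in> B" "cyclic v = cyclic w" "v \<noteq> w"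
      define y where "y u = (if u = v then v else - v)" for u
      have "- v \<in> cyclic w"
        using generator_in_cyclic[of v] unfolding vw(3) by (intro subspace_neg) simp_all
      then have mem: "y u \<in> cyclic u" if "u \<in> {v, w}" for u
        using that generator_in_cyclic[of v] by (cases "u = v") (simp_all add: y_def)
      have "(\<Sum>u\<in>{v, w}. y u) = 0" using vw(4) by (simp add: y_def)
      from cyclic_independent[OF _ _ mem this] have "y v = 0" using vw(1,2) by blast
      then show False using B_nonzero[OF vw(1)] by (simp add: y_def)
    qed
    fix x
    have "weight_space n \<subseteq> span (\<Union>v\<in>B. cyclic v)" for n
    proof (cases "n < 0")
      case True then show ?thesis by (simp add: weights_nonneg span_zero)
    next
      case False
      have "weight_space n \<subseteq> span (\<Union>v\<in>B. level_space v (n - int (wt v)))"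
        using weight_space_spanned[of _ "nat n"] False by auto
      also have "\<dots> \<subseteq> span (\<Union>v\<in>B. cyclic v)" by (rule span_mono) (use level_space_cyclic in blast)
      finally show ?thesis .
    qed
    then have "span (\<Union>n. weight_space n) \<subseteq> span (\<Union>v\<in>B. cyclic v)"
      by (intro span_minimal) auto
    then show "x \<in> span (\<Union>v\<in>B. cyclic v)" using weight_decomposition by blast
  qed (use cyclic_independent in auto)
qed

end

theorem (in graded_virasoro_module) complete_reducibility: "completely_reducible"
proof -
  obtain B wt where "independent B" "\<And>v. v \<in> B \<Longrightarrow> highest_weight (of_nat (wt v)) v"
    "\<And>n. finite {v\<in>B. wt v = n}" "\<And>n x. highest_weight (of_nat n) x \<Longrightarrow> x \<in> span {v\<in>B. wt v = n}"
    using singular_basis_exists by blast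
  then interpret singular_basis scale L c B wt by unfold_locales
  show ?thesis by (rule completely_reducible_singular_basis)
qed

section \<open>Vertex operator algebras\<close>

context vertex_algebra
begin

sublocale modes: vector_space_pair scale scale ..

lemma modes_commute:
  assumes "\<And>i. i \<ge> 0 \<Longrightarrow> Y u i v = 0"
  shows "Y u m (Y v n w) = Y v n (Y u m w)"
proof -
  have l: "Sum_any (\<lambda>i::nat. scale ((-1) ^ i * (of_int 0 gchoose i)) (f i)) = f 0" for f
    by (subst Sum_any.expand_superset[of "{0}"]) (auto simp: gbinomial_0_left)
  have "Y (Y u (int i) v) k w = 0" for i k
    using assms modes.linear_0[OF linear_left] by simp
  then show ?thesis using jacobi[of 0 u m v n w] unfolding l by simp
qed

end

context vertex_operator_algebra
begin

abbreviation L :: "int \<Rightarrow> 'v \<Rightarrow> 'v" where "L \<equiv> virasoro_mode Y \<omega>"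

text \<open>
  If \<open>Y(L(-1) u, z)\<close> has no pole, then neither has \<open>Y(u, z)\<close>, so the modes of \<open>u\<close> commute with those of \<open>\<omega>\<close>
  and \<open>L(0) u = L(0) u\<^bsub>-1\<^esub> \<one> = u\<^bsub>-1\<^esub> L(0) \<one> = 0\<close>.
\<close>
lemma L0_eq_0_if_derivative_regular:
  assumes "\<And>n v. n \<ge> 1 \<Longrightarrow> Y (L (- 1) u) n v = 0"
  shows "L 0 u = 0"
proof -
  have "Y u i v = 0" if "i \<ge> 0" for i v
  proof -
    have "scale (- of_int (i + 1)) (Y u i v) = 0"
      using translation[of u "i + 1" v] assms[of "i + 1" v] that by simp
    moreover have "- of_int (i + 1) \<noteq> (0::complex)"
      using that by (simp only: neg_equal_0_iff_equal of_int_eq_0_iff)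
    ultimately show ?thesis by (metis scale_eq_0_iff)
  qed
  then have "Y u (- 1) (Y \<omega> 1 vac) = Y \<omega> 1 (Y u (- 1) vac)"
    by (intro modes_commute)
  then show ?thesis
    by (simp add: creation virasoro_mode_def modes.linear_0[OF linear_right])
qed

lemma weight_space_kernel: "v \<in> weight_space n \<Longrightarrow> L 0 v = 0 \<Longrightarrow> n \<noteq> 0 \<Longrightarrow> v = 0"
  by (simp add: weight_space_def)

text \<open>
  Going down from weight \<open>-1\<close>, the vector \<open>L(-1) v\<close> is a multiple of the vacuum or zero, whose
  vertex operator has no pole.
\<close>
lemma negative_weight_spaces:
  assumes V0: "weight_space 0 = range (\<lambda>a. scale a vac)" and n: "n < 0"
  shows "weight_space n = {0}"
proof -
  have "v \<in> weight_space (- int k - 1) \<Longrightarrow> v = 0" for k v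
  proof (induction k arbitrary: v)
    case (Suc k)
    have "- int (Suc k) - 1 - (- 1) = - int k - 1" by simp
    with L_weight_space[OF Suc(2), of "- 1"] have "L (- 1) v \<in> weight_space (- int k - 1)" by metis
    then have "L (- 1) v = 0" by (rule Suc(1))
    then have "L 0 v = 0" by (intro L0_eq_0_if_derivative_regular) (simp add: modes.linear_0[OF linear_left])
    with Suc(2) show ?case by (rule weight_space_kernel) simp
  next
    case 0
    then have "L (- 1) v \<in> weight_space 0" using L_weight_space[OF 0, of "- 1"] by simp
    then obtain a where "L (- 1) v = scale a vac" using V0 by auto
    then have "L 0 v = 0" by (intro L0_eq_0_if_derivative_regular) (simp add: modes.linear_scale[OF linear_left] vacuum)
    with 0 show ?case by (rule weight_space_kernel) simp
  qed
  from this[of _ "nat (- n) - 1"] have "weight_space n \<subseteq> {0}" using n by auto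
  moreover have "0 \<in> weight_space n" by (simp add: weight_space_def)
  ultimately show ?thesis by blast
qed

lemma L_vac: "L (- 1) vac = 0"
  by (simp add: virasoro_mode_def creation)

end

theorem proposition3p3:
  fixes scale :: "complex \<Rightarrow> 'v::ab_group_add \<Rightarrow> 'v"
    and Y :: "'v \<Rightarrow> int \<Rightarrow> 'v \<Rightarrow> 'v" and vac \<omega> :: 'v and c :: complex
  defines "L \<equiv> virasoro_mode Y \<omega>"
  defines "V \<equiv> virasoro_module.weight_space scale L"
  assumes "vertex_operator_algebra scale Y vac \<omega> c"
    and "vertex_algebra.simple scale Y"
    and "V 0 = range (\<lambda>a. scale a vac)"
    and "L 1 ` V 1 = {0}"
    and "c \<in> \<real>" and "Re c > 1"
  shows "virasoro_module.completely_reducible scale L"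
proof -
  interpret vertex_operator_algebra scale Y vac \<omega> c by fact
  have V0: "weight_space 0 = range (\<lambda>a. scale a vac)" and V1: "virasoro_mode Y \<omega> 1 ` weight_space 1 = {0}"
    using assms(5,6) by (simp_all add: V_def L_def)
  interpret graded_virasoro_module scale "virasoro_mode Y \<omega>" c
  proof unfold_locales
    show "v \<in> weight_space 0 \<Longrightarrow> virasoro_mode Y \<omega> (- 1) v = 0" for v
      using V0 L_vac by (auto simp: L_scale)
    show "v \<in> weight_space 1 \<Longrightarrow> virasoro_mode Y \<omega> 1 v = 0" for v
      using V1 by blast
  qed (fact assms grading finite_dimensional_weight_space negative_weight_spaces[OF V0])+
  show ?thesis unfolding L_def by (rule complete_reducibility)
qed

end
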